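(* Let $G^{\pi}$ be a clique-whiskered graph (with clique vertex partition $\pi=\{A_1,\dots,A_t\}$ of $G$, $A_i=\{w_{i1},\dots,w_{ir_i}\}$, and added vertices $v_1,\dots,v_t$) which is a Cohen-Macaulay chordal graph. Then for each $k\ge 0$, the ideal $\mathrm{HS}_k(J(G^{\pi}))$ has linear quotients with respect to a linear order $>$ on its set of minimal monomial generators $\mathcal G(\mathrm{HS}_k(J(G^{\pi})))$ which satisfies the following property: if $\alpha\in\mathcal G(\mathrm{HS}_k(J(G^{\pi})))$ is such that $v_i\mid\alpha$ and $w_{ij}\nmid\alpha$ for some $i\in\{1,\dots,t\}$ and $j\in\{1,\dots,r_i\}$, then $\alpha'=w_{ij}\frac{\alpha}{v_i}\in\mathcal G(\mathrm{HS}_k(J(G^{\pi})))$ and $\alpha'>\alpha$.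
   Context: Clique-whiskered graphs: let $G$ be a finite simple graph with vertex set $V_G$ and edge set $E_G$. A clique of $G$ is a set of vertices inducing a complete subgraph. A clique vertex partition of $G$ is a set $\pi=\{A_1,\dots,A_t\}$ of disjoint cliques of $G$ whose union is $V_G$; write $A_i=\{w_{i1},\dots,w_{ir_i}\}$. The clique-whiskered graph $G^{\pi}$ has vertex set $V_G\sqcup\{v_1,\dots,v_t\}$ and edge set $E_G\sqcup\bigcup_{i=1}^t\{\{v_i,w_{ij}\} : 1\le j\le r_i\}$. By the Herzog-Hibi-Zheng classification, a chordal graph is Cohen-Macaulay if and only if it is a clique-whiskered graph, so that Cohen-Macaulay chordal graphs are written as $G^\pi$. Let $\mathbb{K}$ be a field and identify the vertices of a graph $H$ with the variables of a polynomial ring $R$ over $\mathbb{K}$. A vertex cover of $H$ is a set of vertices meeting every edge; it is minimal if it is minimal with respect to inclusion. For a set $A$ of vertices, $\mathbf{x}_A$ is the product of the variables in $A$. The vertex cover ideal is $J(H)=\langle \mathbf{x}_{\mathcal C} : \mathcal C\text{ a minimal vertex cover of }H\rangle$. The graph $H$ is Cohen-Macaulay if $R/I(H)$ is Cohen-Macaulay, where $I(H)=\langle ab : \{a,b\}\text{ an edge of }H\rangle$; it is chordal if it has no induced cycle of length at least $4$. For a monomial ideal $I$ with $\mathbb{N}^n$-graded minimal free resolution $0\to F_r\to\cdots\to F_0\to I\to 0$, $F_k=\bigoplus_j R(-\mathbf a_{kj})$, the $k$-th homological shift ideal $\mathrm{HS}_k(I)$ is the monomial ideal generated by the monomials $\mathbf{x}^{\mathbf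 a_{kj}}$ over all $k$-th multigraded shifts $\mathbf a_{kj}$ of $I$ (so $\mathrm{HS}_0(I)=I$, and $\mathrm{HS}_k(I)=0$ if $k>\mathrm{pd}(I)$; the zero ideal satisfies all assertions vacuously). A monomial ideal $I$ has linear quotients with respect to a total order $m_1>m_2>\dots>m_r$ on its minimal monomial generating set $\mathcal G(I)$ if each colon ideal $\langle m_1,\dots,m_j\rangle:m_{j+1}$, $1\le j\le r-1$, is generated by variables. *)

theory Defs
  imports
    Complex_Main
    "HOL-Library.Poly_Mapping"
    "HOL-Library.Extended_Nat"
    "HOL-Library.Disjoint_Sets"
    "HOL-Algebra.QuotRing"
    "HOL-Algebra.Ring_Divisibility"
    "Jordan_Normal_Form.Matrix"
begin

section \<open>Graphs\<close>

type_synonym 'a graph = "'a set \<times> 'a set set"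

abbreviation verts :: "'a graph \<Rightarrow> 'a set" where "verts \<equiv> fst"
abbreviation edges :: "'a graph \<Rightarrow> 'a set set" where "edges \<equiv> snd"

definition finite_simple_graph :: "'a graph \<Rightarrow> bool" where
  "finite_simple_graph G \<longleftrightarrow>
     finite (verts G) \<and> (\<forall>e\<in>edges G. e \<subseteq> verts G \<and> card e = 2)"

definition clique :: "'a graph \<Rightarrow> 'a set \<Rightarrow> bool" where
  "clique G A \<longleftrightarrow>
     A \<subseteq> verts G \<and> (\<forall>u\<in>A. \<forall>v\<in>A. u \<noteq> v \<longrightarrow> {u, v} \<in> edges G)"

text \<open>The library's \<^const>\<open>partition_on\<close> is not used, because it excludes the empty set,
  which is a clique.\<close>

definition clique_vertex_partition :: "'a graph \<Rightarrow> 'a set set \<Rightarrow> bool" where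
  "clique_vertex_partition G P \<longleftrightarrow>
     (\<forall>A\<in>P. clique G A) \<and> disjoint P \<and> \<Union>P = verts G"

text \<open>A vertex \<open>w\<close> of \<open>G\<close> becomes \<open>Inl w\<close>; the vertex added for the clique \<open>A\<close> is \<open>Inr A\<close>.\<close>

definition clique_whiskered :: "'a graph \<Rightarrow> 'a set set \<Rightarrow> ('a + 'a set) graph" where
  "clique_whiskered G P =
     (Inl ` verts G \<union> Inr ` P,
      (\<lambda>e. Inl ` e) ` edges G \<union> {{Inr A, Inl w} |A w. A \<in> P \<and> w \<in> A})"

text \<open>The list \<open>vs\<close> is the sequence of vertices around the cycle.\<close>

definition induced_cycle :: "'a graph \<Rightarrow> 'a list \<Rightarrow> bool" where
  "induced_cycle G vs \<longleftrightarrow>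
     3 \<le> length vs \<and> distinct vs \<and> set vs \<subseteq> verts G \<and>
     (\<forall>i j. i < j \<and> j < length vs \<longrightarrow>
        ({vs ! i, vs ! j} \<in> edges G \<longleftrightarrow> j = Suc i \<or> i = 0 \<and> Suc j = length vs))"

definition chordal :: "'a graph \<Rightarrow> bool" where
  "chordal G \<longleftrightarrow> \<not> (\<exists>vs. induced_cycle G vs \<and> 4 \<le> length vs)"

definition vertex_cover :: "'a graph \<Rightarrow> 'a set \<Rightarrow> bool" where
  "vertex_cover G C \<longleftrightarrow> C \<subseteq> verts G \<and> (\<forall>e\<in>edges G. e \<inter> C \<noteq> {})"

definition minimal_vertex_cover :: "'a graph \<Rightarrow> 'a set \<Rightarrow> bool" where
  "minimal_vertex_cover G C \<longleftrightarrow> vertex_cover G C \<and> (\<forall>D. D \<subset> C \<longrightarrow> \<not> vertex_cover G D)"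


section \<open>Polynomial rings and monomial ideals\<close>

text \<open>Exponent vectors have type \<open>'x \<Rightarrow>\<^sub>0 nat\<close>. A monomial is represented by its exponent vector
  wherever no ring element is needed; a variable divides it iff it lies in its
  \<^const>\<open>Poly_Mapping.keys\<close>.\<close>

type_synonym ('x, 'k) mpoly = "('x \<Rightarrow>\<^sub>0 nat) \<Rightarrow>\<^sub>0 'k"

definition mpoly_ring :: "'x set \<Rightarrow> ('x, 'k::field) mpoly ring" where
  "mpoly_ring X =
     \<lparr>carrier = {p. \<forall>m\<in>Poly_Mapping.keys p. Poly_Mapping.keys m \<subseteq> X},
      mult = (*), one = 1, zero = 0, add = (+)\<rparr>"

definition mon :: "('x \<Rightarrow>\<^sub>0 nat) \<Rightarrow> ('x, 'k::field) mpoly" where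
  "mon m = Poly_Mapping.single m 1"

definition var :: "'x \<Rightarrow> ('x, 'k::field) mpoly" where
  "var x = mon (Poly_Mapping.single x 1)"

definition colon :: "'x set \<Rightarrow> ('x, 'k::field) mpoly set \<Rightarrow> ('x, 'k) mpoly \<Rightarrow> ('x, 'k) mpoly set" where
  "colon X I f = {p \<in> carrier (mpoly_ring X). p * f \<in> I}"

definition min_gens :: "'x set \<Rightarrow> ('x, 'k::field) mpoly set \<Rightarrow> ('x \<Rightarrow>\<^sub>0 nat) set" where
  "min_gens X I =
     (THE S. (\<forall>m\<in>S. Poly_Mapping.keys m \<subseteq> X) \<and>
        Idl\<^bsub>mpoly_ring X\<^esub> ((mon :: _ \<Rightarrow> ('x, 'k) mpoly) ` S) = I \<and>
        (\<forall>T. T \<subset> S \<longrightarrow> Idl\<^bsub>mpoly_ring X\<^esub> ((mon :: _ \<Rightarrow> ('x, 'k) mpoly) ` T) \<noteq> I))"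

text \<open>A pair \<open>(u, v) \<in> gt\<close> means \<open>u > v\<close>; the list \<open>ms\<close> enumerates the generators in decreasing
  order, with \<open>ms ! j\<close> being \<open>m\<^sub>j\<^sub>+\<^sub>1\<close>.\<close>

definition linear_quotients_wrt ::
    "'x set \<Rightarrow> ('x, 'k::field) mpoly set \<Rightarrow> (('x \<Rightarrow>\<^sub>0 nat) \<times> ('x \<Rightarrow>\<^sub>0 nat)) set \<Rightarrow> bool" where
  "linear_quotients_wrt X I gt \<longleftrightarrow>
     strict_linear_order_on (min_gens X I) gt \<and>
     (\<exists>ms. set ms = min_gens X I \<and> sorted_wrt (\<lambda>u v. (u, v) \<in> gt) ms \<and>
        (\<forall>j. 1 \<le> j \<and> j < length ms \<longrightarrow>
           (\<exists>W\<subseteq>X. colon X (Idl\<^bsub>mpoly_ring X\<^esub> (mon ` set (take j ms))) (mon (ms ! j))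
                   = Idl\<^bsub>mpoly_ring X\<^esub> ((var :: _ \<Rightarrow> ('x, 'k) mpoly) ` W))))"

definition cover_ideal :: "'x graph \<Rightarrow> ('x, 'k::field) mpoly set" where
  "cover_ideal H = Idl\<^bsub>mpoly_ring (verts H)\<^esub> {\<Prod>v\<in>C. var v |C. minimal_vertex_cover H C}"

definition edge_ideal :: "'x graph \<Rightarrow> ('x, 'k::field) mpoly set" where
  "edge_ideal H = Idl\<^bsub>mpoly_ring (verts H)\<^esub> {var a * var b |a b. {a, b} \<in> edges H}"


section \<open>Cohen--Macaulay rings and graphs\<close>

definition regular_sequence :: "('r, 'm) ring_scheme \<Rightarrow> 'r list \<Rightarrow> bool" where
  "regular_sequence A fs \<longleftrightarrow>
     set fs \<subseteq> carrier A \<and>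
     (\<forall>i<length fs. \<forall>a\<in>carrier A.
        fs ! i \<otimes>\<^bsub>A\<^esub> a \<in> Idl\<^bsub>A\<^esub> (set (take i fs)) \<longrightarrow> a \<in> Idl\<^bsub>A\<^esub> (set (take i fs))) \<and>
     Idl\<^bsub>A\<^esub> (set fs) \<noteq> carrier A"

definition ideal_depth :: "('r, 'm) ring_scheme \<Rightarrow> 'r set \<Rightarrow> enat" where
  "ideal_depth A P = Sup {enat (length fs) |fs. regular_sequence A fs \<and> set fs \<subseteq> P}"

definition height :: "('r, 'm) ring_scheme \<Rightarrow> 'r set \<Rightarrow> enat" where
  "height A P =
     Sup {enat n |n. \<exists>Q. (\<forall>i\<le>n. primeideal (Q i) A) \<and> (\<forall>i<n. Q i \<subset> Q (Suc i)) \<and> Q n = P}"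

text \<open>For a maximal ideal \<open>P\<close> of a Noetherian ring \<open>A\<close>, the depth of the local ring \<open>A\<^sub>P\<close> is the
  maximal length of a regular sequence on \<open>A\<close> in \<open>P\<close>, and its dimension is the height of \<open>P\<close>;
  this is Eisenbud's definition of a Cohen--Macaulay ring.\<close>

definition cohen_macaulay :: "('r, 'm) ring_scheme \<Rightarrow> bool" where
  "cohen_macaulay A \<longleftrightarrow>
     cring A \<and> noetherian_ring A \<and> (\<forall>P. maximalideal P A \<longrightarrow> ideal_depth A P = height A P)"

definition cohen_macaulay_graph :: "'k::field itself \<Rightarrow> 'x graph \<Rightarrow> bool" where
  "cohen_macaulay_graph K H \<longleftrightarrow>
     cohen_macaulay (mpoly_ring (verts H) Quot (edge_ideal H :: ('x, 'k) mpoly set))"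


section \<open>Multigraded minimal free resolutions and homological shift ideals\<close>

definition free_module :: "'x set \<Rightarrow> nat \<Rightarrow> ('x, 'k::field) mpoly vec set" where
  "free_module X n = {v \<in> carrier_vec n. \<forall>i<n. v $ i \<in> carrier (mpoly_ring X)}"

text \<open>In a complex \<open>\<dots> \<rightarrow> F\<^sub>1 \<rightarrow> F\<^sub>0 \<rightarrow> R\<close>, the list \<open>a k\<close> holds the multidegrees of the basis of
  \<open>F\<^sub>k\<close>, so that \<open>F\<^sub>k\<close> is the direct sum of the \<open>R(-a k ! j)\<close>. The matrix \<open>d 0\<close> is the augmentation
  \<open>F\<^sub>0 \<rightarrow> R\<close> and \<open>d (Suc k)\<close> is the differential from \<open>F\<^sub>k\<^sub>+\<^sub>1\<close> to \<open>F\<^sub>k\<close>; hence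
  \<open>target_shifts a k\<close> are the multidegrees of the basis of the codomain of \<open>d k\<close>.\<close>

fun target_shifts :: "(nat \<Rightarrow> ('x \<Rightarrow>\<^sub>0 nat) list) \<Rightarrow> nat \<Rightarrow> ('x \<Rightarrow>\<^sub>0 nat) list" where
  "target_shifts a 0 = [0]"
| "target_shifts a (Suc k) = a k"

text \<open>The third clause of the next definition says that every \<open>d k\<close> is a matrix over \<open>R\<close> which
  preserves multidegrees.\<close>

definition multigraded_maps ::
    "'x set \<Rightarrow> (nat \<Rightarrow> ('x \<Rightarrow>\<^sub>0 nat) list) \<Rightarrow> (nat \<Rightarrow> ('x, 'k::field) mpoly mat) \<Rightarrow> bool" where
  "multigraded_maps X a d \<longleftrightarrow>
     (\<forall>k. \<forall>s\<in>set (a k). Poly_Mapping.keys s \<subseteq> X) \<and>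
     (\<forall>k. d k \<in> carrier_mat (length (target_shifts a k)) (length (a k))) \<and>
     (\<forall>k. \<forall>i<length (target_shifts a k). \<forall>j<length (a k).
        d k $$ (i, j) \<in> carrier (mpoly_ring X) \<and>
        (\<forall>m\<in>Poly_Mapping.keys (d k $$ (i, j)). m + target_shifts a k ! i = a k ! j))"

definition multigraded_free_resolution ::
    "'x set \<Rightarrow> ('x, 'k::field) mpoly set \<Rightarrow> (nat \<Rightarrow> ('x \<Rightarrow>\<^sub>0 nat) list)
       \<Rightarrow> (nat \<Rightarrow> ('x, 'k) mpoly mat) \<Rightarrow> bool" where
  "multigraded_free_resolution X I a d \<longleftrightarrow>
     multigraded_maps X a d \<and>
     (\<exists>r. \<forall>k>r. a k = []) \<and>
     (\<lambda>v. (d 0 *\<^sub>v v) $ 0) ` free_module X (length (a 0)) = I \<and>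
     (\<forall>k. {v \<in> free_module X (length (a k)). d k *\<^sub>v v = 0\<^sub>v (length (target_shifts a k))}
          = (\<lambda>v. d (Suc k) *\<^sub>v v) ` free_module X (length (a (Suc k))))"

text \<open>Minimality: the image of each differential \<open>d (Suc k)\<close> lies in the homogeneous maximal ideal
  times its codomain, i.e. its entries have zero constant coefficient.\<close>

definition minimal_multigraded_free_resolution ::
    "'x set \<Rightarrow> ('x, 'k::field) mpoly set \<Rightarrow> (nat \<Rightarrow> ('x \<Rightarrow>\<^sub>0 nat) list)
       \<Rightarrow> (nat \<Rightarrow> ('x, 'k) mpoly mat) \<Rightarrow> bool" where
  "minimal_multigraded_free_resolution X I a d \<longleftrightarrow>
     multigraded_free_resolution X I a d \<and>
     (\<forall>k. \<forall>i<length (a k). \<forall>j<length (a (Suc k)).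
        Poly_Mapping.lookup (d (Suc k) $$ (i, j)) 0 = 0)"

text \<open>The minimal resolution is unique up to isomorphism, so it does not matter which one provides
  the shifts.\<close>

definition multigraded_shifts ::
    "'x set \<Rightarrow> nat \<Rightarrow> ('x, 'k::field) mpoly set \<Rightarrow> ('x \<Rightarrow>\<^sub>0 nat) set" where
  "multigraded_shifts X k I =
     {s. \<exists>a d. minimal_multigraded_free_resolution X I a d \<and> s \<in> set (a k)}"

definition HS :: "'x set \<Rightarrow> nat \<Rightarrow> ('x, 'k::field) mpoly set \<Rightarrow> ('x, 'k) mpoly set" where
  "HS X k I = Idl\<^bsub>mpoly_ring X\<^esub> (mon ` multigraded_shifts X k I)"

end

theory Submission
  imports Defs "HOL-Library.Nat_Bijection" "HOL-Library.Product_Lexorder"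
begin

text \<open>The minimal vertex covers of the whiskered graph correspond to the independent sets \<open>T\<close> of \<open>G\<close>: take all
  vertices of \<open>G\<close> outside \<open>T\<close> and the whiskers of the cliques that meet \<open>T\<close>. The cubes \<open>[T, T \<union> F]\<close> in the face
  poset of the independence complex, labelled by least common multiples, support a minimal free resolution of
  the cover ideal, since in each multidegree they form the cubical complex of a link, which is acyclic. The
  comparison maps between a minimal resolution and this one compose to the identity modulo the variables, so the
  \<open>k\<close>-th shifts are exactly the labels of the \<open>k\<close>-dimensional cubes.

  The shifts are sorted first by \<open>T\<close>, smaller sets coming first. The shifts with the same \<open>T\<close> are sorted by their
  lexicographically largest \<open>F\<close>, with respect to a perfect elimination ordering; an exchange argument in the chordal
  graph \<open>G\<close> then shows that the colon ideals are generated by variables.\<close>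

subsection \<open>Perfect elimination orderings of chordal graphs\<close>

text \<open>A degree-preserving map between multigraded free modules is a matrix of scalars, because
  the multidegrees of source and target fix the monomial in each entry. The homological algebra is
  therefore linear algebra over the field, one multidegree at a time. The shifts of an ideal are
  collected over all its minimal resolutions, so complexes have to be compared; but only the sets of
  degrees matter, so it suffices that a composite of comparison maps has ones on its diagonal, and
  no inverse is constructed.

  Two properties of the labels shape the combinatorics. An independent set meets each clique at most
  once, so all \<open>k\<close>-dimensional cubes have labels of the same size; the labels are thus
  an antichain and form the minimal generating set. On the other hand, a label determines
  \<open>T\<close> but not \<open>F\<close>, since only the cliques met by
  \<open>T \<union> F\<close> enter it. Hence a label is ranked by its best \<open>F\<close>, and
  the exchange argument uses this maximality to ensure that the incoming vertex brings a new
  clique.\<close>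

definition chordal_on :: "('a \<Rightarrow> 'a \<Rightarrow> bool) \<Rightarrow> 'a set \<Rightarrow> bool" where
  "chordal_on R W \<longleftrightarrow> \<not> (\<exists>vs. 4 \<le> length vs \<and> distinct vs \<and> set vs \<subseteq> W \<and>
     (\<forall>i j. i < j \<and> j < length vs \<longrightarrow>
        (R (vs ! i) (vs ! j) \<longleftrightarrow> j = Suc i \<or> i = 0 \<and> Suc j = length vs)))"

definition simplicial :: "('a \<Rightarrow> 'a \<Rightarrow> bool) \<Rightarrow> 'a set \<Rightarrow> 'a \<Rightarrow> bool" where
  "simplicial R W x \<longleftrightarrow> (\<forall>y\<in>W. \<forall>z\<in>W. R x y \<and> R x z \<and> y \<noteq> z \<longrightarrow> R y z)"

definition walk :: "('a \<Rightarrow> 'a \<Rightarrow> bool) \<Rightarrow> 'a set \<Rightarrow> 'a \<Rightarrow> 'a \<Rightarrow> 'a list \<Rightarrow> bool" where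
  "walk R Q a b qs \<longleftrightarrow> qs \<noteq> [] \<and> hd qs = a \<and> last qs = b \<and> set qs \<subseteq> Q \<and>
     (\<forall>i. Suc i < length qs \<longrightarrow> R (qs ! i) (qs ! Suc i))"

lemma chordal_on_subset: "chordal_on R W \<Longrightarrow> W' \<subseteq> W \<Longrightarrow> chordal_on R W'"
  unfolding chordal_on_def by (meson subset_trans)

lemma walk_single: "a \<in> Q \<Longrightarrow> walk R Q a a [a]"
  by (simp add: walk_def)

lemma walk_snoc:
  assumes w: "walk R Q a b qs" and "R b c" "c \<in> Q"
  shows "walk R Q a c (qs @ [c])"
  unfolding walk_def
proof (intro conjI allI impI)
  fix i assume i: "Suc i < length (qs @ [c])"
  show "R ((qs @ [c]) ! i) ((qs @ [c]) ! Suc i)"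
  proof (cases "Suc i < length qs")
    case True
    then show ?thesis using w by (simp add: walk_def nth_append)
  next
    case False
    then have "i = length qs - 1" "qs \<noteq> []" using i w by (auto simp: walk_def)
    then have "(qs @ [c]) ! i = b" "(qs @ [c]) ! Suc i = c"
      using w by (simp_all add: walk_def nth_append last_conv_nth)
    then show ?thesis using assms(2) by simp
  qed
qed (use assms in \<open>simp_all add: walk_def\<close>)

text \<open>The part strictly between positions \<open>i\<close> and \<open>m\<close> is cut out.
  The value \<open>m = length qs\<close> is allowed and means cutting off the whole tail after
  \<open>i\<close>, which requires that the walk has already reached \<open>b\<close>.\<close>

lemma walk_shortcut:
  assumes w: "walk R Q a b qs" and im: "i < m" "m \<le> length qs"
    and edge: "m < length qs \<Longrightarrow> R (qs ! i) (qs ! m)" and last: "m = length qs \<Longrightarrow> qs ! i = b"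
  shows "walk R Q a b (take (Suc i) qs @ drop m qs)"
  unfolding walk_def
proof (intro conjI allI impI)
  have i: "i < length qs" using im by simp
  have take: "take (Suc i) qs \<noteq> []" "last (take (Suc i) qs) = qs ! i"
    using i by (simp_all add: take_Suc_conv_app_nth)
  show "take (Suc i) qs @ drop m qs \<noteq> []" using take by simp
  show "hd (take (Suc i) qs @ drop m qs) = a" using w take by (simp add: walk_def)
  show "last (take (Suc i) qs @ drop m qs) = b"
    using w take im last by (cases "m = length qs") (auto simp: walk_def)
  show "set (take (Suc i) qs @ drop m qs) \<subseteq> Q"
    using w set_take_subset[of "Suc i" qs] set_drop_subset[of m qs] by (auto simp: walk_def)
  fix l assume l: "Suc l < length (take (Suc i) qs @ drop m qs)"
  consider "l < i" | "l = i" | "i < l" by linarith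
  then show "R ((take (Suc i) qs @ drop m qs) ! l) ((take (Suc i) qs @ drop m qs) ! Suc l)"
  proof cases
    case 1
    then show ?thesis using w i by (simp add: walk_def nth_append)
  next
    case 2
    then show ?thesis using l i edge by (simp add: nth_append)
  next
    case 3
    define t where "t = m + (l - Suc i)"
    have "Suc t < length qs" using l 3 i im by (simp add: t_def)
    moreover have "Suc l - Suc i = Suc (l - Suc i)" using 3 by simp
    ultimately show ?thesis using w l 3 i by (simp add: walk_def nth_append t_def)
  qed
qed

text \<open>A repeated vertex or a chord would give a shortcut. Minimality allows only shortcuts
  that remove nothing, which is the inequality \<open>m \<le> Suc i\<close> in
  \<open>short\<close>.\<close>

lemma shortest_walk_induced:
  assumes w: "walk R Q a b qs" and min: "\<And>qs'. walk R Q a b qs' \<Longrightarrow> length qs \<le> length qs'"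
  shows "distinct qs" and "i < j \<Longrightarrow> j < length qs \<Longrightarrow> R (qs ! i) (qs ! j) \<longleftrightarrow> j = Suc i"
proof -
  have short: "m \<le> Suc i" if "i < m" "m \<le> length qs" "m < length qs \<Longrightarrow> R (qs ! i) (qs ! m)"
    "m = length qs \<Longrightarrow> qs ! i = b" for i m
    using min[OF walk_shortcut[OF w that]] that(1,2) by simp
  show "distinct qs"
    unfolding distinct_conv_nth
  proof (intro allI impI)
    have ne: "qs ! i \<noteq> qs ! j" if ij: "i < j" "j < length qs" for i j
    proof
      assume eq: "qs ! i = qs ! j"
      \<comment> \<open>From a repetition one jumps from \<open>i\<close> to the successor of
        \<open>j\<close>, or ends at \<open>i\<close> when \<open>j\<close> is the last
        position.\<close>
      have "Suc j \<le> Suc i"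
      proof (rule short)
        show "R (qs ! i) (qs ! Suc j)" if "Suc j < length qs" using w that eq by (simp add: walk_def)
        show "qs ! i = b" if "Suc j = length qs"
        proof -
          have "qs \<noteq> []" "last qs = b" using w by (simp_all add: walk_def)
          then have "qs ! (length qs - 1) = b" by (simp add: last_conv_nth)
          moreover have "length qs - 1 = j" using that by simp
          ultimately show ?thesis using eq by simp
        qed
      qed (use ij in simp_all)
      then show False using ij by simp
    qed
    show "qs ! i \<noteq> qs ! j" if "i < length qs" "j < length qs" "i \<noteq> j" for i j
      using ne[of i j] ne[of j i] that by (cases "i < j") auto
  qed
  show "R (qs ! i) (qs ! j) \<longleftrightarrow> j = Suc i" if "i < j" "j < length qs"
    using short[of i j] that w by (auto simp: walk_def)
qed

text \<open>Dirac's theorem. The component \<open>C\<close> of a non-neighbour of \<open>v\<close> has a clique \<open>S\<close> of attachments to the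
  neighbourhood of \<open>v\<close>, since a shortest path through \<open>C\<close> between two non-adjacent vertices of \<open>S\<close> would close up
  with \<open>v\<close> to an induced cycle.\<close>

lemma simplicial_nonneighbour:
  assumes sym: "\<And>x y. R x y \<Longrightarrow> R y x" and irr: "\<And>x. \<not> R x x"
    and "finite W" "chordal_on R W" "v \<in> W" "u \<in> W" "u \<noteq> v" "\<not> R v u"
  shows "\<exists>x\<in>W. simplicial R W x \<and> x \<noteq> v \<and> \<not> R v x"
  using assms(3-)
proof (induction "card W" arbitrary: W v u rule: less_induct)
  case less
  define A where "A = {w \<in> W. w \<noteq> v \<and> \<not> R v w}"
  define step where "step x y \<longleftrightarrow> x \<in> A \<and> y \<in> A \<and> R x y" for x y
  define C where "C = {w. step\<^sup>*\<^sup>* u w}"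
  define S where "S = {s \<in> W. R v s \<and> (\<exists>c\<in>C. R s c)}"
  have uA: "u \<in> A" using less.prems by (simp add: A_def)
  have CA: "C \<subseteq> A"
  proof
    fix c assume "c \<in> C"
    then have "step\<^sup>*\<^sup>* u c" by (simp add: C_def)
    then show "c \<in> A" by (induction rule: rtranclp_induct) (use uA in \<open>simp_all add: step_def\<close>)
  qed
  have uC: "u \<in> C" by (simp add: C_def)
  have nbr: "w \<in> C \<union> S" if c: "c \<in> C" and w: "w \<in> W" "R c w" for c w
  proof (cases "R v w")
    case True
    then show ?thesis using c w sym by (auto simp: S_def)
  next
    case False
    have "c \<in> A" using c CA by blast
    then have "w \<noteq> v" using w(2) sym by (auto simp: A_def)
    then have "step c w" using \<open>c \<in> A\<close> w False by (simp add: step_def A_def)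
    then show ?thesis using c by (simp add: C_def rtranclp.rtrancl_into_rtrancl)
  qed
  have walk_C: "\<exists>qs. walk R (insert a (insert b C)) a b qs"
    if "c \<in> C" "c' \<in> C" "R a c" "R c' b" for a b c c'
  proof -
    have stepsym: "step x y \<Longrightarrow> step y x" for x y using sym by (auto simp: step_def)
    let ?Q = "insert a (insert b C)"
    have rev_step: "step\<^sup>*\<^sup>* z u" if "step\<^sup>*\<^sup>* u z" for z
      using that
    proof (induction rule: rtranclp_induct)
      case (step y z)
      then show ?case using stepsym[OF step(2)] by (rule_tac converse_rtranclp_into_rtranclp)
    qed simp
    have "step\<^sup>*\<^sup>* c c'"
      using rev_step[of c] that(1,2) by (metis C_def mem_Collect_eq rtranclp_trans)
    then have "c' \<in> C \<and> (\<exists>qs. walk R ?Q a c' qs)"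
    proof (induction rule: rtranclp_induct)
      case base
      have "walk R ?Q a a [a]" by (rule walk_single) simp
      from walk_snoc[OF this that(3)] show ?case using that(1) by blast
    next
      case (step y z)
      have "step\<^sup>*\<^sup>* u z" using step by (metis C_def mem_Collect_eq rtranclp.rtrancl_into_rtrancl)
      then have "z \<in> C" by (simp add: C_def)
      obtain qs where "walk R ?Q a y qs" using step by blast
      then have "walk R ?Q a z (qs @ [z])"
        by (rule walk_snoc) (use step(2) \<open>z \<in> C\<close> in \<open>simp_all add: step_def\<close>)
      then show ?case using \<open>z \<in> C\<close> by blast
    qed
    then obtain qs where "walk R ?Q a c' qs" by blast
    then have "walk R ?Q a b (qs @ [b])" by (rule walk_snoc) (use that(4) in simp_all)
    then show ?thesis by blast
  qed
  have S_clique: "R a b" if a: "a \<in> S" and b: "b \<in> S" and ne: "a \<noteq> b" for a b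
  proof (rule ccontr)
    assume nR: "\<not> R a b"
    let ?Q = "insert a (insert b C)"
    obtain c c' where "c \<in> C" "R a c" "c' \<in> C" "R b c'" using a b by (auto simp: S_def)
    then obtain qs0 where "walk R ?Q a b qs0" using walk_C[of c c' a b] sym[of b c'] by auto
    from ex_has_least_nat[of "walk R ?Q a b", OF this, of length]
    obtain qs where w: "walk R ?Q a b qs" and min: "\<And>qs'. walk R ?Q a b qs' \<Longrightarrow> length qs \<le> length qs'"
      by blast
    note ind = shortest_walk_induced[OF w min]
    have ends: "qs \<noteq> []" "qs ! 0 = a" "qs ! (length qs - 1) = b"
      using w by (auto simp: walk_def hd_conv_nth last_conv_nth)
    have len: "3 \<le> length qs"
    proof (rule ccontr)
      assume "\<not> 3 \<le> length qs"
      moreover have "length qs \<noteq> 0" using ends(1) by simp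
      ultimately consider "length qs = 1" | "length qs = 2" by linarith
      then show False
      proof cases
        case 1
        then show False using ends ne by simp
      next
        case 2
        then have "R (qs ! 0) (qs ! 1)" using w by (simp add: walk_def)
        then show False using ends 2 nR by simp
      qed
    qed
    have inner: "qs ! k \<in> C" if "0 < k" "k < length qs - 1" for k
    proof -
      have "k < length qs" "0 < length qs" "length qs - 1 < length qs" using that ends(1) by simp_all
      then have "qs ! k \<noteq> qs ! 0" "qs ! k \<noteq> qs ! (length qs - 1)"
        using nth_eq_iff_index_eq[OF ind(1), of k 0] nth_eq_iff_index_eq[OF ind(1), of k "length qs - 1"] that
        by simp_all
      moreover have "qs ! k \<in> ?Q" using w nth_mem[OF \<open>k < length qs\<close>] unfolding walk_def by blast
      ultimately show ?thesis using ends by auto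
    qed
    have QW: "?Q \<subseteq> W" using a b CA by (auto simp: S_def A_def)
    have v_notin: "v \<notin> ?Q" using a b CA irr by (auto simp: S_def A_def)
    have vqs: "R v (qs ! k) \<longleftrightarrow> k = 0 \<or> Suc k = length qs" if k: "k < length qs" for k
    proof (cases "k = 0 \<or> Suc k = length qs")
      case True
      then have "qs ! k = a \<or> qs ! k = b" using ends by (metis diff_Suc_1)
      then show ?thesis using True a b by (auto simp: S_def)
    next
      case False
      then have "0 < k" "k < length qs - 1" using k by linarith+
      then have "qs ! k \<in> C" by (rule inner)
      then show ?thesis using CA False by (auto simp: A_def)
    qed
    have "4 \<le> length (v # qs)" using len by simp
    moreover have "distinct (v # qs)" using ind(1) v_notin w by (auto simp: walk_def)
    moreover have "set (v # qs) \<subseteq> W" using less.prems(3) QW w by (auto simp: walk_def)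
    moreover have "R ((v # qs) ! i) ((v # qs) ! j) \<longleftrightarrow> j = Suc i \<or> i = 0 \<and> Suc j = length (v # qs)"
      if ij: "i < j" "j < length (v # qs)" for i j
    proof (cases i)
      case 0
      then obtain k where "j = Suc k" using ij(1) by (cases j) auto
      then show ?thesis using 0 ij vqs[of k] by simp
    next
      case (Suc i')
      then obtain k where "j = Suc k" using ij(1) by (cases j) auto
      then show ?thesis using Suc ij ind(2)[of i' k] by simp
    qed
    ultimately have "\<not> chordal_on R W"
      unfolding chordal_on_def not_not by (intro exI[of _ "v # qs"]) simp
    then show False using less.prems(2) by contradiction
  qed
  have CS: "C \<union> S \<subseteq> W - {v}" using CA irr by (auto simp: A_def S_def)
  then have "C \<union> S \<subset> W" "C \<subset> W" using less.prems(3) by blast+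
  then have card: "card (C \<union> S) < card W" "card C < card W"
    using psubset_card_mono[OF less.prems(1)] by simp_all
  have sub: "C \<union> S \<subseteq> W" "C \<subseteq> W" using CS by blast+
  have fin: "finite (C \<union> S)" "finite C" using CS less.prems(1) by (auto intro: finite_subset)
  \<comment> \<open>By \<open>nbr\<close> all neighbours in \<open>W\<close> of a vertex of
    \<open>C\<close> lie in \<open>C \<union> S\<close>, so simpliciality in this smaller set
    extends to \<open>W\<close>. Vertices of \<open>C\<close> are non-neighbours of \<open>v\<close>
    by construction.\<close>
  have goal: ?case if x: "x \<in> C" "simplicial R (C \<union> S) x" for x
  proof (intro bexI conjI)
    show "simplicial R W x"
      unfolding simplicial_def
    proof (intro ballI impI)
      fix y z assume "y \<in> W" "z \<in> W" "R x y \<and> R x z \<and> y \<noteq> z"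
      moreover from this have "y \<in> C \<union> S" "z \<in> C \<union> S" using nbr[OF x(1)] by simp_all
      ultimately show "R y z" using x(2) unfolding simplicial_def by blast
    qed
    show "x \<noteq> v" "\<not> R v x" "x \<in> W" using x(1) CA by (auto simp: A_def)
  qed
  show ?case
  proof (cases "\<exists>s\<in>S. \<exists>y\<in>C \<union> S. y \<noteq> s \<and> \<not> R s y")
    case True
    then obtain s y where s: "s \<in> S" "y \<in> C \<union> S" "y \<noteq> s" "\<not> R s y" by blast
    \<comment> \<open>The induction runs inside \<open>C \<union> S\<close> with \<open>s\<close> in
      the role of \<open>v\<close>. The vertex found is not adjacent to \<open>s\<close>; as
      \<open>S\<close> is a clique, it must lie in \<open>C\<close>.\<close>
    have "\<exists>x\<in>C \<union> S. simplicial R (C \<union> S) x \<and> x \<noteq> s \<and> \<not> R s x"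
      by (rule less.hyps[OF card(1) fin(1) chordal_on_subset[OF less.prems(2) sub(1)] UnI2[OF s(1)] s(2,3,4)])
    then obtain x where x: "x \<in> C \<union> S" "simplicial R (C \<union> S) x" "x \<noteq> s" "\<not> R s x" by blast
    then have "x \<in> C" using S_clique[OF s(1), of x] by blast
    then show ?thesis using goal[OF _ x(2)] by simp
  next
    case False
    then have univ: "R s y" if "s \<in> S" "y \<in> C \<union> S" "y \<noteq> s" for s y using that by blast
    \<comment> \<open>Now every vertex of \<open>S\<close> is adjacent to all the others, so
      \<open>S\<close> cannot spoil simpliciality and may be ignored. Either \<open>C\<close> has a
      non-adjacent pair and the induction applies to it, or \<open>C\<close> is complete and
      \<open>u\<close> itself serves.\<close>
    have lift: "simplicial R (C \<union> S) x" if "simplicial R C x" for x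
      unfolding simplicial_def
    proof (intro ballI impI)
      fix y z assume yz: "y \<in> C \<union> S" "z \<in> C \<union> S" "R x y \<and> R x z \<and> y \<noteq> z"
      show "R y z"
      proof (cases "y \<in> C \<and> z \<in> C")
        case True
        then show ?thesis using that yz unfolding simplicial_def by blast
      next
        case False
        then have "y \<in> S \<or> z \<in> S" using yz by blast
        then show ?thesis using univ[of y z] univ[of z y] sym[of z y] yz by auto
      qed
    qed
    show ?thesis
    proof (cases "\<exists>c\<in>C. \<exists>y\<in>C. y \<noteq> c \<and> \<not> R c y")
      case True
      then obtain c y where c: "c \<in> C" "y \<in> C" "y \<noteq> c" "\<not> R c y" by blast
      have "\<exists>x\<in>C. simplicial R C x \<and> x \<noteq> c \<and> \<not> R c x"
        by (rule less.hyps[OF card(2) fin(2) chordal_on_subset[OF less.prems(2) sub(2)] c])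
      then obtain x where "x \<in> C" "simplicial R C x" by blast
      then show ?thesis using goal[OF _ lift] by simp
    next
      case False
      then have "R y z" if "y \<in> C" "z \<in> C" "y \<noteq> z" for y z using that by metis
      then have "simplicial R C u" by (simp add: simplicial_def)
      then show ?thesis using goal[OF uC lift] by simp
    qed
  qed
qed

text \<open>The ordering is built from the top: a simplicial vertex of \<open>W\<close> receives the
  largest position, and the remaining vertices are ordered by induction. In a complete graph any
  vertex is simplicial; otherwise a non-adjacent pair feeds
  \<open>simplicial_nonneighbour\<close>.\<close>

lemma perfect_elimination:
  assumes sym: "\<And>x y. R x y \<Longrightarrow> R y x" and irr: "\<And>x. \<not> R x x" and "finite W" "chordal_on R W"
  shows "\<exists>p :: 'a \<Rightarrow> nat. inj_on p W \<and> (\<forall>x\<in>W. simplicial R {y \<in> W. p y < p x} x)"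
  using assms(3,4)
proof (induction "card W" arbitrary: W)
  case 0
  then show ?case by simp
next
  case (Suc n)
  have "\<exists>x\<in>W. simplicial R W x"
  proof (cases "\<exists>v\<in>W. \<exists>u\<in>W. u \<noteq> v \<and> \<not> R v u")
    case True
    then obtain v u where "v \<in> W" "u \<in> W" "u \<noteq> v" "\<not> R v u" by blast
    from simplicial_nonneighbour[OF sym irr Suc.prems this] show ?thesis by blast
  next
    case False
    then have "R y z" if "y \<in> W" "z \<in> W" "y \<noteq> z" for y z using that by metis
    then have "simplicial R W x" for x by (simp add: simplicial_def)
    moreover have "W \<noteq> {}" using Suc.hyps(2) by (metis card.empty nat.distinct(1))
    ultimately show ?thesis by blast
  qed
  then obtain x where x: "x \<in> W" "simplicial R W x" by blast
  have "chordal_on R (W - {x})" by (rule chordal_on_subset[OF Suc.prems(2)]) blast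
  moreover have "n = card (W - {x})" using Suc.hyps(2) x Suc.prems(1) by simp
  ultimately have "\<exists>p :: 'a \<Rightarrow> nat. inj_on p (W - {x}) \<and>
      (\<forall>y\<in>W - {x}. simplicial R {z \<in> W - {x}. p z < p y} y)"
    using Suc.hyps(1)[OF _ finite_Diff[OF Suc.prems(1), of "{x}"]] by simp
  then obtain p :: "'a \<Rightarrow> nat" where p: "inj_on p (W - {x})"
    "\<And>y. y \<in> W - {x} \<Longrightarrow> simplicial R {z \<in> W - {x}. p z < p y} y"
    by blast
  \<comment> \<open>Inserting 0 keeps \<open>Max\<close> meaningful when \<open>x\<close> is the
    only vertex.\<close>
  define N where "N = Suc (Max (insert 0 (p ` (W - {x}))))"
  have N: "p y < N" if "y \<in> W - {x}" for y
    using that Suc.prems(1) by (simp add: N_def less_Suc_eq_le)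
  define q where "q = p(x := N)"
  have q: "q x = N" "\<And>y. y \<noteq> x \<Longrightarrow> q y = p y" by (simp_all add: q_def)
  have "inj_on q W"
  proof (rule inj_onI)
    fix y z assume "y \<in> W" "z \<in> W" "q y = q z"
    then show "y = z" using N[of y] N[of z] q p(1) by (cases "y = x"; cases "z = x") (auto simp: inj_on_def)
  qed
  moreover have "simplicial R {z \<in> W. q z < q y} y" if y: "y \<in> W" for y
  proof (cases "y = x")
    case True
    then show ?thesis using x(2) unfolding simplicial_def by blast
  next
    case False
    have "z \<noteq> x \<and> p z < p y" if "z \<in> W" "q z < q y" for z
      using that N[of y] q False y by (cases "z = x") auto
    then have "{z \<in> W. q z < q y} \<subseteq> {z \<in> W - {x}. p z < p y}" by blast
    moreover have "simplicial R {z \<in> W - {x}. p z < p y} y" using p(2) False y by blast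
    ultimately show ?thesis unfolding simplicial_def by (meson subsetD)
  qed
  ultimately show ?case by blast
qed

section \<open>Divisibility of monomials as an order on exponent vectors\<close>

definition mle :: "('x \<Rightarrow>\<^sub>0 nat) \<Rightarrow> ('x \<Rightarrow>\<^sub>0 nat) \<Rightarrow> bool"  (infix \<open>\<preceq>\<close> 50) where
  "s \<preceq> t \<longleftrightarrow> (\<forall>x. Poly_Mapping.lookup s x \<le> Poly_Mapping.lookup t x)"

lemma mle_refl [simp]: "s \<preceq> s"
  by (simp add: mle_def)

lemma mle_trans [trans]: "s \<preceq> t \<Longrightarrow> t \<preceq> u \<Longrightarrow> s \<preceq> u"
  by (meson mle_def order_trans)

lemma mle_antisym: "s \<preceq> t \<Longrightarrow> t \<preceq> s \<Longrightarrow> s = t"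
  by (simp add: mle_def order_antisym poly_mapping_eqI)

lemma mle_zero [simp]: "0 \<preceq> s"
  by (simp add: mle_def)

lemma mle_add [simp]: "s \<preceq> m + s"
  by (simp add: mle_def lookup_add)

lemma mle_diff_add: "s \<preceq> t \<Longrightarrow> t - s + s = t"
  by (rule poly_mapping_eqI) (simp add: mle_def lookup_add lookup_minus)

lemma mle_add_diff: "s \<preceq> t \<Longrightarrow> t \<preceq> u \<Longrightarrow> (u - t) + (t - s) = u - s"
  by (rule poly_mapping_eqI) (simp add: mle_def lookup_add lookup_minus)

lemma mle_diff_cancel: "t \<preceq> s \<Longrightarrow> t \<preceq> u \<Longrightarrow> s - t \<preceq> u - t \<longleftrightarrow> s \<preceq> u"
  by (simp add: mle_def lookup_minus le_diff_iff)

lemma single_mle_iff: "Poly_Mapping.single x 1 \<preceq> t \<longleftrightarrow> x \<in> Poly_Mapping.keys t"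
  by (auto simp: mle_def in_keys_iff lookup_single when_def Suc_le_eq)

lemma keys_minus_nat: "Poly_Mapping.keys (s - t :: 'x \<Rightarrow>\<^sub>0 nat) \<subseteq> Poly_Mapping.keys s"
  by (auto simp: in_keys_iff lookup_minus)

lemma keys_add_nat: "Poly_Mapping.keys (s + t :: 'x \<Rightarrow>\<^sub>0 nat) = Poly_Mapping.keys s \<union> Poly_Mapping.keys t"
  by (auto simp: in_keys_iff lookup_add)

subsection \<open>Monomial ideals\<close>

lemma mpoly_ring_simps [simp]:
  "add (mpoly_ring X) = (+)" "mult (mpoly_ring X) = (*)" "zero (mpoly_ring X) = 0" "one (mpoly_ring X) = 1"
  by (simp_all add: mpoly_ring_def)

lemma carrier_mpoly_ring:
  "p \<in> carrier (mpoly_ring X) \<longleftrightarrow> (\<forall>m\<in>Poly_Mapping.keys p. Poly_Mapping.keys m \<subseteq> X)"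
  by (simp add: mpoly_ring_def)

lemma carrier_mult:
  fixes p q :: "('x, 'k::field) mpoly"
  assumes "p \<in> carrier (mpoly_ring X)" "q \<in> carrier (mpoly_ring X)"
  shows "p * q \<in> carrier (mpoly_ring X)"
  unfolding carrier_mpoly_ring
proof
  fix m assume "m \<in> Poly_Mapping.keys (p * q)"
  then obtain a b where "a \<in> Poly_Mapping.keys p" "b \<in> Poly_Mapping.keys q" "m = a + b"
    using keys_mult[of p q] by blast
  moreover from this have "Poly_Mapping.keys a \<subseteq> X" "Poly_Mapping.keys b \<subseteq> X"
    using assms by (simp_all add: carrier_mpoly_ring)
  ultimately show "Poly_Mapping.keys m \<subseteq> X" by (simp add: keys_add_nat)
qed

lemma carrier_add:
  fixes p q :: "('x, 'k::field) mpoly"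
  assumes "p \<in> carrier (mpoly_ring X)" "q \<in> carrier (mpoly_ring X)"
  shows "p + q \<in> carrier (mpoly_ring X)"
  using assms Poly_Mapping.keys_add[of p q] by (auto simp: carrier_mpoly_ring)

lemma carrier_sum:
  fixes f :: "'i \<Rightarrow> ('x, 'k::field) mpoly"
  assumes "\<And>i. i \<in> I \<Longrightarrow> f i \<in> carrier (mpoly_ring X)"
  shows "sum f I \<in> carrier (mpoly_ring X)"
  unfolding carrier_mpoly_ring
proof
  fix m assume "m \<in> Poly_Mapping.keys (sum f I)"
  then obtain i where "i \<in> I" "m \<in> Poly_Mapping.keys (f i)" using keys_sum[of f I] by blast
  then show "Poly_Mapping.keys m \<subseteq> X" using assms[of i] by (simp add: carrier_mpoly_ring)
qed

lemma cring_mpoly_ring: "cring (mpoly_ring X :: ('x, 'k::field) mpoly ring)"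
proof (intro cringI abelian_groupI comm_monoidI)
  fix x :: "('x, 'k) mpoly" assume "x \<in> carrier (mpoly_ring X)"
  then have "- x \<in> carrier (mpoly_ring X)" by (simp add: carrier_mpoly_ring in_keys_iff)
  then show "\<exists>y\<in>carrier (mpoly_ring X). y \<oplus>\<^bsub>mpoly_ring X\<^esub> x = \<zero>\<^bsub>mpoly_ring X\<^esub>"
    by (intro bexI[of _ "- x"]) auto
qed (simp_all add: carrier_add carrier_mult algebra_simps, simp_all add: carrier_mpoly_ring)

lemma single_in_carrier: "Poly_Mapping.keys m \<subseteq> X \<Longrightarrow> Poly_Mapping.single m c \<in> carrier (mpoly_ring X)"
  by (simp add: carrier_mpoly_ring)

lemma mon_in_carrier: "Poly_Mapping.keys m \<subseteq> X \<Longrightarrow> mon m \<in> carrier (mpoly_ring X)"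
  by (simp add: mon_def single_in_carrier)

lemma sum_single_keys: "(\<Sum>m\<in>Poly_Mapping.keys p. Poly_Mapping.single m (Poly_Mapping.lookup p m)) = p"
proof (rule poly_mapping_eqI)
  fix k
  have "(\<Sum>m\<in>Poly_Mapping.keys p. Poly_Mapping.lookup p m when m = k) = Poly_Mapping.lookup p k"
    by (auto simp: when_def sum.delta' in_keys_iff cong: if_cong)
  then show "Poly_Mapping.lookup (\<Sum>m\<in>Poly_Mapping.keys p. Poly_Mapping.single m (Poly_Mapping.lookup p m)) k
      = Poly_Mapping.lookup p k"
    by (simp add: lookup_sum lookup_single)
qed

lemma ideal_sum_mem:
  assumes "ideal I R" "\<And>i. i \<in> A \<Longrightarrow> f i \<in> I" "\<And>x y. x \<oplus>\<^bsub>R\<^esub> y = x + y" "\<zero>\<^bsub>R\<^esub> = (0::'b::comm_monoid_add)"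
  shows "sum f A \<in> I"
proof -
  interpret ideal I R by fact
  have z: "(0::'b) \<in> I" using additive_subgroup.zero_closed[OF is_additive_subgroup] assms(4) by simp
  have a: "x \<in> I \<Longrightarrow> y \<in> I \<Longrightarrow> x + y \<in> I" for x y
    using additive_subgroup.a_closed[OF is_additive_subgroup, of x y] assms(3) by simp
  show ?thesis using assms(2) by (induction A rule: infinite_finite_induct) (auto simp: z a)
qed

text \<open>Membership in a monomial ideal is decided term by term. The right-hand side is closed
  under multiplication because terms of a product are products of terms, and each of its elements is
  a sum of multiples of generators. This reduces later arguments to exponent vectors.\<close>

lemma genideal_mon:
  fixes S :: "('x \<Rightarrow>\<^sub>0 nat) set"
  assumes S: "\<And>s. s \<in> S \<Longrightarrow> Poly_Mapping.keys s \<subseteq> X"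
  shows "Idl\<^bsub>mpoly_ring X\<^esub> (mon ` S :: ('x, 'k::field) mpoly set) =
    {p \<in> carrier (mpoly_ring X). \<forall>m\<in>Poly_Mapping.keys p. \<exists>s\<in>S. s \<preceq> m}" (is "?L = ?R")
proof -
  interpret cring "mpoly_ring X :: ('x, 'k) mpoly ring" by (rule cring_mpoly_ring)
  have "ideal ?R (mpoly_ring X)"
  proof (rule idealI)
    show "ring (mpoly_ring X :: ('x, 'k) mpoly ring)" by (rule ring_axioms)
    have *: "q * p \<in> ?R" if p: "p \<in> ?R" and q: "q \<in> carrier (mpoly_ring X)" for p q
    proof -
      have "\<exists>s\<in>S. s \<preceq> m" if m: "m \<in> Poly_Mapping.keys (q * p)" for m
      proof -
        obtain a b where "a \<in> Poly_Mapping.keys q" "b \<in> Poly_Mapping.keys p" "m = a + b"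
          using m keys_mult[of q p] by blast
        moreover from this obtain s where "s \<in> S" "s \<preceq> b" using p by blast
        ultimately show ?thesis using mle_trans[OF _ mle_add] by blast
      qed
      then show ?thesis using p q carrier_mult by blast
    qed
    fix p x :: "('x, 'k) mpoly" assume p: "p \<in> ?R" and x: "x \<in> carrier (mpoly_ring X)"
    show "x \<otimes>\<^bsub>mpoly_ring X\<^esub> p \<in> ?R" using *[OF p x] by simp
    show "p \<otimes>\<^bsub>mpoly_ring X\<^esub> x \<in> ?R" using *[OF p x] by (simp add: mult.commute)
  next
    show "subgroup ?R (add_monoid (mpoly_ring X))"
    proof (rule group.subgroupI)
      show "Group.group (add_monoid (mpoly_ring X :: ('x, 'k) mpoly ring))" by (rule a_group)
      have "0 \<in> ?R" by (simp add: carrier_mpoly_ring)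
      then show "?R \<noteq> {}" by blast
      fix p assume p: "p \<in> ?R"
      have neg: "- p \<in> ?R" using p by (simp add: carrier_mpoly_ring in_keys_iff)
      have "inv\<^bsub>add_monoid (mpoly_ring X)\<^esub> p = - p"
        using p neg by (intro group.inv_equality[OF a_group]) auto
      then show "inv\<^bsub>add_monoid (mpoly_ring X)\<^esub> p \<in> ?R" using neg by simp
      fix q assume q: "q \<in> ?R"
      show "p \<otimes>\<^bsub>add_monoid (mpoly_ring X)\<^esub> q \<in> ?R"
      proof -
        have "\<exists>s\<in>S. s \<preceq> m" if "m \<in> Poly_Mapping.keys (p + q)" for m
          using that Poly_Mapping.keys_add[of p q] p q by blast
        then show ?thesis using p q carrier_add[of p X q] by simp
      qed
    qed auto
  qed
  moreover have "mon ` S \<subseteq> ?R"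
  proof
    fix p :: "('x, 'k) mpoly" assume "p \<in> mon ` S"
    then obtain s where "s \<in> S" "p = mon s" by blast
    then show "p \<in> ?R" using S[of s] by (simp add: mon_def carrier_mpoly_ring) (use mle_refl in blast)
  qed
  ultimately have "?L \<subseteq> ?R" by (rule genideal_minimal)
  have "mon ` S \<subseteq> carrier (mpoly_ring X :: ('x, 'k) mpoly ring)"
    using mon_in_carrier[OF S] by blast
  then have idl: "ideal ?L (mpoly_ring X)" and sub: "mon ` S \<subseteq> ?L"
    by (rule genideal_ideal, rule genideal_self)
  have "?R \<subseteq> ?L"
  proof
    fix p :: "('x, 'k) mpoly" assume p: "p \<in> ?R"
    have "Poly_Mapping.single m (Poly_Mapping.lookup p m) \<in> ?L" if m: "m \<in> Poly_Mapping.keys p" for m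
    proof -
      obtain s where s: "s \<in> S" "s \<preceq> m" using p m by blast
      have "mon s \<in> ?L" using sub s by blast
      moreover have "Poly_Mapping.single (m - s) (Poly_Mapping.lookup p m) \<in> carrier (mpoly_ring X)"
        using p m keys_minus_nat[of m s] by (intro single_in_carrier) (auto simp: carrier_mpoly_ring)
      moreover have "Poly_Mapping.single (m - s) (Poly_Mapping.lookup p m) * mon s
          = Poly_Mapping.single m (Poly_Mapping.lookup p m)"
        by (simp add: mon_def mult_single mle_diff_add[OF s(2)])
      ultimately show ?thesis using ideal.I_l_closed[OF idl] by (metis mpoly_ring_simps(2))
    qed
    then have "(\<Sum>m\<in>Poly_Mapping.keys p. Poly_Mapping.single m (Poly_Mapping.lookup p m)) \<in> ?L"
      by (intro ideal_sum_mem[OF idl]) simp_all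
    then show "p \<in> ?L" by (simp add: sum_single_keys)
  qed
  with \<open>?L \<subseteq> ?R\<close> show ?thesis by (rule subset_antisym)
qed

lemma mon_in_genideal_iff:
  assumes "\<And>s. s \<in> S \<Longrightarrow> Poly_Mapping.keys s \<subseteq> X"
  shows "(mon m :: ('x, 'k::field) mpoly) \<in> Idl\<^bsub>mpoly_ring X\<^esub> (mon ` S)
    \<longleftrightarrow> Poly_Mapping.keys m \<subseteq> X \<and> (\<exists>s\<in>S. s \<preceq> m)"
  using assms by (subst genideal_mon) (auto simp: mon_def carrier_mpoly_ring)

lemma mon_in_genideal:
  assumes "\<And>s. s \<in> S \<Longrightarrow> Poly_Mapping.keys s \<subseteq> X" and s: "s \<in> S"
  shows "(mon s :: ('x, 'k::field) mpoly) \<in> Idl\<^bsub>mpoly_ring X\<^esub> (mon ` S)"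
proof -
  have "\<exists>t\<in>S. t \<preceq> s" using s by (rule bexI[rotated]) (rule mle_refl)
  then show ?thesis by (simp add: mon_in_genideal_iff[OF assms(1)] assms(1)[OF s])
qed

lemma genideal_mon_mono:
  fixes S T :: "('x \<Rightarrow>\<^sub>0 nat) set"
  assumes "\<And>s. s \<in> S \<Longrightarrow> Poly_Mapping.keys s \<subseteq> X" "\<And>s. s \<in> T \<Longrightarrow> Poly_Mapping.keys s \<subseteq> X"
    and "\<And>s. s \<in> S \<Longrightarrow> \<exists>t\<in>T. t \<preceq> s"
  shows "Idl\<^bsub>mpoly_ring X\<^esub> (mon ` S :: ('x, 'k::field) mpoly set) \<subseteq> Idl\<^bsub>mpoly_ring X\<^esub> (mon ` T)"
proof -
  have "\<exists>t\<in>T. t \<preceq> m" if "\<exists>s\<in>S. s \<preceq> m" for m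
    using that assms(3) mle_trans by blast
  then show ?thesis by (auto simp: genideal_mon[OF assms(1)] genideal_mon[OF assms(2)])
qed

text \<open>\<open>min_gens\<close> is a definite description, so uniqueness is part of the claim.
  Any irredundant generating set is an antichain, and if two antichains generate the same ideal,
  each element of one is divisible by an element of the other in both directions, which forces them
  to coincide.\<close>

lemma min_gens_antichain:
  fixes S :: "('x \<Rightarrow>\<^sub>0 nat) set"
  assumes S: "\<And>s. s \<in> S \<Longrightarrow> Poly_Mapping.keys s \<subseteq> X"
    and anti: "\<And>s t. s \<in> S \<Longrightarrow> t \<in> S \<Longrightarrow> s \<preceq> t \<Longrightarrow> s = t"
  shows "min_gens X (Idl\<^bsub>mpoly_ring X\<^esub> (mon ` S :: ('x, 'k::field) mpoly set)) = S"
  unfolding min_gens_def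
proof (rule the_equality)
  let ?I = "\<lambda>S. Idl\<^bsub>mpoly_ring X\<^esub> (mon ` S :: ('x, 'k) mpoly set)"
  have "?I T \<noteq> ?I S" if T: "T \<subset> S" for T
  proof
    assume eq: "?I T = ?I S"
    obtain s where s: "s \<in> S" "s \<notin> T" using T by blast
    have "(mon s :: ('x, 'k) mpoly) \<in> ?I S" by (rule mon_in_genideal[OF S s(1)])
    then have "(mon s :: ('x, 'k) mpoly) \<in> ?I T" using eq by simp
    moreover have "\<And>m. m \<in> T \<Longrightarrow> Poly_Mapping.keys m \<subseteq> X" using S T by blast
    ultimately obtain t where "t \<in> T" "t \<preceq> s" by (simp add: mon_in_genideal_iff) blast
    then show False using anti[of t s] T s by blast
  qed
  then show "(\<forall>m\<in>S. Poly_Mapping.keys m \<subseteq> X) \<and> ?I S = ?I S \<and> (\<forall>T. T \<subset> S \<longrightarrow> ?I T \<noteq> ?I S)"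
    using S by (intro conjI ballI allI impI refl) simp_all
  fix T assume T: "(\<forall>m\<in>T. Poly_Mapping.keys m \<subseteq> X) \<and> ?I T = ?I S \<and> (\<forall>U. U \<subset> T \<longrightarrow> ?I U \<noteq> ?I S)"
  then have TX: "\<And>m. m \<in> T \<Longrightarrow> Poly_Mapping.keys m \<subseteq> X" and eq: "?I T = ?I S"
    by simp_all
  have ST: "\<exists>t\<in>T. t \<preceq> s" if "s \<in> S" for s
  proof -
    have "(mon s :: ('x, 'k) mpoly) \<in> ?I S" by (rule mon_in_genideal[OF S that])
    then have "(mon s :: ('x, 'k) mpoly) \<in> ?I T" using eq by simp
    then show ?thesis by (simp add: mon_in_genideal_iff[OF TX])
  qed
  have TS: "\<exists>s\<in>S. s \<preceq> t" if "t \<in> T" for t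
  proof -
    have "(mon t :: ('x, 'k) mpoly) \<in> ?I T" by (rule mon_in_genideal[OF TX that])
    then have "(mon t :: ('x, 'k) mpoly) \<in> ?I S" using eq by simp
    then show ?thesis by (simp add: mon_in_genideal_iff[OF S])
  qed
  \<comment> \<open>If \<open>t\<close> divided a different \<open>u\<close> in \<open>T\<close>,
    then \<open>u\<close> could be dropped without changing the ideal, against the irredundancy of
    \<open>T\<close>.\<close>
  have anti': "t = u" if "t \<in> T" "u \<in> T" "t \<preceq> u" for t u
  proof (rule ccontr)
    assume ne: "t \<noteq> u"
    have TX': "\<And>m. m \<in> T - {u} \<Longrightarrow> Poly_Mapping.keys m \<subseteq> X" by (simp add: TX)
    have "?I T = ?I (T - {u})"
    proof
      show "?I T \<subseteq> ?I (T - {u})"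
      proof (rule genideal_mon_mono[OF TX TX'])
        fix s assume "s \<in> T"
        then show "\<exists>t\<in>T - {u}. t \<preceq> s" using that ne by (intro bexI[of _ "if s = u then t else s"]) auto
      qed
      show "?I (T - {u}) \<subseteq> ?I T"
      proof (rule genideal_mon_mono[OF TX' TX])
        fix s assume "s \<in> T - {u}"
        then show "\<exists>t\<in>T. t \<preceq> s" by (intro bexI[of _ s]) auto
      qed
    qed
    moreover have "T - {u} \<subset> T" using that by blast
    ultimately show False using T by metis
  qed
  have "S \<subseteq> T"
  proof
    fix s assume s: "s \<in> S"
    then obtain t where t: "t \<in> T" "t \<preceq> s" using ST by blast
    then obtain s' where "s' \<in> S" "s' \<preceq> t" using TS by blast
    then have "s' = s" using anti[OF _ s] mle_trans[OF _ t(2)] by blast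
    then show "s \<in> T" using t \<open>s' \<preceq> t\<close> mle_antisym by blast
  qed
  moreover have "T \<subseteq> S"
  proof
    fix t assume t: "t \<in> T"
    then obtain s where s: "s \<in> S" "s \<preceq> t" using TS by blast
    then obtain t' where "t' \<in> T" "t' \<preceq> s" using ST by blast
    then have "t' = t" using anti'[OF _ t] mle_trans[OF _ s(2)] by blast
    then show "t \<in> S" using s \<open>t' \<preceq> s\<close> mle_antisym by blast
  qed
  ultimately show "T = S" by blast
qed

lemma keys_times_mon: "Poly_Mapping.keys (p * mon u :: ('x, 'k::field) mpoly) = (\<lambda>m. m + u) ` Poly_Mapping.keys p"
proof -
  have l: "Poly_Mapping.lookup (p * mon u) (m + u) = Poly_Mapping.lookup p m" for m
  proof -
    have "Poly_Mapping.lookup (p * mon u) (m + u)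
      = Poly_Mapping.lookup (\<Sum>k\<in>Poly_Mapping.keys p. Poly_Mapping.single (k + u) (Poly_Mapping.lookup p k)) (m + u)"
      by (subst (1) sum_single_keys[of p, symmetric]) (simp add: sum_distrib_right mon_def mult_single)
    also have "\<dots> = Poly_Mapping.lookup (\<Sum>k\<in>Poly_Mapping.keys p. Poly_Mapping.single k (Poly_Mapping.lookup p k)) m"
      by (simp add: lookup_sum lookup_single when_def)
    finally show ?thesis by (simp add: sum_single_keys)
  qed
  show ?thesis
  proof
    show "Poly_Mapping.keys (p * mon u) \<subseteq> (\<lambda>m. m + u) ` Poly_Mapping.keys p"
      using keys_mult[of p "mon u"] by (auto simp: mon_def)
    show "(\<lambda>m. m + u) ` Poly_Mapping.keys p \<subseteq> Poly_Mapping.keys (p * mon u)"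
      by (auto simp: in_keys_iff l)
  qed
qed

text \<open>The two conditions are the two inclusions: by \<open>quot\<close> every monomial of the
  colon ideal contains a variable of \<open>W\<close>, and by \<open>var\<close> every variable of
  \<open>W\<close> multiplies \<open>u\<close> into the ideal.\<close>

lemma colon_monomial:
  fixes S :: "('x \<Rightarrow>\<^sub>0 nat) set"
  assumes S: "\<And>s. s \<in> S \<Longrightarrow> Poly_Mapping.keys s \<subseteq> X" and u: "Poly_Mapping.keys u \<subseteq> X" and W: "W \<subseteq> X"
    and quot: "\<And>s. s \<in> S \<Longrightarrow> \<exists>x\<in>W. Poly_Mapping.lookup u x < Poly_Mapping.lookup s x"
    and var: "\<And>x. x \<in> W \<Longrightarrow> \<exists>s\<in>S. s \<preceq> Poly_Mapping.single x 1 + u"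
  shows "colon X (Idl\<^bsub>mpoly_ring X\<^esub> (mon ` S)) (mon u)
    = Idl\<^bsub>mpoly_ring X\<^esub> ((var :: _ \<Rightarrow> ('x, 'k::field) mpoly) ` W)"
proof -
  have 1: "Idl\<^bsub>mpoly_ring X\<^esub> ((var :: _ \<Rightarrow> ('x, 'k) mpoly) ` W)
     = {p \<in> carrier (mpoly_ring X). \<forall>m\<in>Poly_Mapping.keys p. \<exists>x\<in>W. x \<in> Poly_Mapping.keys m}"
  proof -
    have "(var :: _ \<Rightarrow> ('x, 'k) mpoly) ` W = mon ` ((\<lambda>x. Poly_Mapping.single x 1) ` W)"
      by (simp add: var_def image_image)
    then show ?thesis using W by (subst \<open>_ = _\<close>, subst genideal_mon) (auto simp: single_mle_iff simp del: One_nat_def)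
  qed
  have 2: "(\<exists>s\<in>S. s \<preceq> m + u) \<longleftrightarrow> (\<exists>x\<in>W. x \<in> Poly_Mapping.keys m)" for m
  proof
    assume "\<exists>s\<in>S. s \<preceq> m + u"
    then obtain s where s: "s \<in> S" "s \<preceq> m + u" by blast
    then obtain x where "x \<in> W" "Poly_Mapping.lookup u x < Poly_Mapping.lookup s x" using quot by blast
    moreover have "Poly_Mapping.lookup s x \<le> Poly_Mapping.lookup m x + Poly_Mapping.lookup u x"
      using s by (simp add: mle_def lookup_add)
    ultimately show "\<exists>x\<in>W. x \<in> Poly_Mapping.keys m" by (intro bexI[of _ x]) (auto simp: in_keys_iff)
  next
    assume "\<exists>x\<in>W. x \<in> Poly_Mapping.keys m"
    then obtain x where x: "x \<in> W" "Poly_Mapping.single x 1 \<preceq> m" using single_mle_iff by metis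
    then have "Poly_Mapping.single x 1 + u \<preceq> m + u" by (simp add: mle_def lookup_add)
    then show "\<exists>s\<in>S. s \<preceq> m + u" using var[OF x(1)] mle_trans by blast
  qed
  have 3: "mon u \<in> carrier (mpoly_ring X)" by (rule mon_in_carrier[OF u])
  have "colon X (Idl\<^bsub>mpoly_ring X\<^esub> (mon ` S)) (mon u :: ('x, 'k) mpoly)
    = {p \<in> carrier (mpoly_ring X). \<forall>m\<in>Poly_Mapping.keys p. \<exists>s\<in>S. s \<preceq> m + u}"
    using 3 carrier_mult[OF _ 3] by (auto simp: colon_def genideal_mon[OF S] keys_times_mon)
  then show ?thesis by (simp add: 1 2)
qed

subsection \<open>Squarefree monomials\<close>

definition sqfree :: "'x set \<Rightarrow> 'x \<Rightarrow>\<^sub>0 nat" where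
  "sqfree M = (\<Sum>x\<in>M. Poly_Mapping.single x 1)"

lemma lookup_sqfree: "finite M \<Longrightarrow> Poly_Mapping.lookup (sqfree M) x = (if x \<in> M then 1 else 0)"
  by (simp add: sqfree_def lookup_sum lookup_single when_def)

lemma keys_sqfree [simp]: "finite M \<Longrightarrow> Poly_Mapping.keys (sqfree M) = M"
  by (auto simp: in_keys_iff lookup_sqfree split: if_splits)

lemma sqfree_mle_iff: "finite M \<Longrightarrow> sqfree M \<preceq> t \<longleftrightarrow> M \<subseteq> Poly_Mapping.keys t"
  by (auto simp: mle_def lookup_sqfree in_keys_iff Suc_le_eq)

text \<open>Infinite \<open>M\<close> is covered by the conventions for sums and products: the
  product is 1 and the exponent vector is 0.\<close>

lemma prod_var: "(\<Prod>x\<in>M. var x :: ('x, 'k::field) mpoly) = mon (sqfree M)"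
  by (induction M rule: infinite_finite_induct)
    (auto simp: sqfree_def var_def mon_def mult_single)

subsection \<open>Strands of multigraded maps\<close>

text \<open>This is the component of degree \<open>s\<close> of the free module whose basis elements
  have degrees \<open>a\<close>. The coordinate at \<open>i\<close> stands for the coefficient of
  the one monomial that lifts \<open>a ! i\<close> to \<open>s\<close>, which exists only if
  \<open>a ! i\<close> divides \<open>s\<close>.\<close>

definition strand :: "('x \<Rightarrow>\<^sub>0 nat) list \<Rightarrow> ('x \<Rightarrow>\<^sub>0 nat) \<Rightarrow> 'k::field vec set" where
  "strand a s = {v \<in> carrier_vec (length a). \<forall>i<length a. v $ i \<noteq> 0 \<longrightarrow> a ! i \<preceq> s}"

definition graded_mat :: "('x \<Rightarrow>\<^sub>0 nat) list \<Rightarrow> ('x \<Rightarrow>\<^sub>0 nat) list \<Rightarrow> 'k::field mat \<Rightarrow> bool" where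
  "graded_mat t a C \<longleftrightarrow> C \<in> carrier_mat (length t) (length a) \<and>
     (\<forall>i<length t. \<forall>j<length a. C $$ (i, j) \<noteq> 0 \<longrightarrow> t ! i \<preceq> a ! j)"

text \<open>The subtraction is truncated, but in a graded matrix an entry is zero unless
  \<open>t ! i\<close> divides \<open>a ! j\<close>, so no wrong monomial appears. On graded maps
  \<open>poly_mat\<close> and \<open>scalar_mat\<close> are inverse to each other.\<close>

definition poly_mat ::
    "('x \<Rightarrow>\<^sub>0 nat) list \<Rightarrow> ('x \<Rightarrow>\<^sub>0 nat) list \<Rightarrow> 'k::field mat \<Rightarrow> ('x, 'k) mpoly mat" where
  "poly_mat t a C = mat (length t) (length a) (\<lambda>(i, j). Poly_Mapping.single (a ! j - t ! i) (C $$ (i, j)))"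

definition scalar_mat ::
    "('x \<Rightarrow>\<^sub>0 nat) list \<Rightarrow> ('x \<Rightarrow>\<^sub>0 nat) list \<Rightarrow> ('x, 'k::field) mpoly mat \<Rightarrow> 'k mat" where
  "scalar_mat t a D = mat (length t) (length a) (\<lambda>(i, j). Poly_Mapping.lookup (D $$ (i, j)) (a ! j - t ! i))"

definition hom_vec :: "('x \<Rightarrow>\<^sub>0 nat) list \<Rightarrow> ('x \<Rightarrow>\<^sub>0 nat) \<Rightarrow> 'k::field vec \<Rightarrow> ('x, 'k) mpoly vec" where
  "hom_vec a s v = vec (length a) (\<lambda>i. Poly_Mapping.single (s - a ! i) (v $ i))"

text \<open>The homogeneous component of degree \<open>s\<close>, a left inverse of
  \<open>hom_vec\<close> on the strand. The guard excludes coordinates in which the truncated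
  subtraction would read an unrelated coefficient.\<close>

definition part_vec :: "('x \<Rightarrow>\<^sub>0 nat) list \<Rightarrow> ('x \<Rightarrow>\<^sub>0 nat) \<Rightarrow> ('x, 'k::field) mpoly vec \<Rightarrow> 'k vec" where
  "part_vec a s v = vec (length a) (\<lambda>i. if a ! i \<preceq> s then Poly_Mapping.lookup (v $ i) (s - a ! i) else 0)"

lemma strandD: "v \<in> strand a s \<Longrightarrow> v \<in> carrier_vec (length a)"
  by (simp add: strand_def)

lemma graded_matD: "graded_mat t a C \<Longrightarrow> C \<in> carrier_mat (length t) (length a)"
  by (simp add: graded_mat_def)

lemma poly_mat_carrier [simp]: "poly_mat t a C \<in> carrier_mat (length t) (length a)"
  by (simp add: poly_mat_def)

lemma hom_vec_carrier [simp]: "hom_vec a s v \<in> carrier_vec (length a)"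
  by (simp add: hom_vec_def)

lemma part_vec_carrier [simp]: "part_vec a s v \<in> carrier_vec (length a)"
  by (simp add: part_vec_def)

lemma part_vec_strand [simp]: "part_vec a s v \<in> strand a s"
  by (simp add: strand_def part_vec_def)

lemma mult_mat_vec_index:
  assumes "A \<in> carrier_mat n m" "v \<in> carrier_vec m" "i < n"
  shows "(A *\<^sub>v v) $ i = (\<Sum>j<m. A $$ (i, j) * v $ j)"
  using assms by (auto simp: scalar_prod_def atLeast0LessThan)

lemma mult_mat_index:
  assumes "A \<in> carrier_mat n m" "B \<in> carrier_mat m l" "i < n" "j < l"
  shows "(A * B) $$ (i, j) = (\<Sum>k<m. A $$ (i, k) * B $$ (k, j))"
  using assms by (auto simp: scalar_prod_def atLeast0LessThan)

lemma graded_mult_strand: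
  assumes C: "graded_mat t a C" and v: "v \<in> strand a s"
  shows "C *\<^sub>v v \<in> strand t s"
  unfolding strand_def
proof (intro CollectI conjI allI impI)
  show "C *\<^sub>v v \<in> carrier_vec (length t)"
    using mult_mat_vec_carrier[OF graded_matD[OF C] strandD[OF v]] .
  fix i assume i: "i < length t" and "(C *\<^sub>v v) $ i \<noteq> 0"
  then have "(\<Sum>j<length a. C $$ (i, j) * v $ j) \<noteq> 0"
    by (simp add: mult_mat_vec_index[OF graded_matD[OF C] strandD[OF v]])
  then obtain j where "j < length a" "C $$ (i, j) * v $ j \<noteq> 0"
    by (meson lessThan_iff sum.neutral)
  then have "t ! i \<preceq> a ! j" "a ! j \<preceq> s" using C v i by (auto simp: graded_mat_def strand_def)
  then show "t ! i \<preceq> s" by (rule mle_trans)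
qed

lemma graded_mat_mult:
  assumes C: "graded_mat t a C" and D: "graded_mat a b D"
  shows "graded_mat t b (C * D)"
  unfolding graded_mat_def
proof (intro conjI allI impI)
  show "C * D \<in> carrier_mat (length t) (length b)"
    using mult_carrier_mat[OF graded_matD[OF C] graded_matD[OF D]] .
  fix i j assume ij: "i < length t" "j < length b" and "(C * D) $$ (i, j) \<noteq> 0"
  then have "(\<Sum>k<length a. C $$ (i, k) * D $$ (k, j)) \<noteq> 0"
    by (simp add: mult_mat_index[OF graded_matD[OF C] graded_matD[OF D]])
  then obtain k where "k < length a" "C $$ (i, k) * D $$ (k, j) \<noteq> 0"
    by (meson lessThan_iff sum.neutral)
  then have "t ! i \<preceq> a ! k" "a ! k \<preceq> b ! j" using C D ij by (auto simp: graded_mat_def)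
  then show "t ! i \<preceq> b ! j" by (rule mle_trans)
qed

lemma unit_vec_strand: "j < length a \<Longrightarrow> unit_vec (length a) j \<in> strand a (a ! j)"
  by (auto simp: strand_def unit_vec_def)

lemma single_sum: "Poly_Mapping.single d (sum f A) = (\<Sum>i\<in>A. Poly_Mapping.single d (f i))"
  by (induction A rule: infinite_finite_induct) (auto simp: single_add)

lemma lookup_single_times:
  fixes p :: "('x, 'k::field) mpoly"
  shows "Poly_Mapping.lookup (Poly_Mapping.single d c * p) e
    = (if d \<preceq> e then c * Poly_Mapping.lookup p (e - d) else 0)"
proof -
  have "Poly_Mapping.lookup (Poly_Mapping.single d c * p) e
    = Poly_Mapping.lookup (Poly_Mapping.single d c *
        (\<Sum>m\<in>Poly_Mapping.keys p. Poly_Mapping.single m (Poly_Mapping.lookup p m))) e"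
    by (simp only: sum_single_keys)
  also have "\<dots> = (\<Sum>m\<in>Poly_Mapping.keys p. if d + m = e then c * Poly_Mapping.lookup p m else 0)"
    by (simp add: sum_distrib_left mult_single lookup_sum lookup_single when_def)
  also have "\<dots> = (if d \<preceq> e then c * Poly_Mapping.lookup p (e - d) else 0)"
  proof (cases "d \<preceq> e")
    case True
    then have *: "d + m = e \<longleftrightarrow> m = e - d" for m
      using mle_diff_add[OF True] by (metis add.commute add_diff_cancel_left')
    show ?thesis using True by (auto simp: * sum.delta in_keys_iff)
  next
    case False
    then have "d + m \<noteq> e" for m using mle_add[of d m] by (metis add.commute)
    then show ?thesis using False by simp
  qed
  finally show ?thesis .
qed

lemma poly_mat_hom_vec:
  assumes C: "graded_mat t a C" and v: "v \<in> strand a s"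
  shows "poly_mat t a C *\<^sub>v hom_vec a s v = hom_vec t s (C *\<^sub>v v)"
proof (rule eq_vecI)
  fix i assume "i < dim_vec (hom_vec t s (C *\<^sub>v v))"
  then have i: "i < length t" by (simp add: hom_vec_def)
  have "(poly_mat t a C *\<^sub>v hom_vec a s v) $ i
    = (\<Sum>j<length a. Poly_Mapping.single (a ! j - t ! i) (C $$ (i, j)) * Poly_Mapping.single (s - a ! j) (v $ j))"
    using i by (simp add: mult_mat_vec_index[OF poly_mat_carrier hom_vec_carrier]) (simp add: poly_mat_def hom_vec_def)
  also have "\<dots> = (\<Sum>j<length a. Poly_Mapping.single (s - t ! i) (C $$ (i, j) * v $ j))"
  proof (rule sum.cong[OF refl])
    fix j assume "j \<in> {..<length a}"
    then have j: "j < length a" by simp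
    show "Poly_Mapping.single (a ! j - t ! i) (C $$ (i, j)) * Poly_Mapping.single (s - a ! j) (v $ j)
      = Poly_Mapping.single (s - t ! i) (C $$ (i, j) * v $ j)"
    proof (cases "C $$ (i, j) = 0 \<or> v $ j = 0")
      case False
      then have "t ! i \<preceq> a ! j" "a ! j \<preceq> s" using C v i j by (auto simp: graded_mat_def strand_def)
      then show ?thesis by (simp add: mult_single mle_add_diff add.commute)
    qed auto
  qed
  also have "\<dots> = hom_vec t s (C *\<^sub>v v) $ i"
    using i by (simp add: hom_vec_def mult_mat_vec_index[OF graded_matD[OF C] strandD[OF v]] single_sum)
  finally show "(poly_mat t a C *\<^sub>v hom_vec a s v) $ i = hom_vec t s (C *\<^sub>v v) $ i" .
qed (simp add: hom_vec_def poly_mat_def)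

text \<open>A degree-preserving map acts on each homogeneous component separately. Where
  \<open>t ! i\<close> does not divide \<open>s\<close>, every summand vanishes because
  \<open>t ! i\<close> would divide \<open>a ! j\<close>.\<close>

lemma part_vec_poly_mat:
  assumes C: "graded_mat t a C" and V: "V \<in> carrier_vec (length a)"
  shows "part_vec t s (poly_mat t a C *\<^sub>v V) = C *\<^sub>v part_vec a s V"
proof (rule eq_vecI)
  fix i assume "i < dim_vec (C *\<^sub>v part_vec a s V)"
  then have i: "i < length t" using graded_matD[OF C] by simp
  have "part_vec t s (poly_mat t a C *\<^sub>v V) $ i
    = (if t ! i \<preceq> s then \<Sum>j<length a. Poly_Mapping.lookup (Poly_Mapping.single (a ! j - t ! i) (C $$ (i, j)) * V $ j) (s - t ! i) else 0)"
    using i by (simp add: part_vec_def mult_mat_vec_index[OF poly_mat_carrier V]) (simp add: poly_mat_def lookup_sum)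
  also have "\<dots> = (\<Sum>j<length a. C $$ (i, j) * part_vec a s V $ j)"
  proof (cases "t ! i \<preceq> s")
    case True
    have "Poly_Mapping.lookup (Poly_Mapping.single (a ! j - t ! i) (C $$ (i, j)) * V $ j) (s - t ! i)
      = C $$ (i, j) * part_vec a s V $ j" if j: "j < length a" for j
    proof (cases "C $$ (i, j) = 0")
      case False
      then have le: "t ! i \<preceq> a ! j" using C i j by (simp add: graded_mat_def)
      have "s - t ! i - (a ! j - t ! i) = s - a ! j" if "a ! j \<preceq> s"
        using mle_add_diff[OF le that] by (metis add_diff_cancel_right')
      then show ?thesis using j by (simp add: lookup_single_times part_vec_def mle_diff_cancel[OF le True])
    qed simp
    then show ?thesis using True by simp
  next
    case False
    have "C $$ (i, j) * part_vec a s V $ j = 0" if j: "j < length a" for j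
    proof (cases "C $$ (i, j) = 0")
      case nz: False
      then have le: "t ! i \<preceq> a ! j" using C i j by (simp add: graded_mat_def)
      then have "\<not> a ! j \<preceq> s" using False mle_trans by blast
      then show ?thesis using j by (simp add: part_vec_def)
    qed simp
    then have "(\<Sum>j<length a. C $$ (i, j) * part_vec a s V $ j) = 0"
      by (intro sum.neutral ballI) simp
    then show ?thesis using False by simp
  qed
  also have "\<dots> = (C *\<^sub>v part_vec a s V) $ i"
    using i by (simp add: mult_mat_vec_index[OF graded_matD[OF C] part_vec_carrier])
  finally show "part_vec t s (poly_mat t a C *\<^sub>v V) $ i = (C *\<^sub>v part_vec a s V) $ i" .
qed (use graded_matD[OF C] in \<open>simp add: part_vec_def\<close>)

lemma part_vec_hom_vec: "v \<in> strand a s \<Longrightarrow> part_vec a s (hom_vec a s v) = v"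
  by (rule eq_vecI) (auto simp: part_vec_def hom_vec_def strand_def)

lemma part_vec_zero [simp]: "part_vec a s (0\<^sub>v (length a)) = 0\<^sub>v (length a)"
  by (rule eq_vecI) (auto simp: part_vec_def)

lemma hom_vec_zero [simp]: "hom_vec a s (0\<^sub>v (length a)) = 0\<^sub>v (length a)"
  by (rule eq_vecI) (auto simp: hom_vec_def)

lemma hom_vec_free_module: "Poly_Mapping.keys s \<subseteq> X \<Longrightarrow> hom_vec a s v \<in> free_module X (length a)"
  using keys_minus_nat by (fastforce simp: free_module_def hom_vec_def carrier_mpoly_ring)

lemma poly_mat_free_module:
  assumes "\<And>s. s \<in> set a \<Longrightarrow> Poly_Mapping.keys s \<subseteq> X" and V: "V \<in> free_module X (length a)"
  shows "poly_mat t a C *\<^sub>v V \<in> free_module X (length t)"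
  unfolding free_module_def
proof (intro CollectI conjI allI impI)
  have V': "V \<in> carrier_vec (length a)" using V by (simp add: free_module_def)
  show "poly_mat t a C *\<^sub>v V \<in> carrier_vec (length t)"
    using mult_mat_vec_carrier[OF poly_mat_carrier V'] .
  fix i assume i: "i < length t"
  have "Poly_Mapping.single (a ! j - t ! i) (C $$ (i, j)) * V $ j \<in> carrier (mpoly_ring X)" if "j < length a" for j
  proof (rule carrier_mult[OF single_in_carrier])
    show "Poly_Mapping.keys (a ! j - t ! i) \<subseteq> X"
      using keys_minus_nat[of "a ! j" "t ! i"] assms(1)[OF nth_mem[OF that]] by blast
    show "V $ j \<in> carrier (mpoly_ring X)" using V that by (simp add: free_module_def)
  qed
  then show "(poly_mat t a C *\<^sub>v V) $ i \<in> carrier (mpoly_ring X)"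
    unfolding mult_mat_vec_index[OF poly_mat_carrier V' i] using i
    by (intro carrier_sum) (simp add: poly_mat_def)
qed

lemma free_module_eqI:
  assumes U: "U \<in> free_module X (length a)" and V: "V \<in> free_module X (length a)"
    and a: "\<And>s. s \<in> set a \<Longrightarrow> Poly_Mapping.keys s \<subseteq> X"
    and parts: "\<And>s. Poly_Mapping.keys s \<subseteq> X \<Longrightarrow> part_vec a s U = part_vec a s V"
  shows "U = V"
proof (rule eq_vecI)
  fix i assume "i < dim_vec V"
  then have i: "i < length a" using V by (auto simp: free_module_def)
  have "Poly_Mapping.lookup (U $ i) m = Poly_Mapping.lookup (V $ i) m" for m
  proof (cases "Poly_Mapping.keys m \<subseteq> X")
    case True
    then have "Poly_Mapping.keys (m + a ! i) \<subseteq> X" using a[OF nth_mem[OF i]] by (simp add: keys_add_nat)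
    from parts[OF this] have "part_vec a (m + a ! i) U $ i = part_vec a (m + a ! i) V $ i" by simp
    then show ?thesis using i by (simp add: part_vec_def)
  next
    case False
    then have "m \<notin> Poly_Mapping.keys (U $ i)" "m \<notin> Poly_Mapping.keys (V $ i)"
      using U V i unfolding free_module_def carrier_mpoly_ring by blast+
    then show ?thesis by (simp add: in_keys_iff)
  qed
  then show "U $ i = V $ i" by (rule poly_mapping_eqI)
qed (use U V in \<open>auto simp: free_module_def\<close>)

section \<open>Exactness in each multidegree\<close>

definition strand_exact ::
    "'x set \<Rightarrow> ('x \<Rightarrow>\<^sub>0 nat) list \<Rightarrow> ('x \<Rightarrow>\<^sub>0 nat) list \<Rightarrow> ('x \<Rightarrow>\<^sub>0 nat) list \<Rightarrow> 'k::field mat \<Rightarrow> 'k mat \<Rightarrow> bool" where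
  "strand_exact X t a b C D \<longleftrightarrow> (\<forall>s. Poly_Mapping.keys s \<subseteq> X \<longrightarrow>
     {v \<in> strand a s. C *\<^sub>v v = 0\<^sub>v (length t)} = (\<lambda>w. D *\<^sub>v w) ` strand b s)"

text \<open>Polynomial vectors are finite sums of homogeneous ones and the maps respect this
  decomposition. One direction embeds a strand by \<open>hom_vec\<close> and projects back by
  \<open>part_vec\<close>; the other chooses a preimage in every degree that occurs and adds them
  up.\<close>

lemma poly_mat_exact_iff:
  fixes C D :: "'k::field mat" and t a b :: "('x \<Rightarrow>\<^sub>0 nat) list"
  assumes C: "graded_mat t a C" and D: "graded_mat a b D"
    and t: "\<And>s. s \<in> set t \<Longrightarrow> Poly_Mapping.keys s \<subseteq> X"
    and a: "\<And>s. s \<in> set a \<Longrightarrow> Poly_Mapping.keys s \<subseteq> X"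
    and b: "\<And>s. s \<in> set b \<Longrightarrow> Poly_Mapping.keys s \<subseteq> X"
  shows "{v \<in> free_module X (length a). poly_mat t a C *\<^sub>v v = 0\<^sub>v (length t)}
      = (\<lambda>w. poly_mat a b D *\<^sub>v w) ` free_module X (length b) \<longleftrightarrow> strand_exact X t a b C D" (is "?K = ?I \<longleftrightarrow> _")
proof
  assume eq: "?K = ?I"
  show "strand_exact X t a b C D"
    unfolding strand_exact_def
  proof (intro allI impI subset_antisym subsetI)
    fix s v assume s: "Poly_Mapping.keys s \<subseteq> X" and "v \<in> {v \<in> strand a s. C *\<^sub>v v = 0\<^sub>v (length t)}"
    then have v: "v \<in> strand a s" "C *\<^sub>v v = 0\<^sub>v (length t)" by auto
    then have "hom_vec a s v \<in> ?K"
      using hom_vec_free_module[OF s] by (simp add: poly_mat_hom_vec[OF C])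
    then have "hom_vec a s v \<in> ?I" unfolding eq .
    then obtain W where W: "W \<in> free_module X (length b)" "hom_vec a s v = poly_mat a b D *\<^sub>v W" by blast
    then have "v = D *\<^sub>v part_vec b s W"
      using part_vec_hom_vec[OF v(1)] part_vec_poly_mat[OF D, of W s] by (auto simp: free_module_def)
    then show "v \<in> (\<lambda>w. D *\<^sub>v w) ` strand b s" by (rule image_eqI) simp
  next
    fix s v assume s: "Poly_Mapping.keys s \<subseteq> X" and "v \<in> (\<lambda>w. D *\<^sub>v w) ` strand b s"
    then obtain w where w: "w \<in> strand b s" and v: "v = D *\<^sub>v w" by blast
    have vs: "v \<in> strand a s" using graded_mult_strand[OF D w] v by simp
    have "poly_mat a b D *\<^sub>v hom_vec b s w \<in> ?I" by (rule imageI[OF hom_vec_free_module[OF s]])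
    then have "hom_vec a s v \<in> ?K" using eq poly_mat_hom_vec[OF D w] v by simp
    then have "hom_vec t s (C *\<^sub>v v) = 0\<^sub>v (length t)" using poly_mat_hom_vec[OF C vs] by simp
    then have "C *\<^sub>v v = 0\<^sub>v (length t)"
      using part_vec_hom_vec[OF graded_mult_strand[OF C vs]] by simp
    then show "v \<in> {v \<in> strand a s. C *\<^sub>v v = 0\<^sub>v (length t)}" using vs by simp
  qed
next
  assume ex: "strand_exact X t a b C D"
  then have strands: "{v \<in> strand a s. C *\<^sub>v v = 0\<^sub>v (length t)} = (\<lambda>w. D *\<^sub>v w) ` strand b s"
    if "Poly_Mapping.keys s \<subseteq> X" for s using that by (simp add: strand_exact_def)
  show "?K = ?I"
  proof (intro subset_antisym subsetI)
    fix V assume "V \<in> ?I"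
    then obtain W where W: "W \<in> free_module X (length b)" and V: "V = poly_mat a b D *\<^sub>v W" by blast
    have Wc: "W \<in> carrier_vec (length b)" using W by (simp add: free_module_def)
    have Vf: "V \<in> free_module X (length a)" using poly_mat_free_module[OF b W] V by simp
    have Vc: "V \<in> carrier_vec (length a)" using Vf by (simp add: free_module_def)
    have "poly_mat t a C *\<^sub>v V = 0\<^sub>v (length t)"
    proof (rule free_module_eqI[OF poly_mat_free_module[OF a Vf] _ t])
      show "0\<^sub>v (length t) \<in> free_module X (length t)" by (simp add: free_module_def carrier_mpoly_ring)
      fix s :: "'x \<Rightarrow>\<^sub>0 nat" assume s: "Poly_Mapping.keys s \<subseteq> X"
      have "D *\<^sub>v part_vec b s W \<in> {v \<in> strand a s. C *\<^sub>v v = 0\<^sub>v (length t)}"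
        unfolding strands[OF s] by (rule imageI) simp
      moreover have "part_vec a s V = D *\<^sub>v part_vec b s W" by (simp add: V part_vec_poly_mat[OF D Wc])
      ultimately show "part_vec t s (poly_mat t a C *\<^sub>v V) = part_vec t s (0\<^sub>v (length t))"
        by (simp add: part_vec_poly_mat[OF C Vc])
    qed
    then show "V \<in> ?K" using Vf by simp
  next
    fix V assume "V \<in> ?K"
    then have V: "V \<in> free_module X (length a)" "poly_mat t a C *\<^sub>v V = 0\<^sub>v (length t)" by auto
    have Vc: "V \<in> carrier_vec (length a)" using V by (simp add: free_module_def)
    have "\<exists>w. w \<in> strand b s \<and> part_vec a s V = D *\<^sub>v w" if s: "Poly_Mapping.keys s \<subseteq> X" for s :: "'x \<Rightarrow>\<^sub>0 nat"
    proof -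
      have "C *\<^sub>v part_vec a s V = 0\<^sub>v (length t)" using part_vec_poly_mat[OF C Vc, of s] V by simp
      then have "part_vec a s V \<in> {v \<in> strand a s. C *\<^sub>v v = 0\<^sub>v (length t)}" by simp
      then show ?thesis unfolding strands[OF s] by blast
    qed
    then have "\<forall>s\<in>{s. Poly_Mapping.keys s \<subseteq> X}. \<exists>w. w \<in> strand b s \<and> part_vec a s V = D *\<^sub>v w"
      by simp
    from bchoice[OF this]
    obtain w :: "('x \<Rightarrow>\<^sub>0 nat) \<Rightarrow> 'k vec" where w: "\<And>s. Poly_Mapping.keys s \<subseteq> X \<Longrightarrow> w s \<in> strand b s"
        "\<And>s. Poly_Mapping.keys s \<subseteq> X \<Longrightarrow> part_vec a s V = D *\<^sub>v w s" by auto
    \<comment> \<open>These are the finitely many degrees in which \<open>V\<close> has a nonzero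
      component; preimages are summed over them only, so that \<open>W\<close> is a vector of
      polynomials.\<close>
    define S where "S = (\<Union>i<length a. (\<lambda>m. m + a ! i) ` Poly_Mapping.keys (V $ i))"
    have finS: "finite S" by (simp add: S_def)
    have SX: "Poly_Mapping.keys s \<subseteq> X" if s: "s \<in> S" for s
    proof -
      obtain i m where im: "i < length a" "m \<in> Poly_Mapping.keys (V $ i)" "s = m + a ! i"
        using s by (auto simp: S_def)
      then have "Poly_Mapping.keys m \<subseteq> X" using V by (simp add: free_module_def carrier_mpoly_ring)
      then show ?thesis using im a[OF nth_mem[OF im(1)]] by (simp add: keys_add_nat)
    qed
    define W where "W = vec (length b) (\<lambda>j. \<Sum>s\<in>S. hom_vec b s (w s) $ j)"
    have Wf: "W \<in> free_module X (length b)"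
      using hom_vec_free_module[OF SX] by (auto simp: W_def free_module_def intro!: carrier_sum)
    have Wc: "W \<in> carrier_vec (length b)" using Wf by (simp add: free_module_def)
    have part_W: "part_vec b s W = (if s \<in> S then w s else 0\<^sub>v (length b))" if s: "Poly_Mapping.keys s \<subseteq> X" for s :: "'x \<Rightarrow>\<^sub>0 nat"
    proof (rule eq_vecI)
      fix j assume "j < dim_vec (if s \<in> S then w s else 0\<^sub>v (length b))"
      then have j: "j < length b" using strandD[OF w(1)[OF s]] by (auto split: if_splits)
      \<comment> \<open>Adding \<open>b ! j\<close> back to an exponent recovers the degree, so
        summands of other degrees contribute nothing to the component of degree
        \<open>s\<close>.\<close>
      have eq: "Poly_Mapping.lookup (Poly_Mapping.single (s' - b ! j) (w s' $ j)) (s - b ! j)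
        = (if s' = s then w s $ j else 0)" if s': "s' \<in> S" and le: "b ! j \<preceq> s" for s'
      proof (cases "w s' $ j = 0")
        case False
        then have le': "b ! j \<preceq> s'" using w(1)[OF SX[OF s']] j by (simp add: strand_def)
        have "s' - b ! j = s - b ! j \<longleftrightarrow> s' = s"
          using mle_diff_add[OF le] mle_diff_add[OF le'] by metis
        then show ?thesis by (auto simp: lookup_single)
      qed auto
      show "part_vec b s W $ j = (if s \<in> S then w s else 0\<^sub>v (length b)) $ j"
      proof (cases "b ! j \<preceq> s")
        case True
        then have "part_vec b s W $ j = (\<Sum>s'\<in>S. if s' = s then w s $ j else 0)"
          using j eq by (simp add: part_vec_def W_def lookup_sum hom_vec_def)
        then show ?thesis using j finS by simp
      next
        case False
        then have "w s $ j = 0" using w(1)[OF s] j by (auto simp: strand_def)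
        then show ?thesis using False j by (simp add: part_vec_def)
      qed
    qed (use strandD[OF w(1)[OF s]] in auto)
    have "V = poly_mat a b D *\<^sub>v W"
    proof (rule free_module_eqI[OF V(1) poly_mat_free_module[OF b Wf] a])
      fix s :: "'x \<Rightarrow>\<^sub>0 nat" assume s: "Poly_Mapping.keys s \<subseteq> X"
      show "part_vec a s V = part_vec a s (poly_mat a b D *\<^sub>v W)"
      proof (cases "s \<in> S")
        case True
        then show ?thesis by (simp add: part_vec_poly_mat[OF D Wc] part_W[OF s] w(2)[OF s])
      next
        case False
        have "part_vec a s V = 0\<^sub>v (length a)"
        proof (rule eq_vecI)
          fix i assume "i < dim_vec (0\<^sub>v (length a))"
          then have i: "i < length a" by simp
          have "Poly_Mapping.lookup (V $ i) (s - a ! i) = 0" if "a ! i \<preceq> s"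
          proof (rule ccontr)
            assume "Poly_Mapping.lookup (V $ i) (s - a ! i) \<noteq> 0"
            then have "s - a ! i \<in> Poly_Mapping.keys (V $ i)" by (simp add: in_keys_iff)
            then have "s - a ! i + a ! i \<in> S" using i by (auto simp: S_def)
            then show False using False mle_diff_add[OF that] by simp
          qed
          then show "part_vec a s V $ i = 0\<^sub>v (length a) $ i" using i by (simp add: part_vec_def)
        qed (simp add: part_vec_def)
        moreover have "D *\<^sub>v 0\<^sub>v (length b) = 0\<^sub>v (length a)" using graded_matD[OF D] by auto
        ultimately show ?thesis using False by (simp add: part_vec_poly_mat[OF D Wc] part_W[OF s])
      qed
    qed
    then show "V \<in> ?I" using Wf by blast
  qed
qed

text \<open>In a fixed degree the image of the augmentation depends on the ideal alone. Two
  resolutions of the same ideal therefore have equal images at the bottom, which is what starts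
  their comparison.\<close>

lemma poly_mat_augmentation:
  fixes C :: "'k::field mat"
  assumes C: "graded_mat [0] a C" and s: "Poly_Mapping.keys s \<subseteq> X"
    and I: "(\<lambda>v. (poly_mat [0] a C *\<^sub>v v) $ 0) ` free_module X (length a) = I"
  shows "(\<lambda>w. C *\<^sub>v w) ` strand a s = {u \<in> carrier_vec 1. Poly_Mapping.single s (u $ 0) \<in> I}"
proof (intro subset_antisym subsetI)
  fix u assume "u \<in> (\<lambda>w. C *\<^sub>v w) ` strand a s"
  then obtain w where w: "w \<in> strand a s" "u = C *\<^sub>v w" by blast
  have "(poly_mat [0] a C *\<^sub>v hom_vec a s w) $ 0 \<in> I" using I hom_vec_free_module[OF s] by blast
  then have "Poly_Mapping.single s (u $ 0) \<in> I" using w by (simp add: poly_mat_hom_vec[OF C]) (simp add: hom_vec_def)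
  moreover have "u \<in> carrier_vec 1" using graded_mult_strand[OF C w(1)] w(2) by (simp add: strand_def)
  ultimately show "u \<in> {u \<in> carrier_vec 1. Poly_Mapping.single s (u $ 0) \<in> I}" by simp
next
  fix u :: "'k vec" assume "u \<in> {u \<in> carrier_vec 1. Poly_Mapping.single s (u $ 0) \<in> I}"
  then have u: "u \<in> carrier_vec 1" "Poly_Mapping.single s (u $ 0) \<in> I" by auto
  then obtain V where V: "V \<in> free_module X (length a)" "Poly_Mapping.single s (u $ 0) = (poly_mat [0] a C *\<^sub>v V) $ 0"
    using I by blast
  have Vc: "V \<in> carrier_vec (length a)" using V by (simp add: free_module_def)
  have "part_vec [0] s (poly_mat [0] a C *\<^sub>v V) = u"
  proof (rule eq_vecI)
    fix i assume "i < dim_vec u"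
    then have "i = 0" using u by simp
    then show "part_vec [0] s (poly_mat [0] a C *\<^sub>v V) $ i = u $ i"
      using V(2)[symmetric] by (simp add: part_vec_def del: index_mult_mat_vec)
  qed (use u in \<open>simp add: part_vec_def\<close>)
  then have "u = C *\<^sub>v part_vec a s V" by (simp add: part_vec_poly_mat[OF C Vc])
  then show "u \<in> (\<lambda>w. C *\<^sub>v w) ` strand a s" by (rule image_eqI) simp
qed

text \<open>The degree condition leaves only one possible exponent, \<open>a ! j - t ! i\<close>, in
  each entry, so reading off its coefficient loses nothing.\<close>

lemma graded_scalar_mat:
  assumes D: "D \<in> carrier_mat (length t) (length a)"
    and deg: "\<And>i j m. i < length t \<Longrightarrow> j < length a \<Longrightarrow> m \<in> Poly_Mapping.keys (D $$ (i, j)) \<Longrightarrow> m + t ! i = a ! j"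
  shows "graded_mat t a (scalar_mat t a D)" and "poly_mat t a (scalar_mat t a D) = D"
proof -
  have *: "t ! i \<preceq> a ! j" if "i < length t" "j < length a" "m \<in> Poly_Mapping.keys (D $$ (i, j))" for i j m
    using deg[OF that] by (metis mle_add)
  show "graded_mat t a (scalar_mat t a D)"
    unfolding graded_mat_def
  proof (intro conjI allI impI)
    fix i j assume ij: "i < length t" "j < length a" and "scalar_mat t a D $$ (i, j) \<noteq> 0"
    then have "a ! j - t ! i \<in> Poly_Mapping.keys (D $$ (i, j))" by (simp add: scalar_mat_def in_keys_iff)
    then show "t ! i \<preceq> a ! j" using *[OF ij] by blast
  qed (simp add: scalar_mat_def)
  show "poly_mat t a (scalar_mat t a D) = D"
  proof (rule eq_matI)
    fix i j assume "i < dim_row D" "j < dim_col D"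
    then have ij: "i < length t" "j < length a" using D by auto
    have "Poly_Mapping.single (a ! j - t ! i) (Poly_Mapping.lookup (D $$ (i, j)) (a ! j - t ! i)) = D $$ (i, j)"
    proof (rule poly_mapping_eqI)
      fix m
      have "Poly_Mapping.lookup (D $$ (i, j)) m = 0" if "m \<noteq> a ! j - t ! i"
      proof (rule ccontr)
        assume "Poly_Mapping.lookup (D $$ (i, j)) m \<noteq> 0"
        then have "m + t ! i = a ! j" using deg[OF ij] by (simp add: in_keys_iff)
        then show False using that by (metis add_diff_cancel_right')
      qed
      then show "Poly_Mapping.lookup (Poly_Mapping.single (a ! j - t ! i) (Poly_Mapping.lookup (D $$ (i, j)) (a ! j - t ! i))) m
        = Poly_Mapping.lookup (D $$ (i, j)) m" by (auto simp: lookup_single when_def)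
    qed
    then show "poly_mat t a (scalar_mat t a D) $$ (i, j) = D $$ (i, j)"
      using ij by (simp add: poly_mat_def scalar_mat_def)
  qed (use D in \<open>auto simp: poly_mat_def\<close>)
qed

subsection \<open>Comparison of resolutions\<close>

lemma graded_col_strand:
  assumes "graded_mat t b B" "j < length b"
  shows "col B j \<in> strand t (b ! j)"
  using assms by (auto simp: strand_def graded_mat_def col_def)

lemma graded_one: "graded_mat a a (1\<^sub>m (length a))"
  by (auto simp: graded_mat_def)

lemma graded_zero: "graded_mat t a (0\<^sub>m (length t) (length a))"
  by (auto simp: graded_mat_def)

lemma graded_add: "graded_mat t a A \<Longrightarrow> graded_mat t a B \<Longrightarrow> graded_mat t a (A + B)"
  by (fastforce simp: graded_mat_def)

lemma graded_minus: "graded_mat t a A \<Longrightarrow> graded_mat t a B \<Longrightarrow> graded_mat t a (A - B)"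
  unfolding graded_mat_def
proof (intro conjI allI impI)
  assume A: "A \<in> carrier_mat (length t) (length a) \<and>
      (\<forall>i<length t. \<forall>j<length a. A $$ (i, j) \<noteq> 0 \<longrightarrow> t ! i \<preceq> a ! j)"
    and B: "B \<in> carrier_mat (length t) (length a) \<and>
      (\<forall>i<length t. \<forall>j<length a. B $$ (i, j) \<noteq> 0 \<longrightarrow> t ! i \<preceq> a ! j)"
  show "A - B \<in> carrier_mat (length t) (length a)" using B by auto
  fix i j assume ij: "i < length t" "j < length a" and "(A - B) $$ (i, j) \<noteq> 0"
  then have "A $$ (i, j) \<noteq> 0 \<or> B $$ (i, j) \<noteq> 0" using B by auto
  then show "t ! i \<preceq> a ! j" using A B ij by blast
qed

text \<open>Column \<open>j\<close> is homogeneous of degree \<open>b ! j\<close> and can be lifted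
  on its own inside that strand. This is the projectivity of graded free modules.\<close>

lemma graded_lift:
  assumes C: "graded_mat t a C" and B: "graded_mat t b B"
    and im: "\<And>j. j < length b \<Longrightarrow> col B j \<in> (\<lambda>w. C *\<^sub>v w) ` strand a (b ! j)"
  obtains L where "graded_mat a b L" "C * L = B"
proof -
  have "\<forall>j\<in>{..<length b}. \<exists>w. w \<in> strand a (b ! j) \<and> col B j = C *\<^sub>v w"
    using im by auto
  from bchoice[OF this] obtain w where
    w: "\<And>j. j < length b \<Longrightarrow> w j \<in> strand a (b ! j)" "\<And>j. j < length b \<Longrightarrow> col B j = C *\<^sub>v w j"
    by auto
  define L where "L = mat (length a) (length b) (\<lambda>(i, j). w j $ i)"
  have col: "col L j = w j" if "j < length b" for j
    using strandD[OF w(1)[OF that]] that by (intro eq_vecI) (auto simp: L_def)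
  show thesis
  proof (rule that)
    show "graded_mat a b L" using w(1) by (auto simp: graded_mat_def L_def strand_def)
    show "C * L = B"
    proof (rule eq_matI)
      fix i j assume "i < dim_row B" "j < dim_col B"
      then have ij: "i < length t" "j < length b" using graded_matD[OF B] by auto
      have "(C * L) $$ (i, j) = row C i \<bullet> col L j"
        using ij graded_matD[OF C] by (simp add: L_def)
      also have "\<dots> = (C *\<^sub>v w j) $ i" using ij graded_matD[OF C] by (simp add: col)
      also have "\<dots> = B $$ (i, j)" using ij graded_matD[OF B] w(2)[OF ij(2), symmetric] by simp
      finally show "(C * L) $$ (i, j) = B $$ (i, j)" .
    qed (use graded_matD[OF B] graded_matD[OF C] in \<open>auto simp: L_def\<close>)
  qed
qed

text \<open>A nonzero summand of a diagonal entry would make two degrees divide each other and hence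
  coincide, which the last hypothesis forbids for one of the factors. Through this lemma minimality
  removes homotopies from the diagonal.\<close>

lemma graded_mult_diag:
  assumes A: "graded_mat t a A" and B: "graded_mat a t B" and j: "j < length t"
    and "(\<forall>i<length t. \<forall>k<length a. A $$ (i, k) \<noteq> 0 \<longrightarrow> t ! i \<noteq> a ! k) \<or>
      (\<forall>i<length a. \<forall>k<length t. B $$ (i, k) \<noteq> 0 \<longrightarrow> a ! i \<noteq> t ! k)"
  shows "(A * B) $$ (j, j) = 0"
proof -
  have "A $$ (j, k) * B $$ (k, j) = 0" if k: "k < length a" for k
  proof (rule ccontr)
    assume nz: "A $$ (j, k) * B $$ (k, j) \<noteq> 0"
    then have "t ! j \<preceq> a ! k" "a ! k \<preceq> t ! j" using A B j k by (auto simp: graded_mat_def)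
    then have "t ! j = a ! k" by (rule mle_antisym)
    moreover have "A $$ (j, k) \<noteq> 0" "B $$ (k, j) \<noteq> 0" using nz by auto
    ultimately show False using assms(4) j k by metis
  qed
  then have "(\<Sum>k<length a. A $$ (j, k) * B $$ (k, j)) = 0" by (intro sum.neutral ballI) simp
  then show ?thesis using mult_mat_index[OF graded_matD[OF A] graded_matD[OF B] j j] by simp
qed

text \<open>Strandwise exact complexes of scalar matrices: level \<open>0\<close> is the codomain of the augmentation.\<close>

definition scalar_resolution ::
    "'x set \<Rightarrow> (nat \<Rightarrow> ('x \<Rightarrow>\<^sub>0 nat) list) \<Rightarrow> (nat \<Rightarrow> 'k::field mat) \<Rightarrow> bool" where
  "scalar_resolution X b C \<longleftrightarrow>
     (\<forall>k. \<forall>s\<in>set (b k). Poly_Mapping.keys s \<subseteq> X) \<and>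
     (\<forall>k. graded_mat (b k) (b (Suc k)) (C k)) \<and>
     (\<forall>k. strand_exact X (b k) (b (Suc k)) (b (Suc (Suc k))) (C k) (C (Suc k)))"

text \<open>A nonzero entry between equal degrees would be a nonzero constant in the polynomial
  matrix. The index \<open>Suc k\<close> leaves out the augmentation \<open>C 0\<close>, as
  minimality of a resolution does.\<close>

definition scalar_minimal :: "(nat \<Rightarrow> ('x \<Rightarrow>\<^sub>0 nat) list) \<Rightarrow> (nat \<Rightarrow> 'k::field mat) \<Rightarrow> bool" where
  "scalar_minimal b C \<longleftrightarrow> (\<forall>k. \<forall>i<length (b (Suc k)). \<forall>j<length (b (Suc (Suc k))).
     C (Suc k) $$ (i, j) \<noteq> 0 \<longrightarrow> b (Suc k) ! i \<noteq> b (Suc (Suc k)) ! j)"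

lemma scalar_resolution_kernel:
  assumes R: "scalar_resolution X b C" and s: "Poly_Mapping.keys s \<subseteq> X"
  shows "{v \<in> strand (b (Suc k)) s. C k *\<^sub>v v = 0\<^sub>v (length (b k))}
    = (\<lambda>w. C (Suc k) *\<^sub>v w) ` strand (b (Suc (Suc k))) s"
  using assms by (simp add: scalar_resolution_def strand_exact_def)

lemma scalar_resolution_graded: "scalar_resolution X b C \<Longrightarrow> graded_mat (b k) (b (Suc k)) (C k)"
  by (simp add: scalar_resolution_def)

lemma mult_unit_vec:
  fixes A :: "'k::field mat"
  assumes A: "A \<in> carrier_mat n m" and j: "j < m"
  shows "A *\<^sub>v unit_vec m j = col A j"
  using assms by (intro eq_vecI) (auto simp: scalar_prod_right_unit)

lemma mat_eq_zeroI:
  fixes A :: "'k::field mat"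
  assumes A: "A \<in> carrier_mat n m" and "\<And>j. j < m \<Longrightarrow> A *\<^sub>v unit_vec m j = 0\<^sub>v n"
  shows "A = 0\<^sub>m n m"
proof (rule eq_matI)
  fix i j assume "i < dim_row (0\<^sub>m n m)" "j < dim_col (0\<^sub>m n m)"
  then have ij: "i < n" "j < m" by auto
  have "col A j = 0\<^sub>v n" using assms(2)[OF ij(2)] mult_unit_vec[OF A ij(2)] by simp
  then have "col A j $ i = 0" using ij by simp
  then show "A $$ (i, j) = 0\<^sub>m n m $$ (i, j)" using ij A by simp
qed (use A in auto)

lemma scalar_resolution_comp:
  assumes R: "scalar_resolution X b C"
  shows "C k * C (Suc k) = 0\<^sub>m (length (b k)) (length (b (Suc (Suc k))))"
proof (rule mat_eq_zeroI)
  let ?m = "length (b (Suc (Suc k)))"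
  note g = scalar_resolution_graded[OF R]
  show "C k * C (Suc k) \<in> carrier_mat (length (b k)) ?m"
    using graded_matD[OF g] by (rule mult_carrier_mat) (rule graded_matD[OF g])
  fix j assume j: "j < ?m"
  have "Poly_Mapping.keys (b (Suc (Suc k)) ! j) \<subseteq> X"
    using R nth_mem[OF j] by (simp add: scalar_resolution_def)
  from scalar_resolution_kernel[OF R this, of k]
  have "C (Suc k) *\<^sub>v unit_vec ?m j \<in> {v \<in> strand (b (Suc k)) (b (Suc (Suc k)) ! j). C k *\<^sub>v v = 0\<^sub>v (length (b k))}"
    using unit_vec_strand[OF j] by (simp only:) (rule imageI)
  then show "C k * C (Suc k) *\<^sub>v unit_vec ?m j = 0\<^sub>v (length (b k))"
    by (simp add: assoc_mult_mat_vec[OF graded_matD[OF g] graded_matD[OF g]])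
qed

text \<open>This is the condition under which \<open>f\<close> lifts one level up. At the bottom it
  holds because both complexes resolve the same ideal; above it comes from exactness of the
  target.\<close>

definition maps_image ::
    "'x set \<Rightarrow> (nat \<Rightarrow> ('x \<Rightarrow>\<^sub>0 nat) list) \<Rightarrow> (nat \<Rightarrow> 'k::field mat) \<Rightarrow>
      (nat \<Rightarrow> ('x \<Rightarrow>\<^sub>0 nat) list) \<Rightarrow> (nat \<Rightarrow> 'k mat) \<Rightarrow> nat \<Rightarrow> 'k mat \<Rightarrow> bool" where
  "maps_image X b C b' C' k f \<longleftrightarrow> (\<forall>s. Poly_Mapping.keys s \<subseteq> X \<longrightarrow>
     (\<forall>w\<in>strand (b (Suc k)) s. f *\<^sub>v (C k *\<^sub>v w) \<in> (\<lambda>w. C' k *\<^sub>v w) ` strand (b' (Suc k)) s))"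

text \<open>One step of the comparison theorem. The columns of \<open>f * C k\<close> are lifted
  through \<open>C' k\<close>; the lift sends boundaries to cycles of the second complex, and
  exactness there yields the image condition for the next step.\<close>

lemma comparison_lift:
  fixes C C' :: "nat \<Rightarrow> 'k::field mat" and b b' :: "nat \<Rightarrow> ('x \<Rightarrow>\<^sub>0 nat) list"
  assumes R: "scalar_resolution X b C" and R': "scalar_resolution X b' C'"
    and f: "graded_mat (b' k) (b k) f" and im: "maps_image X b C b' C' k f"
  obtains f' where "graded_mat (b' (Suc k)) (b (Suc k)) f'" "C' k * f' = f * C k"
    "maps_image X b C b' C' (Suc k) f'"
proof -
  note g = scalar_resolution_graded[OF R] and g' = scalar_resolution_graded[OF R']
  note c = graded_matD[OF g] and c' = graded_matD[OF g'] and fc = graded_matD[OF f]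
  obtain f' where f': "graded_mat (b' (Suc k)) (b (Suc k)) f'" "C' k * f' = f * C k"
  proof (rule graded_lift[OF g' graded_mat_mult[OF f g]])
    fix j assume j: "j < length (b (Suc k))"
    have s: "Poly_Mapping.keys (b (Suc k) ! j) \<subseteq> X" using R nth_mem[OF j] by (simp add: scalar_resolution_def)
    have "f *\<^sub>v (C k *\<^sub>v unit_vec (length (b (Suc k))) j) = col (f * C k) j"
      using mult_unit_vec[OF mult_carrier_mat[OF fc c] j] assoc_mult_mat_vec[OF fc c unit_vec_carrier] by metis
    moreover have "f *\<^sub>v (C k *\<^sub>v unit_vec (length (b (Suc k))) j) \<in> (\<lambda>w. C' k *\<^sub>v w) ` strand (b' (Suc k)) (b (Suc k) ! j)"
      using im[unfolded maps_image_def, rule_format, OF s unit_vec_strand[OF j]] .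
    ultimately show "col (f * C k) j \<in> (\<lambda>w. C' k *\<^sub>v w) ` strand (b' (Suc k)) (b (Suc k) ! j)" by simp
  qed
  have "maps_image X b C b' C' (Suc k) f'"
    unfolding maps_image_def
  proof (intro allI impI ballI)
    fix s :: "'x \<Rightarrow>\<^sub>0 nat" and w :: "'k vec" assume s: "Poly_Mapping.keys s \<subseteq> X" and w: "w \<in> strand (b (Suc (Suc k))) s"
    have w1: "C (Suc k) *\<^sub>v w \<in> strand (b (Suc k)) s" by (rule graded_mult_strand[OF g w])
    have "C (Suc k) *\<^sub>v w \<in> {v \<in> strand (b (Suc k)) s. C k *\<^sub>v v = 0\<^sub>v (length (b k))}"
      unfolding scalar_resolution_kernel[OF R s] by (rule imageI[OF w])
    then have z: "C k *\<^sub>v (C (Suc k) *\<^sub>v w) = 0\<^sub>v (length (b k))" by simp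
    have "C' k *\<^sub>v (f' *\<^sub>v (C (Suc k) *\<^sub>v w)) = (C' k * f') *\<^sub>v (C (Suc k) *\<^sub>v w)"
      using assoc_mult_mat_vec[OF c' graded_matD[OF f'(1)] strandD[OF w1]] by simp
    also have "\<dots> = f *\<^sub>v 0\<^sub>v (length (b k))"
      unfolding f'(2) using assoc_mult_mat_vec[OF fc c strandD[OF w1]] z by simp
    also have "\<dots> = 0\<^sub>v (length (b' k))" using fc by auto
    finally have "C' k *\<^sub>v (f' *\<^sub>v (C (Suc k) *\<^sub>v w)) = 0\<^sub>v (length (b' k))" .
    then have "f' *\<^sub>v (C (Suc k) *\<^sub>v w) \<in> {v \<in> strand (b' (Suc k)) s. C' k *\<^sub>v v = 0\<^sub>v (length (b' k))}"
      using graded_mult_strand[OF f'(1) w1] by simp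
    then show "f' *\<^sub>v (C (Suc k) *\<^sub>v w) \<in> (\<lambda>w. C' (Suc k) *\<^sub>v w) ` strand (b' (Suc (Suc k))) s"
      unfolding scalar_resolution_kernel[OF R' s] .
  qed
  then show thesis using f' that by blast
qed

text \<open>The pair \<open>h, g\<close> makes \<open>\<psi> \<phi>\<close> homotopic to the identity: at level \<open>k + 1\<close> the matrix \<open>g\<close> is \<open>h\<close> of level
  \<open>k\<close> composed with \<open>C k\<close>. Minimality makes the diagonals of both correction terms vanish.\<close>

lemma comparison_homotopy:
  fixes C C' :: "nat \<Rightarrow> 'k::field mat" and b b' :: "nat \<Rightarrow> ('x \<Rightarrow>\<^sub>0 nat) list"
  assumes R: "scalar_resolution X b C" and R': "scalar_resolution X b' C'" and M: "scalar_minimal b C"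
    and b0: "b 0 = b' 0"
    and im: "\<And>s. Poly_Mapping.keys s \<subseteq> X \<Longrightarrow>
      (\<lambda>w. C 0 *\<^sub>v w) ` strand (b (Suc 0)) s = (\<lambda>w. C' 0 *\<^sub>v w) ` strand (b' (Suc 0)) s"
  shows "\<exists>\<phi> \<psi> h g. graded_mat (b' k) (b k) \<phi> \<and> graded_mat (b k) (b' k) \<psi> \<and>
    graded_mat (b (Suc k)) (b k) h \<and> graded_mat (b k) (b k) g \<and>
    maps_image X b C b' C' k \<phi> \<and> maps_image X b' C' b C k \<psi> \<and>
    \<psi> * \<phi> = 1\<^sub>m (length (b k)) + C k * h + g \<and> g * C k = 0\<^sub>m (length (b k)) (length (b (Suc k))) \<and>
    (\<forall>j<length (b k). (C k * h) $$ (j, j) = 0 \<and> g $$ (j, j) = 0) \<and>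
    (\<forall>j<length (b (Suc k)). (h * C k) $$ (j, j) = 0)"
proof (induction k)
  case 0
  let ?n = "length (b 0)"
  note g = scalar_resolution_graded[OF R] and g' = scalar_resolution_graded[OF R']
  note c = graded_matD[OF g[of 0]]
  have m: "maps_image X b C b' C' 0 (1\<^sub>m ?n)" "maps_image X b' C' b C 0 (1\<^sub>m ?n)"
  proof -
    have 1: "1\<^sub>m ?n *\<^sub>v (C 0 *\<^sub>v w) = C 0 *\<^sub>v w" if "w \<in> strand (b (Suc 0)) s"
      for w and s :: "'x \<Rightarrow>\<^sub>0 nat"
      using mult_mat_vec_carrier[OF c strandD[OF that]] by simp
    have 2: "1\<^sub>m ?n *\<^sub>v (C' 0 *\<^sub>v w) = C' 0 *\<^sub>v w" if "w \<in> strand (b' (Suc 0)) s"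
      for w and s :: "'x \<Rightarrow>\<^sub>0 nat"
      using mult_mat_vec_carrier[OF graded_matD[OF g'[of 0]] strandD[OF that]] b0 by simp
    show "maps_image X b C b' C' 0 (1\<^sub>m ?n)"
      unfolding maps_image_def
    proof (intro allI impI ballI)
      fix s :: "'x \<Rightarrow>\<^sub>0 nat" and w :: "'k vec"
      assume s: "Poly_Mapping.keys s \<subseteq> X" and w: "w \<in> strand (b (Suc 0)) s"
      show "1\<^sub>m ?n *\<^sub>v (C 0 *\<^sub>v w) \<in> (\<lambda>w. C' 0 *\<^sub>v w) ` strand (b' (Suc 0)) s"
        unfolding 1[OF w] im[OF s, symmetric] by (rule imageI[OF w])
    qed
    show "maps_image X b' C' b C 0 (1\<^sub>m ?n)"
      unfolding maps_image_def
    proof (intro allI impI ballI)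
      fix s :: "'x \<Rightarrow>\<^sub>0 nat" and w :: "'k vec"
      assume s: "Poly_Mapping.keys s \<subseteq> X" and w: "w \<in> strand (b' (Suc 0)) s"
      show "1\<^sub>m ?n *\<^sub>v (C' 0 *\<^sub>v w) \<in> (\<lambda>w. C 0 *\<^sub>v w) ` strand (b (Suc 0)) s"
        unfolding 2[OF w] im[OF s] by (rule imageI[OF w])
    qed
  qed
  let ?h = "0\<^sub>m (length (b (Suc 0))) ?n"
  have z: "C 0 * ?h = 0\<^sub>m ?n ?n" "?h * C 0 = 0\<^sub>m (length (b (Suc 0))) (length (b (Suc 0)))"
    "0\<^sub>m ?n ?n * C 0 = 0\<^sub>m ?n (length (b (Suc 0)))" using c by auto
  show ?case
    by (rule exI[of _ "1\<^sub>m ?n"], rule exI[of _ "1\<^sub>m ?n"], rule exI[of _ ?h], rule exI[of _ "0\<^sub>m ?n ?n"])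
      (use m graded_one[of "b 0"] graded_zero[of "b (Suc 0)" "b 0"] graded_zero[of "b 0" "b 0"] in \<open>simp add: z b0[symmetric]\<close>)
next
  case (Suc k)
  let ?n = "length (b k)" and ?m = "length (b (Suc k))" and ?n' = "length (b' k)" and ?m' = "length (b' (Suc k))"
  note gr = scalar_resolution_graded[OF R] and gr' = scalar_resolution_graded[OF R']
  obtain \<phi> \<psi> h g where phi: "graded_mat (b' k) (b k) \<phi>" "maps_image X b C b' C' k \<phi>"
    and psi: "graded_mat (b k) (b' k) \<psi>" "maps_image X b' C' b C k \<psi>"
    and h: "graded_mat (b (Suc k)) (b k) h" and g: "graded_mat (b k) (b k) g"
    and hom: "\<psi> * \<phi> = 1\<^sub>m ?n + C k * h + g" and gC: "g * C k = 0\<^sub>m ?n ?m"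
    and diag: "\<And>j. j < ?m \<Longrightarrow> (h * C k) $$ (j, j) = 0"
    using Suc.IH by blast
  obtain \<phi>' where phi': "graded_mat (b' (Suc k)) (b (Suc k)) \<phi>'" "C' k * \<phi>' = \<phi> * C k"
    "maps_image X b C b' C' (Suc k) \<phi>'" using comparison_lift[OF R R' phi] .
  obtain \<psi>' where psi': "graded_mat (b (Suc k)) (b' (Suc k)) \<psi>'" "C k * \<psi>' = \<psi> * C' k"
    "maps_image X b' C' b C (Suc k) \<psi>'" using comparison_lift[OF R' R psi] .
  \<comment> \<open>\<open>B\<close> is what remains of the composite after removing the identity
    and the inherited term \<open>h * C k\<close>. Multiplying by \<open>C k\<close> reproduces the
    homotopy of level \<open>k\<close>, whose \<open>g\<close> dies against \<open>C k\<close>, so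
    the columns of \<open>B\<close> are cycles and exactness provides the new
    \<open>h'\<close>.\<close>
  define B where "B = \<psi>' * \<phi>' - (1\<^sub>m ?m + h * C k)"
  have ghC: "graded_mat (b (Suc k)) (b (Suc k)) (h * C k)" by (rule graded_mat_mult[OF h gr])
  have gB: "graded_mat (b (Suc k)) (b (Suc k)) B"
    unfolding B_def by (intro graded_minus graded_add graded_mat_mult[OF psi'(1) phi'(1)] graded_one ghC)
  note cC = graded_matD[OF gr[of k]] and cC' = graded_matD[OF gr'[of k]] and ch = graded_matD[OF h] and cg = graded_matD[OF g]
  note cphi = graded_matD[OF phi(1)] and cpsi = graded_matD[OF psi(1)]
  note cphi' = graded_matD[OF phi'(1)] and cpsi' = graded_matD[OF psi'(1)] and chC = graded_matD[OF ghC]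
  have "C k * (\<psi>' * \<phi>') = \<psi> * (\<phi> * C k)"
    using assoc_mult_mat[OF cC cpsi' cphi'] assoc_mult_mat[OF cpsi cC' cphi'] psi'(2) phi'(2) by simp
  also have "\<dots> = (1\<^sub>m ?n + C k * h + g) * C k"
    using assoc_mult_mat[OF cpsi cphi cC] hom by simp
  also have "\<dots> = (1\<^sub>m ?n + C k * h) * C k + g * C k"
    using cC ch cg by (intro add_mult_distrib_mat[of _ ?n ?n]) auto
  also have "\<dots> = C k + C k * h * C k"
    using cC ch gC add_mult_distrib_mat[of "1\<^sub>m ?n" ?n ?n "C k * h" "C k" ?m] by auto
  finally have 1: "C k * (\<psi>' * \<phi>') = C k + C k * h * C k" .
  have 2: "C k * (1\<^sub>m ?m + h * C k) = C k + C k * h * C k"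
    using mult_add_distrib_mat[OF cC one_carrier_mat chC] assoc_mult_mat[OF cC ch cC] cC by simp
  have CB: "C k * B = 0\<^sub>m ?n ?m"
  proof -
    have "C k * B = C k * (\<psi>' * \<phi>') - C k * (1\<^sub>m ?m + h * C k)"
      unfolding B_def using cC cpsi' cphi' chC by (intro mult_minus_distrib_mat[of _ ?n ?m]) auto
    then show ?thesis unfolding 1 2 using cC ch by (simp add: minus_r_inv_mat)
  qed
  obtain h' where h': "graded_mat (b (Suc (Suc k))) (b (Suc k)) h'" "C (Suc k) * h' = B"
  proof (rule graded_lift[OF gr gB])
    fix j assume j: "j < ?m"
    have s: "Poly_Mapping.keys (b (Suc k) ! j) \<subseteq> X" using R nth_mem[OF j] by (simp add: scalar_resolution_def)
    have "C k *\<^sub>v col B j = col (C k * B) j" using col_mult2[OF cC graded_matD[OF gB] j] by simp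
    also have "\<dots> = 0\<^sub>v ?n" using CB j by simp
    finally have "col B j \<in> {v \<in> strand (b (Suc k)) (b (Suc k) ! j). C k *\<^sub>v v = 0\<^sub>v ?n}"
      using graded_col_strand[OF gB j] by simp
    then show "col B j \<in> (\<lambda>w. C (Suc k) *\<^sub>v w) ` strand (b (Suc (Suc k))) (b (Suc k) ! j)"
      unfolding scalar_resolution_kernel[OF R s] .
  qed
  have min: "C (Suc k) $$ (i, j) \<noteq> 0 \<Longrightarrow> b (Suc k) ! i \<noteq> b (Suc (Suc k)) ! j"
    if "i < length (b (Suc k))" "j < length (b (Suc (Suc k)))" for i j
    using M that by (simp add: scalar_minimal_def)
  have "\<psi>' * \<phi>' = 1\<^sub>m ?m + C (Suc k) * h' + h * C k"
    unfolding h'(2) B_def using cpsi' cphi' chC by (intro eq_matI) auto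
  moreover have "h * C k * C (Suc k) = 0\<^sub>m ?m (length (b (Suc (Suc k))))"
    using assoc_mult_mat[OF ch cC graded_matD[OF gr[of "Suc k"]]] scalar_resolution_comp[OF R] ch by auto
  moreover have "(C (Suc k) * h') $$ (j, j) = 0" if "j < ?m" for j
    by (rule graded_mult_diag[OF gr h'(1) that]) (use min in blast)
  moreover have "(h' * C (Suc k)) $$ (j, j) = 0" if "j < length (b (Suc (Suc k)))" for j
    by (rule graded_mult_diag[OF h'(1) gr that]) (use min in blast)
  ultimately show ?case
    by (intro exI[of _ \<phi>'] exI[of _ \<psi>'] exI[of _ h'] exI[of _ "h * C k"])
      (simp add: phi'(1,3) psi'(1,3) h'(1) ghC diag)
qed

text \<open>The diagonal entry of \<open>\<psi> * \<phi>\<close> at \<open>j\<close> is 1, so some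
  product of an entry of \<open>\<psi>\<close> with one of \<open>\<phi>\<close> is nonzero.
  Gradedness then makes the degree at \<open>j\<close> and a degree of the other complex divide each
  other.\<close>

lemma minimal_shifts_subset:
  fixes C C' :: "nat \<Rightarrow> 'k::field mat" and b b' :: "nat \<Rightarrow> ('x \<Rightarrow>\<^sub>0 nat) list"
  assumes "scalar_resolution X b C" "scalar_resolution X b' C'" "scalar_minimal b C" "b 0 = b' 0"
    and "\<And>s. Poly_Mapping.keys s \<subseteq> X \<Longrightarrow>
      (\<lambda>w. C 0 *\<^sub>v w) ` strand (b (Suc 0)) s = (\<lambda>w. C' 0 *\<^sub>v w) ` strand (b' (Suc 0)) s"
  shows "set (b k) \<subseteq> set (b' k)"
proof
  fix s assume "s \<in> set (b k)"
  then obtain j where j: "j < length (b k)" "s = b k ! j" by (metis in_set_conv_nth)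
  obtain \<phi> \<psi> h g where phi: "graded_mat (b' k) (b k) \<phi>" and psi: "graded_mat (b k) (b' k) \<psi>"
    and h: "graded_mat (b (Suc k)) (b k) h" and g: "graded_mat (b k) (b k) g"
    and hom: "\<psi> * \<phi> = 1\<^sub>m (length (b k)) + C k * h + g"
    and diag: "(C k * h) $$ (j, j) = 0" "g $$ (j, j) = 0"
    using comparison_homotopy[OF assms, of k] j(1) by blast
  have "(\<psi> * \<phi>) $$ (j, j) = 1"
    unfolding hom using diag j(1) graded_matD[OF g] graded_matD[OF h]
      graded_matD[OF scalar_resolution_graded[OF assms(1), of k]] by auto
  then have "(\<Sum>i<length (b' k). \<psi> $$ (j, i) * \<phi> $$ (i, j)) \<noteq> 0"
    by (simp add: mult_mat_index[OF graded_matD[OF psi] graded_matD[OF phi] j(1) j(1)])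
  then obtain i where i: "i < length (b' k)" "\<psi> $$ (j, i) * \<phi> $$ (i, j) \<noteq> 0"
    by (meson lessThan_iff sum.neutral)
  then have "b k ! j \<preceq> b' k ! i" "b' k ! i \<preceq> b k ! j" using phi psi j by (auto simp: graded_mat_def)
  then have "b k ! j = b' k ! i" by (rule mle_antisym)
  then show "s \<in> set (b' k)" using i(1) j(2) by simp
qed

section \<open>Translation between polynomial resolutions and scalar complexes\<close>

lemma target_shifts_Suc_eq: "b 0 = [0] \<Longrightarrow> target_shifts (\<lambda>k. b (Suc k)) k = b k"
  by (cases k) simp_all

lemma scalar_resolution_of_free_resolution:
  fixes d :: "nat \<Rightarrow> ('x, 'k::field) mpoly mat"
  assumes F: "multigraded_free_resolution X I a d"
  defines "C \<equiv> \<lambda>k. scalar_mat (target_shifts a k) (a k) (d k)"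
  shows "scalar_resolution X (target_shifts a) C"
    and "\<And>s. Poly_Mapping.keys s \<subseteq> X \<Longrightarrow> (\<lambda>w. C 0 *\<^sub>v w) ` strand (a 0) s
      = {u \<in> carrier_vec 1. Poly_Mapping.single s (u $ 0) \<in> I}"
proof -
  let ?b = "target_shifts a"
  have M: "multigraded_maps X a d"
    and im: "(\<lambda>v. (d 0 *\<^sub>v v) $ 0) ` free_module X (length (a 0)) = I"
    and ker: "\<And>k. {v \<in> free_module X (length (a k)). d k *\<^sub>v v = 0\<^sub>v (length (?b k))}
          = (\<lambda>v. d (Suc k) *\<^sub>v v) ` free_module X (length (a (Suc k)))"
    using F by (simp_all add: multigraded_free_resolution_def)
  have keys: "Poly_Mapping.keys s \<subseteq> X" if "s \<in> set (?b k)" for s k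
    using that M by (cases k) (simp_all add: multigraded_maps_def)
  have d: "d k \<in> carrier_mat (length (?b k)) (length (a k))" for k
    using M by (simp add: multigraded_maps_def)
  have deg: "m + ?b k ! i = a k ! j"
    if "i < length (?b k)" "j < length (a k)" "m \<in> Poly_Mapping.keys (d k $$ (i, j))" for i j k m
    using M that by (simp add: multigraded_maps_def)
  have g: "graded_mat (?b k) (a k) (C k)" and p: "poly_mat (?b k) (a k) (C k) = d k" for k
    unfolding C_def by (rule graded_scalar_mat[OF d deg], assumption+)+
  have "strand_exact X (?b k) (?b (Suc k)) (?b (Suc (Suc k))) (C k) (C (Suc k))" for k
  proof -
    have "strand_exact X (?b k) (a k) (a (Suc k)) (C k) (C (Suc k))"
    proof (rule iffD1[OF poly_mat_exact_iff])
      show "graded_mat (a k) (a (Suc k)) (C (Suc k))" using g[of "Suc k"] by simp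
      show "{v \<in> free_module X (length (a k)). poly_mat (?b k) (a k) (C k) *\<^sub>v v = 0\<^sub>v (length (?b k))}
        = (\<lambda>w. poly_mat (a k) (a (Suc k)) (C (Suc k)) *\<^sub>v w) ` free_module X (length (a (Suc k)))"
        using ker[of k] p[of k] p[of "Suc k"] by simp
    qed (use g keys[of _ k] keys[of _ "Suc k"] keys[of _ "Suc (Suc k)"] in simp_all)
    then show ?thesis by simp
  qed
  then show "scalar_resolution X ?b C"
    unfolding scalar_resolution_def using keys g by simp
  fix s :: "'x \<Rightarrow>\<^sub>0 nat" assume s: "Poly_Mapping.keys s \<subseteq> X"
  show "(\<lambda>w. C 0 *\<^sub>v w) ` strand (a 0) s = {u \<in> carrier_vec 1. Poly_Mapping.single s (u $ 0) \<in> I}"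
    by (rule poly_mat_augmentation[OF _ s]) (use g[of 0] p[of 0] im in simp_all)
qed

lemma scalar_minimal_of_minimal_free_resolution:
  fixes d :: "nat \<Rightarrow> ('x, 'k::field) mpoly mat"
  assumes F: "minimal_multigraded_free_resolution X I a d"
  shows "scalar_minimal (target_shifts a) (\<lambda>k. scalar_mat (target_shifts a k) (a k) (d k))"
  unfolding scalar_minimal_def
proof (intro allI impI notI)
  fix k i j
  assume i: "i < length (target_shifts a (Suc k))" and j: "j < length (target_shifts a (Suc (Suc k)))"
    and nz: "scalar_mat (target_shifts a (Suc k)) (a (Suc k)) (d (Suc k)) $$ (i, j) \<noteq> 0"
    and eq: "target_shifts a (Suc k) ! i = target_shifts a (Suc (Suc k)) ! j"
  have "Poly_Mapping.lookup (d (Suc k) $$ (i, j)) 0 = 0"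
    using F i j by (simp add: minimal_multigraded_free_resolution_def)
  then show False using nz i j eq by (simp add: scalar_mat_def)
qed

lemma free_resolution_of_scalar_resolution:
  fixes C :: "nat \<Rightarrow> 'k::field mat"
  assumes R: "scalar_resolution X b C" and b0: "b 0 = [0]" and fin: "\<And>k. r < k \<Longrightarrow> b (Suc k) = []"
    and im: "(\<lambda>v. (poly_mat [0] (b 1) (C 0) *\<^sub>v v) $ 0) ` free_module X (length (b 1)) = I"
  shows "multigraded_free_resolution X I (\<lambda>k. b (Suc k)) (\<lambda>k. poly_mat (b k) (b (Suc k)) (C k))"
proof -
  note g = scalar_resolution_graded[OF R] and t = target_shifts_Suc_eq[of b, OF b0]
  have keys: "Poly_Mapping.keys s \<subseteq> X" if "s \<in> set (b k)" for s k
    using R that by (simp add: scalar_resolution_def)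
  have "multigraded_maps X (\<lambda>k. b (Suc k)) (\<lambda>k. poly_mat (b k) (b (Suc k)) (C k))"
    unfolding multigraded_maps_def t
  proof (intro conjI allI impI ballI)
    fix k i j assume ij: "i < length (b k)" "j < length (b (Suc k))"
    have "Poly_Mapping.keys (b (Suc k) ! j - b k ! i) \<subseteq> X"
      using keys_minus_nat[of "b (Suc k) ! j" "b k ! i"] keys[OF nth_mem[OF ij(2)]] by (rule subset_trans)
    then show "poly_mat (b k) (b (Suc k)) (C k) $$ (i, j) \<in> carrier (mpoly_ring X)"
      using ij by (simp add: poly_mat_def single_in_carrier)
    fix m assume m: "m \<in> Poly_Mapping.keys (poly_mat (b k) (b (Suc k)) (C k) $$ (i, j))"
    then have "m = b (Suc k) ! j - b k ! i" "C k $$ (i, j) \<noteq> 0"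
      using ij by (auto simp: poly_mat_def split: if_splits)
    moreover from this have "b k ! i \<preceq> b (Suc k) ! j" using g[of k] ij by (simp add: graded_mat_def)
    ultimately show "m + b k ! i = b (Suc k) ! j" by (simp add: mle_diff_add)
  qed (use keys in simp_all)
  moreover have "{v \<in> free_module X (length (b (Suc k))). poly_mat (b k) (b (Suc k)) (C k) *\<^sub>v v = 0\<^sub>v (length (b k))}
      = (\<lambda>w. poly_mat (b (Suc k)) (b (Suc (Suc k))) (C (Suc k)) *\<^sub>v w) ` free_module X (length (b (Suc (Suc k))))" for k
    by (rule iffD2[OF poly_mat_exact_iff[OF g g keys keys keys]]) (use R in \<open>simp_all add: scalar_resolution_def\<close>)
  moreover have "\<exists>r. \<forall>k>r. b (Suc k) = []" using fin by blast
  ultimately show ?thesis unfolding multigraded_free_resolution_def t using im b0 by simp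
qed

text \<open>The complex, turned into polynomial matrices, is one of the minimal resolutions over
  which \<open>multigraded_shifts\<close> ranges. The degrees of any other one occur in it by
  \<open>minimal_shifts_subset\<close>, since by \<open>poly_mat_augmentation\<close> both
  augmentations have the same image in each degree.\<close>

lemma multigraded_shifts_scalar_resolution:
  fixes C :: "nat \<Rightarrow> 'k::field mat" and b :: "nat \<Rightarrow> ('x \<Rightarrow>\<^sub>0 nat) list"
  assumes R: "scalar_resolution X b C" and M: "scalar_minimal b C" and b0: "b 0 = [0]"
    and fin: "\<And>k. r < k \<Longrightarrow> b (Suc k) = []"
    and im: "(\<lambda>v. (poly_mat [0] (b 1) (C 0) *\<^sub>v v) $ 0) ` free_module X (length (b 1)) = I"
  shows "multigraded_shifts X k I = set (b (Suc k))"
proof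
  note g = scalar_resolution_graded[OF R]
  have "Poly_Mapping.lookup (poly_mat (b (Suc k)) (b (Suc (Suc k))) (C (Suc k)) $$ (i, j)) 0 = 0"
    if ij: "i < length (b (Suc k))" "j < length (b (Suc (Suc k)))" for i j k
  proof (cases "C (Suc k) $$ (i, j) = 0")
    case False
    then have "b (Suc k) ! i \<preceq> b (Suc (Suc k)) ! j" "b (Suc k) ! i \<noteq> b (Suc (Suc k)) ! j"
      using g[of "Suc k"] M ij by (simp_all add: graded_mat_def scalar_minimal_def)
    then have "b (Suc (Suc k)) ! j - b (Suc k) ! i \<noteq> 0"
      using mle_diff_add[of "b (Suc k) ! i" "b (Suc (Suc k)) ! j"] by auto
    then show ?thesis using ij by (simp add: poly_mat_def lookup_single)
  qed (use ij in \<open>simp add: poly_mat_def\<close>)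
  then have "minimal_multigraded_free_resolution X I (\<lambda>k. b (Suc k)) (\<lambda>k. poly_mat (b k) (b (Suc k)) (C k))"
    using free_resolution_of_scalar_resolution[OF R b0 fin im]
    by (simp add: minimal_multigraded_free_resolution_def)
  then show "set (b (Suc k)) \<subseteq> multigraded_shifts X k I"
    unfolding multigraded_shifts_def by blast
  show "multigraded_shifts X k I \<subseteq> set (b (Suc k))"
  proof
    fix s assume "s \<in> multigraded_shifts X k I"
    then obtain a and d :: "nat \<Rightarrow> ('x, 'k) mpoly mat"
      where min: "minimal_multigraded_free_resolution X I a d" and s: "s \<in> set (a k)"
      unfolding multigraded_shifts_def by blast
    then have res: "multigraded_free_resolution X I a d" by (simp add: minimal_multigraded_free_resolution_def)
    have "set (target_shifts a (Suc k)) \<subseteq> set (b (Suc k))"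
    proof (rule minimal_shifts_subset[OF scalar_resolution_of_free_resolution(1)[OF res] R
          scalar_minimal_of_minimal_free_resolution[OF min]])
      fix s :: "'x \<Rightarrow>\<^sub>0 nat" assume s: "Poly_Mapping.keys s \<subseteq> X"
      have "graded_mat [0] (b 1) (C 0)" using g[of 0] b0 by simp
      from poly_mat_augmentation[OF this s im]
      show "(\<lambda>w. scalar_mat (target_shifts a 0) (a 0) (d 0) *\<^sub>v w) ` strand (target_shifts a (Suc 0)) s
        = (\<lambda>w. C 0 *\<^sub>v w) ` strand (b (Suc 0)) s"
        using scalar_resolution_of_free_resolution(2)[OF res s] by simp
    qed (simp add: b0)
    then show "s \<in> set (b (Suc k))" using s by auto
  qed
qed

lemma image_augmentation_ones:
  fixes a :: "('x \<Rightarrow>\<^sub>0 nat) list"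
  assumes a: "\<And>s. s \<in> set a \<Longrightarrow> Poly_Mapping.keys s \<subseteq> X"
  defines "C \<equiv> mat 1 (length a) (\<lambda>_. 1 :: 'k::field)"
  shows "(\<lambda>v. (poly_mat [0] a C *\<^sub>v v) $ 0) ` free_module X (length a)
    = Idl\<^bsub>mpoly_ring X\<^esub> (mon ` set a :: ('x, 'k) mpoly set)" (is "?f ` _ = ?I")
proof (intro subset_antisym subsetI)
  have f: "?f v = (\<Sum>j<length a. mon (a ! j) * v $ j)" if "v \<in> carrier_vec (length a)" for v
    using mult_mat_vec_index[OF poly_mat_carrier that, of 0 "[0]" C]
    by (simp add: poly_mat_def C_def mon_def del: index_mult_mat_vec)
  interpret cring "mpoly_ring X :: ('x, 'k) mpoly ring" by (rule cring_mpoly_ring)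
  have sub: "mon ` set a \<subseteq> carrier (mpoly_ring X :: ('x, 'k) mpoly ring)" using mon_in_carrier[OF a] by auto
  note idl = genideal_ideal[OF sub]
  {
    fix p :: "('x, 'k) mpoly" assume "p \<in> ?f ` free_module X (length a)"
    then obtain v where v: "v \<in> free_module X (length a)" "p = ?f v" by blast
    have "mon (a ! j) * v $ j \<in> ?I" if "j \<in> {..<length a}" for j
    proof -
      have "(mon (a ! j) :: ('x, 'k) mpoly) \<in> ?I" using genideal_self[OF sub] that by auto
      moreover have "v $ j \<in> carrier (mpoly_ring X)" using v that by (simp add: free_module_def)
      ultimately show ?thesis using ideal.I_r_closed[OF idl] by fastforce
    qed
    then have "(\<Sum>j<length a. mon (a ! j) * v $ j) \<in> ?I" by (rule ideal_sum_mem[OF idl]) simp_all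
    then show "p \<in> ?I" using v f by (simp add: free_module_def)
  next
    fix p :: "('x, 'k) mpoly" assume "p \<in> ?I"
    then have p: "p \<in> carrier (mpoly_ring X)" "\<forall>m\<in>Poly_Mapping.keys p. \<exists>s\<in>set a. s \<preceq> m"
      using a by (simp_all add: genideal_mon)
    \<comment> \<open>Each term of \<open>p\<close> is assigned to a single generator dividing it;
      the quotients, grouped by generator, form the preimage \<open>v\<close>.\<close>
    have "\<forall>m\<in>Poly_Mapping.keys p. \<exists>j. j < length a \<and> a ! j \<preceq> m"
      using p(2) by (metis in_set_conv_nth)
    from bchoice[OF this] obtain j where
      j: "\<And>m. m \<in> Poly_Mapping.keys p \<Longrightarrow> j m < length a" "\<And>m. m \<in> Poly_Mapping.keys p \<Longrightarrow> a ! j m \<preceq> m"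
      by auto
    define v where "v = vec (length a) (\<lambda>i. \<Sum>m\<in>{m \<in> Poly_Mapping.keys p. j m = i}.
      Poly_Mapping.single (m - a ! i) (Poly_Mapping.lookup p m))"
    have "v \<in> free_module X (length a)"
    proof -
      have "Poly_Mapping.keys (m - s) \<subseteq> X" if "m \<in> Poly_Mapping.keys p" for m s
        using p(1) that keys_minus_nat[of m s] by (auto simp: carrier_mpoly_ring)
      then show ?thesis by (auto simp: free_module_def v_def intro!: carrier_sum single_in_carrier)
    qed
    moreover have "?f v = p"
    proof -
      have "?f v = (\<Sum>i<length a. \<Sum>m\<in>{m \<in> Poly_Mapping.keys p. j m = i}. Poly_Mapping.single m (Poly_Mapping.lookup p m))"
        unfolding f[of v, unfolded v_def, OF vec_carrier, folded v_def]
      proof (rule sum.cong[OF refl])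
        fix i assume i: "i \<in> {..<length a}"
        have "mon (a ! i) * Poly_Mapping.single (m - a ! i) (Poly_Mapping.lookup p m)
          = Poly_Mapping.single m (Poly_Mapping.lookup p m)" if "m \<in> Poly_Mapping.keys p" "j m = i" for m
          using mle_diff_add[OF j(2)[OF that(1)]] that(2) by (simp add: mon_def mult_single add.commute)
        then show "mon (a ! i) * v $ i = (\<Sum>m\<in>{m \<in> Poly_Mapping.keys p. j m = i}. Poly_Mapping.single m (Poly_Mapping.lookup p m))"
          using i by (simp add: v_def sum_distrib_left)
      qed
      also have "\<dots> = (\<Sum>m\<in>Poly_Mapping.keys p. Poly_Mapping.single m (Poly_Mapping.lookup p m))"
        by (rule sum.group) (use j(1) in auto)
      finally show ?thesis by (simp add: sum_single_keys)
    qed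
    ultimately show "p \<in> ?f ` free_module X (length a)" by blast
  }
qed

subsection \<open>The cubical complex of a simplicial complex\<close>

text \<open>The pairs are split by the order of their positions and the swap matches the two halves
  with opposite signs. With the diagonal left out this is valid also in characteristic 2.\<close>

lemma sum_antisymmetric:
  fixes f :: "'a \<Rightarrow> 'a \<Rightarrow> 'k::ab_group_add" and p :: "'a \<Rightarrow> nat"
  assumes fin: "finite A" and inj: "inj_on p A"
    and anti: "\<And>s t. s \<in> A \<Longrightarrow> t \<in> A \<Longrightarrow> p s < p t \<Longrightarrow> f t s = - f s t"
  shows "(\<Sum>s\<in>A. \<Sum>t\<in>A - {s}. f s t) = 0"
proof -
  define L where "L = (SIGMA s:A. {t \<in> A. p s < p t})"
  define G where "G = (SIGMA s:A. {t \<in> A. p t < p s})"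
  have "(\<Sum>s\<in>A. \<Sum>t\<in>A - {s}. f s t) = (\<Sum>(s, t)\<in>(SIGMA s:A. A - {s}). f s t)"
    using fin by (subst sum.Sigma) auto
  also have "(SIGMA s:A. A - {s}) = L \<union> G"
    using inj by (auto simp: L_def G_def inj_on_def neq_iff) (meson linorder_neqE_nat)
  also have "(\<Sum>(s, t)\<in>L \<union> G. f s t) = (\<Sum>(s, t)\<in>L. f s t) + (\<Sum>(s, t)\<in>G. f s t)"
    using fin by (intro sum.union_disjoint) (auto simp: L_def G_def)
  also have "(\<Sum>(s, t)\<in>G. f s t) = (\<Sum>(s, t)\<in>L. f t s)"
    by (rule sum.reindex_bij_witness[of _ prod.swap prod.swap]) (auto simp: L_def G_def)
  also have "\<dots> = (\<Sum>(s, t)\<in>L. - f s t)" using anti by (intro sum.cong) (auto simp: L_def)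
  also have "(\<Sum>(s, t)\<in>L. f s t) + \<dots> = 0" by (simp add: case_prod_beta sum_negf)
  finally show ?thesis .
qed

text \<open>The pair \<open>(T, F)\<close> of disjoint sets encodes the cube \<open>{S. T \<subseteq> S \<subseteq> T \<union> F}\<close> of dimension \<open>card F\<close>. A chain
  is given by its coefficients \<open>v T F\<close>. In its boundary, the cube \<open>(T, F)\<close> is a face of the cubes \<open>(T - {s}, insert s F)\<close>: the
  top face if \<open>s \<in> T\<close> and the bottom face otherwise.\<close>

definition cube_sign :: "('a \<Rightarrow> nat) \<Rightarrow> 'a \<Rightarrow> 'a set \<Rightarrow> 'k::field" where
  "cube_sign p s F = (- 1) ^ card {u \<in> F. p u < p s}"

definition face_sign :: "'a \<Rightarrow> 'a set \<Rightarrow> 'k::field" where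
  "face_sign s T = (if s \<in> T then 1 else - 1)"

definition cube_bd :: "'a set \<Rightarrow> ('a \<Rightarrow> nat) \<Rightarrow> ('a set \<Rightarrow> 'a set \<Rightarrow> 'k::field) \<Rightarrow> 'a set \<Rightarrow> 'a set \<Rightarrow> 'k" where
  "cube_bd V p v T F = (\<Sum>s\<in>V - F. cube_sign p s F * face_sign s T * v (T - {s}) (insert s F))"

definition cube_aug :: "'a set \<Rightarrow> ('a set \<Rightarrow> 'a set \<Rightarrow> 'k::field) \<Rightarrow> 'k" where
  "cube_aug V v = (\<Sum>T\<in>Pow V. v T {})"

text \<open>\<open>R\<close> and \<open>U\<close> are the bounds that a multidegree puts on cubes:
  the support consists of cubes in the face poset of the link of \<open>R\<close>, restricted to
  \<open>U\<close>, with \<open>R\<close> joined to every face.\<close>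

definition cube_chain ::
    "'a set set \<Rightarrow> 'a set \<Rightarrow> 'a set \<Rightarrow> nat \<Rightarrow> ('a set \<Rightarrow> 'a set \<Rightarrow> 'k::field) \<Rightarrow> bool" where
  "cube_chain \<Delta> R U k v \<longleftrightarrow> (\<forall>T F. v T F \<noteq> 0 \<longrightarrow>
     R \<subseteq> T \<and> T \<union> F \<subseteq> U \<and> T \<inter> F = {} \<and> T \<union> F \<in> \<Delta> \<and> card F = k)"

lemma cube_chainD:
  "cube_chain \<Delta> R U k v \<Longrightarrow> v T F \<noteq> 0 \<Longrightarrow>
    R \<subseteq> T \<and> T \<union> F \<subseteq> U \<and> T \<inter> F = {} \<and> T \<union> F \<in> \<Delta> \<and> card F = k"
  by (simp add: cube_chain_def)

lemma cube_sign_square: "cube_sign p s F * cube_sign p s F = (1 :: 'k::field)"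
  by (simp add: cube_sign_def flip: power_add mult_2)

lemma cube_sign_insert:
  assumes "finite F" "t \<notin> F"
  shows "cube_sign p s (insert t F) = (if p t < p s then - cube_sign p s F else cube_sign p s F :: 'k::field)"
proof -
  have "{u \<in> insert t F. p u < p s} = (if p t < p s then insert t {u \<in> F. p u < p s} else {u \<in> F. p u < p s})"
    by auto
  then show ?thesis using assms by (simp add: cube_sign_def)
qed

text \<open>Two directions can be inserted in either order. Inserting the earlier one first flips
  the sign of the later one, but not conversely, so the two contributions cancel.\<close>

lemma cube_bd_bd:
  assumes V: "finite V" and inj: "inj_on p V" and F: "finite F"
  shows "cube_bd V p (cube_bd V p v) T F = (0 :: 'k::field)"
proof -
  define f where "f s t = cube_sign p s F * face_sign s T *
    (cube_sign p t (insert s F) * face_sign t (T - {s}) * v (T - {s} - {t}) (insert t (insert s F)))" for s t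
  have "cube_bd V p (cube_bd V p v) T F = (\<Sum>s\<in>V - F. \<Sum>t\<in>V - F - {s}. f s t)"
  proof -
    have "V - insert s F = V - F - {s}" for s by auto
    then show ?thesis unfolding cube_bd_def f_def by (simp only: sum_distrib_left)
  qed
  also have "\<dots> = 0"
  proof (rule sum_antisymmetric[of _ p])
    fix s t assume s: "s \<in> V - F" and t: "t \<in> V - F" and lt: "p s < p t"
    then have ne: "s \<noteq> t" by auto
    have "T - {t} - {s} = T - {s} - {t}" "insert s (insert t F) = insert t (insert s F)" by auto
    moreover have "face_sign t (T - {s}) = (face_sign t T :: 'k)" "face_sign s (T - {t}) = (face_sign s T :: 'k)"
      using ne by (auto simp: face_sign_def)
    moreover have "cube_sign p t (insert s F) = (- cube_sign p t F :: 'k)"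
      "cube_sign p s (insert t F) = (cube_sign p s F :: 'k)"
      using lt s t F by (simp_all add: cube_sign_insert)
    ultimately show "f t s = - f s t" unfolding f_def by (simp add: mult_ac)
  qed (use V inj in \<open>auto simp: inj_on_def\<close>)
  finally show ?thesis .
qed

text \<open>Every edge in direction \<open>s\<close> contributes to its two endpoints with opposite
  signs; for each \<open>s\<close> the sum over \<open>T\<close> is split into the endpoints without
  and with \<open>s\<close>.\<close>

lemma cube_aug_bd:
  assumes V: "finite V"
  shows "cube_aug V (cube_bd V p v) = (0 :: 'k::field)"
proof -
  have "cube_aug V (cube_bd V p v) = (\<Sum>T\<in>Pow V. \<Sum>s\<in>V. face_sign s T * v (T - {s}) {s})"
    by (simp add: cube_aug_def cube_bd_def cube_sign_def)
  also have "\<dots> = (\<Sum>s\<in>V. \<Sum>T\<in>Pow V. face_sign s T * v (T - {s}) {s})" by (rule sum.swap)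
  also have "\<dots> = 0"
  proof (rule sum.neutral, rule ballI)
    fix s assume s: "s \<in> V"
    let ?A = "Pow (V - {s})"
    have Pow: "Pow V = ?A \<union> insert s ` ?A" using s by (metis Pow_insert insert_Diff)
    have "(\<Sum>T\<in>Pow V. face_sign s T * v (T - {s}) {s})
      = (\<Sum>T\<in>?A. face_sign s T * v (T - {s}) {s}) + (\<Sum>T\<in>insert s ` ?A. face_sign s T * v (T - {s}) {s})"
      unfolding Pow using V by (intro sum.union_disjoint) auto
    also have "(\<Sum>T\<in>insert s ` ?A. face_sign s T * v (T - {s}) {s}) = (\<Sum>T\<in>?A. v T {s})"
    proof (subst sum.reindex)
      show "inj_on (insert s) ?A" by (auto simp: inj_on_def insert_ident)
      show "(\<Sum>T\<in>?A. ((\<lambda>T. face_sign s T * v (T - {s}) {s}) \<circ> insert s) T) = (\<Sum>T\<in>?A. v T {s})"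
        by (intro sum.cong) (auto simp: face_sign_def intro!: arg_cong2[of _ _ _ _ v])
    qed
    also have "(\<Sum>T\<in>?A. face_sign s T * v (T - {s}) {s}) = (\<Sum>T\<in>?A. - v T {s})"
      by (intro sum.cong) (auto simp: face_sign_def intro!: arg_cong2[of _ _ _ _ v])
    also have "\<dots> + (\<Sum>T\<in>?A. v T {s}) = 0" by (simp add: sum_negf)
    finally show "(\<Sum>T\<in>Pow V. face_sign s T * v (T - {s}) {s}) = 0" .
  qed
  finally show ?thesis .
qed

lemma cube_bd_add: "cube_bd V p (\<lambda>T F. v T F + w T F) T F = cube_bd V p v T F + cube_bd V p w T F"
  by (simp add: cube_bd_def algebra_simps sum.distrib)

lemma cube_bd_diff: "cube_bd V p (\<lambda>T F. v T F - w T F) T F = cube_bd V p v T F - cube_bd V p w T F"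
  by (simp add: cube_bd_def algebra_simps sum_subtractf)

lemma cube_chain_bd:
  assumes down: "\<And>S S'. S \<in> \<Delta> \<Longrightarrow> S' \<subseteq> S \<Longrightarrow> S' \<in> \<Delta>" and U: "finite U"
    and v: "cube_chain \<Delta> R U (Suc k) v"
  shows "cube_chain \<Delta> R U k (cube_bd V p v)"
  unfolding cube_chain_def
proof (intro allI impI)
  fix T F assume "cube_bd V p v T F \<noteq> 0"
  then obtain s where s: "s \<in> V - F" "v (T - {s}) (insert s F) \<noteq> 0"
    unfolding cube_bd_def by (metis (no_types, lifting) mult_zero_right sum.neutral)
  then have *: "R \<subseteq> T - {s}" "T - {s} \<union> insert s F \<subseteq> U" "(T - {s}) \<inter> insert s F = {}"
    "T - {s} \<union> insert s F \<in> \<Delta>" "card (insert s F) = Suc k"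
    using cube_chainD[OF v s(2)] by simp_all
  have "finite F" using *(2) U by (meson finite_subset finite_insert sup.boundedE)
  then have "card F = k" using *(5) s(1) by simp
  moreover have "T \<union> F \<in> \<Delta>" by (rule down[OF *(4)]) auto
  ultimately show "R \<subseteq> T \<and> T \<union> F \<subseteq> U \<and> T \<inter> F = {} \<and> T \<union> F \<in> \<Delta> \<and> card F = k"
    using * s by blast
qed

text \<open>A vertex \<open>x\<close> of \<open>U\<close> outside \<open>R\<close> is removed by pairing the cubes \<open>(T, F)\<close> with \<open>x \<in> T\<close> with the cubes
  \<open>(T - {x}, insert x F)\<close>.\<close>

lemma cube_exact:
  fixes v :: "'a set \<Rightarrow> 'a set \<Rightarrow> 'k::field"
  assumes V: "finite V" and inj: "inj_on p V" and UV: "U \<subseteq> V"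
    and down: "\<And>S S'. S \<in> \<Delta> \<Longrightarrow> S' \<subseteq> S \<Longrightarrow> S' \<in> \<Delta>"
    and v: "cube_chain \<Delta> R U k v"
    and aug: "k = 0 \<Longrightarrow> cube_aug V v = 0" and bd: "\<And>T F. 0 < k \<Longrightarrow> cube_bd V p v T F = 0"
  shows "\<exists>w. cube_chain \<Delta> R U (Suc k) w \<and> (\<forall>T F. v T F = cube_bd V p w T F)"
  using UV v aug bd
proof (induction "card (U - R)" arbitrary: U v)
  case 0
  have finU: "finite U" using "0.prems"(1) V by (rule finite_subset)
  then have UR: "U \<subseteq> R" using "0.hyps" by auto
  \<comment> \<open>With \<open>U\<close> inside \<open>R\<close> the only possible cube is the
    vertex \<open>R\<close>, in dimension 0, and the augmentation kills its coefficient.\<close>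
  have eq: "T = R \<and> F = {} \<and> k = 0 \<and> R \<subseteq> U" if "v T F \<noteq> 0" for T F
  proof -
    have "R \<subseteq> T" "T \<union> F \<subseteq> U" "T \<inter> F = {}" "card F = k"
      using cube_chainD[OF "0.prems"(2) that] by simp_all
    moreover from this have "F = {}" using UR by blast
    ultimately show ?thesis using UR by auto
  qed
  have "v T F = 0" for T F
  proof (rule ccontr)
    assume nz: "v T F \<noteq> 0"
    note e = eq[OF nz]
    have "cube_aug V v = (\<Sum>T\<in>Pow V. if T = R then v R {} else 0)"
      unfolding cube_aug_def using eq by (intro sum.cong) auto
    also have "\<dots> = v R {}" using e "0.prems"(1) V by (subst sum.delta) auto
    finally show False using "0.prems"(3) e nz by auto
  qed
  then show ?case by (intro exI[of _ "\<lambda>T F. 0"]) (simp add: cube_chain_def cube_bd_def)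
next
  case (Suc n)
  have finU: "finite U" using Suc.prems(1) V by (rule finite_subset)
  have "U - R \<noteq> {}" using Suc.hyps(2) by (metis card.empty nat.distinct(1))
  then obtain x where x: "x \<in> U" "x \<notin> R" by blast
  have xV: "x \<in> V" using x Suc.prems(1) by blast
  \<comment> \<open>A cube with direction \<open>x\<close> gets the value of \<open>v\<close> on its
    face with \<open>x\<close> added to \<open>T\<close>, with the sign that makes the boundary of
    \<open>w\<close> equal to \<open>v\<close> on all cubes with \<open>x\<close> in
    \<open>T\<close>.\<close>
  define w where "w T F = (if x \<in> F \<and> x \<notin> T then cube_sign p x (F - {x}) * v (insert x T) (F - {x}) else 0)" for T F
  have suppv: "R \<subseteq> T \<and> T \<union> F \<subseteq> U \<and> T \<inter> F = {} \<and> T \<union> F \<in> \<Delta> \<and> card F = k" if "v T F \<noteq> 0" for T F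
    using cube_chainD[OF Suc.prems(2) that] .
  have w: "cube_chain \<Delta> R U (Suc k) w"
    unfolding cube_chain_def
  proof (intro allI impI)
    fix T F assume "w T F \<noteq> 0"
    then have xF: "x \<in> F" "x \<notin> T" and "v (insert x T) (F - {x}) \<noteq> 0" by (auto simp: w_def split: if_splits)
    note s = suppv[OF this(3)]
    have un: "insert x T \<union> (F - {x}) = T \<union> F" using xF by blast
    have "F \<subseteq> U" using s un by blast
    then have "finite F" using finU by (rule finite_subset)
    then have "card F = Suc k" using s xF by (metis card_Suc_Diff1)
    moreover have "T \<inter> F = {}" using s xF by blast
    ultimately show "R \<subseteq> T \<and> T \<union> F \<subseteq> U \<and> T \<inter> F = {} \<and> T \<union> F \<in> \<Delta> \<and> card F = Suc k"
      using s un x(2) by auto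
  qed
  define v' where "v' T F = v T F - cube_bd V p w T F" for T F
  have bw: "cube_chain \<Delta> R U k (cube_bd V p w)" by (rule cube_chain_bd[OF down finU w])
  have v'_chain: "cube_chain \<Delta> R U k v'"
    unfolding cube_chain_def
  proof (intro allI impI)
    fix T F assume "v' T F \<noteq> 0"
    then have "v T F \<noteq> 0 \<or> cube_bd V p w T F \<noteq> 0" by (auto simp: v'_def)
    then show "R \<subseteq> T \<and> T \<union> F \<subseteq> U \<and> T \<inter> F = {} \<and> T \<union> F \<in> \<Delta> \<and> card F = k"
      using suppv[of T F] cube_chainD[OF bw, of T F] by blast
  qed
  have fin: "finite F" if "v' T F \<noteq> 0" for T F
    using cube_chainD[OF v'_chain that] finU by (meson finite_subset le_sup_iff)
  \<comment> \<open>Only the direction \<open>x\<close> contributes here, since \<open>w\<close>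
    vanishes on cubes whose first component still contains \<open>x\<close>; the two equal signs
    multiply to 1.\<close>
  have top: "v' T F = 0" if xT: "x \<in> T" for T F
  proof (cases "x \<in> F")
    case True
    then have "T \<inter> F \<noteq> {}" using xT by blast
    then show ?thesis using cube_chainD[OF v'_chain, of T F] by blast
  next
    case False
    have "cube_bd V p w T F
      = (\<Sum>s\<in>V - F. if s = x then cube_sign p x F * (cube_sign p x F * v T F) else 0)"
      unfolding cube_bd_def
    proof (rule sum.cong[OF refl])
      fix s assume "s \<in> V - F"
      show "cube_sign p s F * face_sign s T * w (T - {s}) (insert s F)
        = (if s = x then cube_sign p x F * (cube_sign p x F * v T F) else 0)"
        using False xT by (auto simp: w_def face_sign_def insert_absorb)
    qed
    also have "\<dots> = cube_sign p x F * cube_sign p x F * v T F" using V False xV by (simp add: mult.assoc)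
    also have "\<dots> = v T F" by (simp add: cube_sign_square)
    finally show ?thesis by (simp add: v'_def)
  qed
  have aug': "cube_aug V v' = 0" if "k = 0"
    using Suc.prems(3)[OF that] cube_aug_bd[OF V, of p w]
    by (simp add: v'_def cube_aug_def sum_subtractf)
  have bd': "cube_bd V p v' T F = 0" if k: "0 < k" for T F
  proof (cases "finite F")
    case True
    then show ?thesis unfolding v'_def cube_bd_diff using Suc.prems(4)[OF k] cube_bd_bd[OF V inj True] by simp
  next
    case False
    have "v' (T - {s}) (insert s F) = 0" for s using fin[of "T - {s}" "insert s F"] False by auto
    then show ?thesis by (simp add: cube_bd_def)
  qed
  have side: "v' T F = 0" if xF: "x \<in> F" for T F
  proof (cases "finite F \<and> x \<notin> T")
    case False
    then show ?thesis using fin top by blast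
  next
    case True
    show ?thesis
    proof (rule ccontr)
      assume nz: "v' T F \<noteq> 0"
      then have "card F = k" using cube_chainD[OF v'_chain] by blast
      then have k: "0 < k" using xF True by (auto simp: card_gt_0_iff)
      \<comment> \<open>The cycle condition is read at the face of \<open>(T, F)\<close> with
        \<open>x\<close> added to \<open>T\<close>. Every other direction keeps \<open>x\<close> in
        the first component, where \<open>v'\<close> is already zero, so only \<open>v' T F\<close>
        survives.\<close>
      have "cube_bd V p v' (insert x T) (F - {x})
        = (\<Sum>s\<in>V - (F - {x}). if s = x then cube_sign p x (F - {x}) * v' T F else 0)"
        unfolding cube_bd_def
      proof (rule sum.cong[OF refl])
        fix s assume "s \<in> V - (F - {x})"
        show "cube_sign p s (F - {x}) * face_sign s (insert x T) * v' (insert x T - {s}) (insert s (F - {x}))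
          = (if s = x then cube_sign p x (F - {x}) * v' T F else 0)"
        proof (cases "s = x")
          case True
          then have "insert x T - {s} = T" "insert s (F - {x}) = F" using \<open>finite F \<and> x \<notin> T\<close> xF by auto
          then show ?thesis using True by (simp add: face_sign_def)
        next
          case False
          then have "x \<in> insert x T - {s}" by blast
          then show ?thesis using top False by simp
        qed
      qed
      also have "\<dots> = cube_sign p x (F - {x}) * v' T F" using V xV by simp
      finally have "cube_sign p x (F - {x}) * v' T F = 0" using bd'[OF k] by simp
      moreover have "cube_sign p x (F - {x}) \<noteq> (0 :: 'k)" by (simp add: cube_sign_def)
      ultimately show False using nz by simp
    qed
  qed
  have v'_chain': "cube_chain \<Delta> R (U - {x}) k v'"
    unfolding cube_chain_def
  proof (intro allI impI)
    fix T F assume nz: "v' T F \<noteq> 0"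
    then have "x \<notin> T" "x \<notin> F" using top side by blast+
    moreover have "R \<subseteq> T \<and> T \<union> F \<subseteq> U \<and> T \<inter> F = {} \<and> T \<union> F \<in> \<Delta> \<and> card F = k"
      using cube_chainD[OF v'_chain nz] .
    ultimately show "R \<subseteq> T \<and> T \<union> F \<subseteq> U - {x} \<and> T \<inter> F = {} \<and> T \<union> F \<in> \<Delta> \<and> card F = k" by blast
  qed
  have "U - R = insert x (U - {x} - R)" using x by blast
  then have "n = card (U - {x} - R)" using Suc.hyps(2) finU by simp
  then obtain w' where w': "cube_chain \<Delta> R (U - {x}) (Suc k) w'" "\<And>T F. v' T F = cube_bd V p w' T F"
    using Suc.hyps(1)[of "U - {x}" v'] Suc.prems(1) v'_chain' aug' bd' by blast
  show ?case
  proof (intro exI[of _ "\<lambda>T F. w T F + w' T F"] conjI allI)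
    show "cube_chain \<Delta> R U (Suc k) (\<lambda>T F. w T F + w' T F)"
      unfolding cube_chain_def
    proof (intro allI impI)
      fix T F assume "w T F + w' T F \<noteq> 0"
      then have "w T F \<noteq> 0 \<or> w' T F \<noteq> 0" by auto
      then show "R \<subseteq> T \<and> T \<union> F \<subseteq> U \<and> T \<inter> F = {} \<and> T \<union> F \<in> \<Delta> \<and> card F = Suc k"
        using cube_chainD[OF w, of T F] cube_chainD[OF w'(1), of T F] by blast
    qed
    fix T F
    show "v T F = cube_bd V p (\<lambda>T F. w T F + w' T F) T F"
      unfolding cube_bd_add using w'(2)[of T F] by (simp add: v'_def algebra_simps)
  qed
qed

section \<open>The labelled cubical complex as a minimal free resolution\<close>

locale labelled_complex =
  fixes V :: "'a set" and p :: "'a \<Rightarrow> nat" and \<Delta> :: "'a set set" and cl :: "'a \<Rightarrow> 'b"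
    and X :: "('a + 'b) set"
  assumes finite_V: "finite V" and inj_p: "inj_on p V" and faces: "\<Delta> \<subseteq> Pow V"
    and down: "S \<in> \<Delta> \<Longrightarrow> S' \<subseteq> S \<Longrightarrow> S' \<in> \<Delta>"
    and cl_inj: "S \<in> \<Delta> \<Longrightarrow> inj_on cl S"
    and X: "Inl ` V \<union> Inr ` cl ` V \<subseteq> X"
begin

definition cubes :: "nat \<Rightarrow> ('a set \<times> 'a set) set" where
  "cubes k = {(T, F). T \<union> F \<in> \<Delta> \<and> T \<inter> F = {} \<and> card F = k}"

text \<open>A face \<open>S\<close> stands for the set of all \<open>Inl w\<close> with
  \<open>w\<close> outside \<open>S\<close> and all \<open>Inr (cl w)\<close> with \<open>w\<close>
  in \<open>S\<close>. The label is the union of these sets over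
  \<open>T \<subseteq> S \<subseteq> T \<union> F\<close>, that is, the least common multiple over
  the vertices of the cube.\<close>

definition label :: "'a set \<times> 'a set \<Rightarrow> ('a + 'b) set" where
  "label c = Inl ` (V - fst c) \<union> Inr ` cl ` (fst c \<union> snd c)"

definition cube_list :: "nat \<Rightarrow> ('a set \<times> 'a set) list" where
  "cube_list k = (SOME cs. set cs = cubes k \<and> distinct cs)"

definition shift_list :: "nat \<Rightarrow> ('a + 'b \<Rightarrow>\<^sub>0 nat) list" where
  "shift_list k = (case k of 0 \<Rightarrow> [0] | Suc k \<Rightarrow> map (\<lambda>c. sqfree (label c)) (cube_list k))"

text \<open>The coefficient of \<open>c\<close> in the boundary of \<open>c'\<close>. At most one
  \<open>s\<close> contributes; the form of a sum over directions lets matrix products be turned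
  into \<open>cube_bd\<close> by exchanging two sums.\<close>

definition incidence :: "'a set \<times> 'a set \<Rightarrow> 'a set \<times> 'a set \<Rightarrow> 'k::field" where
  "incidence c c' = (\<Sum>s\<in>V - snd c. if (fst c - {s}, insert s (snd c)) = c'
     then cube_sign p s (snd c) * face_sign s (fst c) else 0)"

definition cube_diff :: "nat \<Rightarrow> 'k::field mat" where
  "cube_diff k = (case k of 0 \<Rightarrow> mat 1 (length (cube_list 0)) (\<lambda>_. 1)
     | Suc k \<Rightarrow> mat (length (cube_list k)) (length (cube_list (Suc k)))
         (\<lambda>(i, j). incidence (cube_list k ! i) (cube_list (Suc k) ! j)))"

definition cube_fun :: "nat \<Rightarrow> 'k::field vec \<Rightarrow> 'a set \<Rightarrow> 'a set \<Rightarrow> 'k" where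
  "cube_fun k v T F = (\<Sum>j<length (cube_list k). if cube_list k ! j = (T, F) then v $ j else 0)"

text \<open>\<open>low\<close> and \<open>high\<close> turn a multidegree into bounds on cubes: the
  vertices that \<open>T\<close> is forced to contain, and those that \<open>T \<union> F\<close>
  may use.\<close>

definition low :: "('a + 'b \<Rightarrow>\<^sub>0 nat) \<Rightarrow> 'a set" where
  "low s = {w \<in> V. Inl w \<notin> Poly_Mapping.keys s}"

definition high :: "('a + 'b \<Rightarrow>\<^sub>0 nat) \<Rightarrow> 'a set" where
  "high s = {w \<in> V. Inr (cl w) \<in> Poly_Mapping.keys s}"

lemma cubesD:
  assumes "(T, F) \<in> cubes k"
  shows "T \<subseteq> V" "F \<subseteq> V" "T \<union> F \<in> \<Delta>" "T \<inter> F = {}" "card F = k" "finite T" "finite F"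
proof -
  show *: "T \<union> F \<in> \<Delta>" "T \<inter> F = {}" "card F = k" using assms by (simp_all add: cubes_def)
  then show "T \<subseteq> V" "F \<subseteq> V" using faces by auto
  then show "finite T" "finite F" using finite_V finite_subset by auto
qed

lemma finite_cubes: "finite (cubes k)"
proof -
  have "cubes k \<subseteq> Pow V \<times> Pow V"
  proof
    fix c assume "c \<in> cubes k"
    then have "fst c \<subseteq> V" "snd c \<subseteq> V" using cubesD(1,2)[of "fst c" "snd c" k] by simp_all
    then show "c \<in> Pow V \<times> Pow V" by (simp add: mem_Times_iff)
  qed
  then show ?thesis using finite_V finite_subset by blast
qed

lemma cube_list: "set (cube_list k) = cubes k" "distinct (cube_list k)"
  using someI_ex[OF finite_distinct_list[OF finite_cubes, of k]] by (simp_all add: cube_list_def)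

lemma cube_list_nth: "j < length (cube_list k) \<Longrightarrow> cube_list k ! j \<in> cubes k"
  using cube_list(1) nth_mem by blast

lemma finite_label: "c \<in> cubes k \<Longrightarrow> finite (label c)"
  using cubesD(6,7)[of "fst c" "snd c" k] finite_V by (simp add: label_def)

lemma in_label_iff:
  "Inl w \<in> label c \<longleftrightarrow> w \<in> V - fst c" "Inr A \<in> label c \<longleftrightarrow> A \<in> cl ` (fst c \<union> snd c)"
  by (auto simp: label_def)

lemma label_subset:
  assumes "c \<in> cubes k"
  shows "label c \<subseteq> X"
proof -
  have "fst c \<union> snd c \<subseteq> V" using cubesD(1,2)[of "fst c" "snd c" k] assms by simp
  then show ?thesis using X unfolding label_def by blast
qed

lemma label_mle_iff:
  assumes c: "(T, F) \<in> cubes k"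
  shows "sqfree (label (T, F)) \<preceq> s \<longleftrightarrow> low s \<subseteq> T \<and> T \<union> F \<subseteq> high s"
proof -
  have "Inl ` (V - T) \<subseteq> Poly_Mapping.keys s \<longleftrightarrow> low s \<subseteq> T" by (auto simp: low_def)
  moreover have "Inr ` cl ` (T \<union> F) \<subseteq> Poly_Mapping.keys s \<longleftrightarrow> T \<union> F \<subseteq> high s"
    using cubesD(1,2)[OF c] by (auto simp: high_def)
  ultimately show ?thesis unfolding sqfree_mle_iff[OF finite_label[OF c]] by (simp add: label_def)
qed

text \<open>Equal labels give equal first components, but only equal \<open>cl\<close>-images of the
  unions, and different faces may have the same image. The inclusion puts both unions inside one
  face, on which \<open>cl\<close> is injective.\<close>

lemma label_inj:
  assumes c: "(T, F) \<in> cubes k" and c': "(T', F') \<in> cubes k'" and sub: "T \<union> F \<subseteq> T' \<union> F'"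
    and eq: "label (T, F) = label (T', F')"
  shows "T = T'" "F = F'"
proof -
  have 1: "V - T = V - T'" "cl ` (T \<union> F) = cl ` (T' \<union> F')"
  proof -
    have "{w. Inl w \<in> label c} = V - fst c" "{A. Inr A \<in> label c} = cl ` (fst c \<union> snd c)" for c
      by (simp_all only: in_label_iff Collect_mem_eq)
    from this[of "(T, F)"] this[of "(T', F')"]
    show "V - T = V - T'" "cl ` (T \<union> F) = cl ` (T' \<union> F')" using eq by simp_all
  qed
  show T: "T = T'" using 1(1) cubesD(1)[OF c] cubesD(1)[OF c'] by blast
  have "T \<union> F = T' \<union> F'"
    using inj_on_image_eq_iff[OF cl_inj[OF cubesD(3)[OF c']] sub subset_refl] 1(2) by blast
  then show "F = F'" using T cubesD(4)[OF c] cubesD(4)[OF c'] by blast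
qed

lemma incidence_nonzero:
  assumes "(incidence c c' :: 'k::field) \<noteq> 0"
  obtains s where "s \<in> V - snd c" "c' = (fst c - {s}, insert s (snd c))"
proof -
  obtain s where "s \<in> V - snd c"
    "(if (fst c - {s}, insert s (snd c)) = c' then cube_sign p s (snd c) * face_sign s (fst c) else 0) \<noteq> (0 :: 'k)"
    using assms unfolding incidence_def by (rule sum.not_neutral_contains_not_neutral)
  then have "s \<in> V - snd c" "c' = (fst c - {s}, insert s (snd c))" by (auto split: if_splits)
  then show thesis by (rule that)
qed

text \<open>A cube has a strictly smaller label than any cube having it as a facet, since equal
  labels would by \<open>label_inj\<close> identify the two. This is the source of both gradedness
  and minimality of the differentials.\<close>

lemma incidence_label:
  assumes "c \<in> cubes k" "c' \<in> cubes k'" and nz: "(incidence c c' :: 'k::field) \<noteq> 0"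
  shows "sqfree (label c) \<preceq> sqfree (label c')" "sqfree (label c) \<noteq> sqfree (label c')"
proof -
  obtain T F where c: "c = (T, F)" by (cases c)
  obtain T' F' where c': "c' = (T', F')" by (cases c')
  obtain s where s: "s \<in> V - F" "T' = T - {s}" "F' = insert s F"
    using incidence_nonzero[OF nz] c c' by auto
  have sub: "T \<union> F \<subseteq> T' \<union> F'" using s by blast
  have "label c \<subseteq> label c'" using s by (auto simp: label_def c c')
  then show "sqfree (label c) \<preceq> sqfree (label c')"
    using assms by (simp add: sqfree_mle_iff[OF finite_label] finite_label)
  have "F \<noteq> F'" using s by blast
  then have "label c \<noteq> label c'" using label_inj(2)[OF _ _ sub] assms(1,2) c c' by blast
  then show "sqfree (label c) \<noteq> sqfree (label c')"
    using keys_sqfree[OF finite_label[OF assms(1)]] keys_sqfree[OF finite_label[OF assms(2)]] by metis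
qed

lemma shift_list_simps [simp]: "shift_list 0 = [0]"
  "shift_list (Suc k) = map (\<lambda>c. sqfree (label c)) (cube_list k)"
  by (simp_all add: shift_list_def)

lemma graded_cube_diff: "graded_mat (shift_list k) (shift_list (Suc k)) (cube_diff k :: 'k::field mat)"
proof (cases k)
  case 0
  then show ?thesis by (auto simp: graded_mat_def cube_diff_def)
next
  case (Suc m)
  then show ?thesis
    using incidence_label(1)[OF cube_list_nth cube_list_nth] by (auto simp: graded_mat_def cube_diff_def)
qed

lemma minimal_cube_diff: "scalar_minimal shift_list (cube_diff :: nat \<Rightarrow> 'k::field mat)"
  using incidence_label(2)[OF cube_list_nth cube_list_nth] by (auto simp: scalar_minimal_def cube_diff_def)

lemma cube_fun_nth: "j < length (cube_list k) \<Longrightarrow> cube_fun k v (fst (cube_list k ! j)) (snd (cube_list k ! j)) = v $ j"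
proof -
  assume j: "j < length (cube_list k)"
  have "cube_list k ! i = cube_list k ! j \<longleftrightarrow> i = j" if "i < length (cube_list k)" for i
    using nth_eq_iff_index_eq[OF cube_list(2) that j] .
  then have "cube_fun k v (fst (cube_list k ! j)) (snd (cube_list k ! j))
    = (\<Sum>i<length (cube_list k). if i = j then v $ j else 0)"
    unfolding cube_fun_def by (intro sum.cong) auto
  then show ?thesis using j by simp
qed

lemma cube_fun_nonzero:
  assumes "cube_fun k v T F \<noteq> 0"
  obtains j where "j < length (cube_list k)" "cube_list k ! j = (T, F)" "v $ j \<noteq> 0"
proof -
  obtain j where "j < length (cube_list k)" "(if cube_list k ! j = (T, F) then v $ j else 0) \<noteq> 0"
    using assms unfolding cube_fun_def by (rule sum.not_neutral_contains_not_neutral) simp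
  then have "j < length (cube_list k)" "cube_list k ! j = (T, F)" "v $ j \<noteq> 0" by (auto split: if_splits)
  then show thesis by (rule that)
qed

lemma cube_fun_chain:
  assumes v: "v \<in> strand (shift_list (Suc k)) s"
  shows "cube_chain \<Delta> (low s) (high s) k (cube_fun k v)"
  unfolding cube_chain_def
proof (intro allI impI)
  fix T F assume "cube_fun k v T F \<noteq> 0"
  then obtain j where j: "j < length (cube_list k)" "cube_list k ! j = (T, F)" "v $ j \<noteq> 0"
    by (rule cube_fun_nonzero)
  have c: "(T, F) \<in> cubes k" using cube_list_nth[OF j(1)] j(2) by simp
  have "sqfree (label (T, F)) \<preceq> s" using v j by (auto simp: strand_def)
  then show "low s \<subseteq> T \<and> T \<union> F \<subseteq> high s \<and> T \<inter> F = {} \<and> T \<union> F \<in> \<Delta> \<and> card F = k"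
    using label_mle_iff[OF c] cubesD[OF c] by simp
qed

lemma cube_chain_cube: "cube_chain \<Delta> R U k v \<Longrightarrow> v T F \<noteq> 0 \<Longrightarrow> (T, F) \<in> cubes k"
  using cube_chainD[of \<Delta> R U k v T F] by (simp add: cubes_def)

lemma cube_chain_eqI:
  assumes v: "cube_chain \<Delta> R U k v" and w: "cube_chain \<Delta> R' U' k w"
    and "\<And>j. j < length (cube_list k) \<Longrightarrow>
      v (fst (cube_list k ! j)) (snd (cube_list k ! j)) = w (fst (cube_list k ! j)) (snd (cube_list k ! j))"
  shows "v T F = w T F"
proof (cases "(T, F) \<in> cubes k")
  case True
  then obtain j where "j < length (cube_list k)" "cube_list k ! j = (T, F)"
    using cube_list(1) by (metis in_set_conv_nth)
  then show ?thesis using assms(3)[of j] by simp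
next
  case False
  then show ?thesis using cube_chain_cube[OF v] cube_chain_cube[OF w] by metis
qed

lemma vec_of_cube_chain:
  assumes w: "cube_chain \<Delta> (low s) (high s) k w"
  defines "v \<equiv> vec (length (cube_list k)) (\<lambda>j. w (fst (cube_list k ! j)) (snd (cube_list k ! j)))"
  shows "v \<in> strand (shift_list (Suc k)) s" "cube_fun k v T F = w T F"
proof -
  show v: "v \<in> strand (shift_list (Suc k)) s"
    unfolding strand_def
  proof (intro CollectI conjI allI impI)
    fix j assume "j < length (shift_list (Suc k))" and nz: "v $ j \<noteq> 0"
    then have j: "j < length (cube_list k)" by simp
    obtain T F where c: "cube_list k ! j = (T, F)" by fastforce
    then have "low s \<subseteq> T \<and> T \<union> F \<subseteq> high s" using cube_chainD[OF w, of T F] nz j by (simp add: v_def)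
    then show "shift_list (Suc k) ! j \<preceq> s"
      using label_mle_iff[of T F k s] cube_list_nth[OF j] c j by simp
  qed (simp add: v_def)
  show "cube_fun k v T F = w T F"
    by (rule cube_chain_eqI[OF cube_fun_chain[OF v] w]) (simp add: cube_fun_nth v_def)
qed

lemma cube_diff_index:
  fixes v :: "'k::field vec"
  assumes v: "v \<in> carrier_vec (length (cube_list (Suc k)))" and i: "i < length (cube_list k)"
  shows "(cube_diff (Suc k) *\<^sub>v v) $ i
    = cube_bd V p (cube_fun (Suc k) v) (fst (cube_list k ! i)) (snd (cube_list k ! i))"
proof -
  obtain T F where c: "cube_list k ! i = (T, F)" by fastforce
  let ?n = "length (cube_list (Suc k))"
  have C: "(cube_diff (Suc k) :: 'k mat) \<in> carrier_mat (length (cube_list k)) ?n" by (simp add: cube_diff_def)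
  have "(cube_diff (Suc k) *\<^sub>v v) $ i = (\<Sum>j<?n. incidence (T, F) (cube_list (Suc k) ! j) * v $ j)"
    unfolding mult_mat_vec_index[OF C v i] using i c by (simp add: cube_diff_def)
  also have "\<dots> = (\<Sum>j<?n. \<Sum>s\<in>V - F. cube_sign p s F * face_sign s T *
      (if cube_list (Suc k) ! j = (T - {s}, insert s F) then v $ j else 0))"
    unfolding incidence_def sum_distrib_right by (intro sum.cong refl) auto
  also have "\<dots> = (\<Sum>s\<in>V - F. \<Sum>j<?n. cube_sign p s F * face_sign s T *
      (if cube_list (Suc k) ! j = (T - {s}, insert s F) then v $ j else 0))" by (rule sum.swap)
  also have "\<dots> = cube_bd V p (cube_fun (Suc k) v) T F"
    unfolding cube_bd_def cube_fun_def by (simp only: sum_distrib_left)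
  finally show ?thesis using c by simp
qed

lemma cube_diff_aug:
  fixes v :: "'k::field vec"
  assumes v: "v \<in> carrier_vec (length (cube_list 0))"
  shows "(cube_diff 0 *\<^sub>v v) $ 0 = cube_aug V (cube_fun 0 v)"
proof -
  let ?n = "length (cube_list 0)"
  have C: "(cube_diff 0 :: 'k mat) \<in> carrier_mat 1 ?n" by (simp add: cube_diff_def)
  have cell: "fst (cube_list 0 ! j) \<in> Pow V" "snd (cube_list 0 ! j) = {}" if "j < ?n" for j
  proof -
    have c: "(fst (cube_list 0 ! j), snd (cube_list 0 ! j)) \<in> cubes 0" using cube_list_nth[OF that] by simp
    show "fst (cube_list 0 ! j) \<in> Pow V" "snd (cube_list 0 ! j) = {}"
      using cubesD(1,5,7)[OF c] by auto
  qed
  have "cube_aug V (cube_fun 0 v) = (\<Sum>j<?n. \<Sum>T\<in>Pow V. if cube_list 0 ! j = (T, {}) then v $ j else 0)"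
    unfolding cube_aug_def cube_fun_def by (rule sum.swap)
  also have "\<dots> = (\<Sum>j<?n. \<Sum>T\<in>Pow V. if T = fst (cube_list 0 ! j) then v $ j else 0)"
    using cell(2) by (intro sum.cong refl if_cong) (auto simp: prod_eq_iff)
  also have "\<dots> = (\<Sum>j<?n. v $ j)" using cell(1) finite_V by (intro sum.cong refl) (simp add: sum.delta)
  also have "\<dots> = (cube_diff 0 *\<^sub>v v) $ 0"
    using mult_mat_vec_index[OF C v, of 0] by (simp add: cube_diff_def del: index_mult_mat_vec)
  finally show ?thesis by simp
qed

lemma cube_diff_zero_iff:
  fixes v :: "'k::field vec"
  assumes v: "v \<in> strand (shift_list (Suc k)) s"
  shows "cube_diff k *\<^sub>v v = 0\<^sub>v (length (shift_list k)) \<longleftrightarrow>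
    (if k = 0 then cube_aug V (cube_fun 0 v) = 0 else \<forall>T F. cube_bd V p (cube_fun k v) T F = 0)"
proof (cases k)
  case 0
  have vc: "v \<in> carrier_vec (length (cube_list 0))" using strandD[OF v] 0 by simp
  have "cube_diff 0 *\<^sub>v v = 0\<^sub>v 1 \<longleftrightarrow> (cube_diff 0 *\<^sub>v v) $ 0 = 0"
    by (auto simp: cube_diff_def simp del: index_mult_mat_vec intro!: eq_vecI)
  then show ?thesis using 0 cube_diff_aug[OF vc] by simp
next
  case (Suc m)
  have vc: "v \<in> carrier_vec (length (cube_list (Suc m)))" using strandD[OF v] Suc by simp
  have fin: "finite (high s)" using finite_V by (simp add: high_def)
  have chain: "cube_chain \<Delta> (low s) (high s) m (cube_bd V p (cube_fun (Suc m) v))"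
    using cube_chain_bd[OF down fin cube_fun_chain[of v "Suc m" s]] v Suc by simp
  have "cube_diff (Suc m) *\<^sub>v v = 0\<^sub>v (length (cube_list m))
    \<longleftrightarrow> (\<forall>i<length (cube_list m). (cube_diff (Suc m) *\<^sub>v v) $ i = 0)"
    by (auto simp: cube_diff_def simp del: index_mult_mat_vec intro!: eq_vecI)
  also have "\<dots> \<longleftrightarrow> (\<forall>T F. cube_bd V p (cube_fun (Suc m) v) T F = 0)"
  proof
    assume z: "\<forall>i<length (cube_list m). (cube_diff (Suc m) *\<^sub>v v) $ i = 0"
    have zero: "cube_chain \<Delta> (low s) (high s) m (\<lambda>T F. 0 :: 'k)" by (simp add: cube_chain_def)
    show "\<forall>T F. cube_bd V p (cube_fun (Suc m) v) T F = 0"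
    proof (intro allI)
      fix T F
      show "cube_bd V p (cube_fun (Suc m) v) T F = 0"
        by (rule cube_chain_eqI[OF chain zero, of T F]) (use z cube_diff_index[OF vc] in simp)
    qed
  qed (simp add: cube_diff_index[OF vc] del: index_mult_mat_vec)
  finally show ?thesis using Suc by simp
qed

lemma cube_fun_diff:
  fixes v :: "'k::field vec"
  assumes v: "v \<in> strand (shift_list (Suc (Suc k))) s"
  shows "cube_fun k (cube_diff (Suc k) *\<^sub>v v) T F = cube_bd V p (cube_fun (Suc k) v) T F"
proof -
  have fin: "finite (high s)" using finite_V by (simp add: high_def)
  have vc: "v \<in> carrier_vec (length (cube_list (Suc k)))" using strandD[OF v] by simp
  have d: "cube_diff (Suc k) *\<^sub>v v \<in> strand (shift_list (Suc k)) s" by (rule graded_mult_strand[OF graded_cube_diff v])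
  show ?thesis
    by (rule cube_chain_eqI[OF cube_fun_chain[OF d] cube_chain_bd[OF down fin cube_fun_chain[OF v]]])
      (simp_all add: cube_fun_nth cube_diff_index[OF vc] del: index_mult_mat_vec)
qed

text \<open>In degree \<open>s\<close> the complex is that of the cubes between \<open>low s\<close>
  and \<open>high s\<close>, so cycles are boundaries by \<open>cube_exact\<close>, and boundaries
  are cycles by \<open>cube_bd_bd\<close> and \<open>cube_aug_bd\<close>.\<close>

lemma cube_diff_exact:
  "strand_exact Y (shift_list k) (shift_list (Suc k)) (shift_list (Suc (Suc k)))
    (cube_diff k :: 'k::field mat) (cube_diff (Suc k))"
  unfolding strand_exact_def
proof (intro allI impI subset_antisym subsetI)
  fix s and v :: "'k vec"
  assume "v \<in> {v \<in> strand (shift_list (Suc k)) s. cube_diff k *\<^sub>v v = 0\<^sub>v (length (shift_list k))}"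
  then have v: "v \<in> strand (shift_list (Suc k)) s" "cube_diff k *\<^sub>v v = 0\<^sub>v (length (shift_list k))" by auto
  have "\<exists>w. cube_chain \<Delta> (low s) (high s) (Suc k) w \<and> (\<forall>T F. cube_fun k v T F = cube_bd V p w T F)"
  proof (rule cube_exact[OF finite_V inj_p _ down cube_fun_chain[OF v(1)]])
    show "high s \<subseteq> V" by (auto simp: high_def)
    show "cube_aug V (cube_fun k v) = 0" if "k = 0"
      using iffD1[OF cube_diff_zero_iff[OF v(1)] v(2)] that by simp
    show "cube_bd V p (cube_fun k v) T F = 0" if "0 < k" for T F
      using iffD1[OF cube_diff_zero_iff[OF v(1)] v(2)] that by simp
  qed
  then obtain w where w: "cube_chain \<Delta> (low s) (high s) (Suc k) w" "\<And>T F. cube_fun k v T F = cube_bd V p w T F"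
    by blast
  define y where "y = vec (length (cube_list (Suc k))) (\<lambda>j. w (fst (cube_list (Suc k) ! j)) (snd (cube_list (Suc k) ! j)))"
  have y: "y \<in> strand (shift_list (Suc (Suc k))) s" and fy: "cube_fun (Suc k) y = w"
    using vec_of_cube_chain[OF w(1)] unfolding y_def by auto
  have "v = cube_diff (Suc k) *\<^sub>v y"
  proof (rule eq_vecI)
    fix i assume "i < dim_vec (cube_diff (Suc k) *\<^sub>v y)"
    then have i: "i < length (cube_list k)" by (simp add: cube_diff_def)
    have yc: "y \<in> carrier_vec (length (cube_list (Suc k)))" by (simp add: y_def)
    show "v $ i = (cube_diff (Suc k) *\<^sub>v y) $ i"
      unfolding cube_diff_index[OF yc i] fy w(2)[symmetric] cube_fun_nth[OF i] ..
  qed (use strandD[OF v(1)] in \<open>simp add: cube_diff_def\<close>)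
  then show "v \<in> (\<lambda>w. cube_diff (Suc k) *\<^sub>v w) ` strand (shift_list (Suc (Suc k))) s"
    using y by (rule image_eqI)
next
  fix s and v :: "'k vec"
  assume "v \<in> (\<lambda>w. cube_diff (Suc k) *\<^sub>v w) ` strand (shift_list (Suc (Suc k))) s"
  then obtain y where y: "y \<in> strand (shift_list (Suc (Suc k))) s" and v: "v = cube_diff (Suc k) *\<^sub>v y" by blast
  have vs: "v \<in> strand (shift_list (Suc k)) s" unfolding v by (rule graded_mult_strand[OF graded_cube_diff y])
  have f: "cube_fun k v = cube_bd V p (cube_fun (Suc k) y)"
    unfolding v by (intro ext cube_fun_diff[OF y])
  have "cube_bd V p (cube_fun k v) T F = 0" for T F
  proof (cases "finite F")
    case True
    then show ?thesis unfolding f by (rule cube_bd_bd[OF finite_V inj_p])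
  next
    case False
    \<comment> \<open>For infinite \<open>F\<close> the boundary reads only pairs with infinite
      second component, and cubes are finite.\<close>
    have "cube_fun k v (T - {t}) (insert t F) = 0" for t
    proof (rule ccontr)
      assume "cube_fun k v (T - {t}) (insert t F) \<noteq> 0"
      then have "(T - {t}, insert t F) \<in> cubes k" by (rule cube_chain_cube[OF cube_fun_chain[OF vs]])
      from cubesD(7)[OF this] show False using False by simp
    qed
    then show ?thesis by (simp add: cube_bd_def)
  qed
  moreover have "cube_aug V (cube_fun 0 v) = 0" if "k = 0"
    using that f cube_aug_bd[OF finite_V, of p "cube_fun (Suc k) y"] by simp
  ultimately show "v \<in> {v \<in> strand (shift_list (Suc k)) s. cube_diff k *\<^sub>v v = 0\<^sub>v (length (shift_list k))}"
    using vs cube_diff_zero_iff[OF vs] by simp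
qed

lemma multigraded_shifts_labels:
  "multigraded_shifts X k (Idl\<^bsub>mpoly_ring X\<^esub> (mon ` (\<lambda>c. sqfree (label c)) ` cubes 0) :: ('a + 'b, 'k::field) mpoly set)
    = (\<lambda>c. sqfree (label c)) ` cubes k"
proof -
  have keys: "Poly_Mapping.keys s \<subseteq> X" if "s \<in> set (shift_list k)" for s k
  proof (cases k)
    case (Suc m)
    then obtain c where "c \<in> cubes m" "s = sqfree (label c)" using \<open>s \<in> set (shift_list k)\<close> cube_list(1) by auto
    then show ?thesis using label_subset finite_label by simp
  qed (use that in simp)
  have R: "scalar_resolution X shift_list (cube_diff :: nat \<Rightarrow> 'k mat)"
    unfolding scalar_resolution_def by (intro conjI allI ballI keys graded_cube_diff cube_diff_exact)
  \<comment> \<open>The dimension of a cube is at most the number of vertices, which bounds the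
    length of the resolution.\<close>
  have "shift_list (Suc k) = []" if "card V < k" for k
  proof -
    have "cubes k = {}"
    proof (rule ccontr)
      assume "cubes k \<noteq> {}"
      then obtain c where "c \<in> cubes k" by blast
      then have c: "(fst c, snd c) \<in> cubes k" by simp
      have "card (snd c) \<le> card V" by (rule card_mono[OF finite_V cubesD(2)[OF c]])
      then show False using that cubesD(5)[OF c] by simp
    qed
    then show ?thesis using cube_list(1)[of k] by simp
  qed
  moreover have "(\<lambda>v. (poly_mat [0] (shift_list 1) (cube_diff 0) *\<^sub>v v) $ 0) ` free_module X (length (shift_list 1))
    = Idl\<^bsub>mpoly_ring X\<^esub> (mon ` set (shift_list 1) :: ('a + 'b, 'k) mpoly set)"
  proof -
    have "cube_diff 0 = mat 1 (length (shift_list 1)) (\<lambda>_. 1 :: 'k)" by (simp add: cube_diff_def)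
    then show ?thesis by (simp only:) (rule image_augmentation_ones[OF keys])
  qed
  ultimately have "multigraded_shifts X k (Idl\<^bsub>mpoly_ring X\<^esub> (mon ` set (shift_list 1)) :: ('a + 'b, 'k) mpoly set)
    = set (shift_list (Suc k))"
    by (intro multigraded_shifts_scalar_resolution[OF R minimal_cube_diff shift_list_simps(1)])
  moreover have "set (shift_list (Suc m)) = (\<lambda>c. sqfree (label c)) ` cubes m" for m
    by (simp add: cube_list(1))
  ultimately show ?thesis by (simp only: One_nat_def)
qed

end

subsection \<open>Linear quotients from a sorting key\<close>

text \<open>Small keys come first, so they are the large elements of the order. The condition
  \<open>quot\<close> is the usual test: the quotient of an earlier \<open>s\<close> by its greatest
  common divisor with \<open>u\<close> is divisible by a variable that itself lies in the colon
  ideal.\<close>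

lemma linear_quotients_by_key:
  fixes S :: "('x \<Rightarrow>\<^sub>0 nat) set" and key :: "('x \<Rightarrow>\<^sub>0 nat) \<Rightarrow> 'o::linorder"
  assumes fin: "finite S" and SX: "\<And>s. s \<in> S \<Longrightarrow> Poly_Mapping.keys s \<subseteq> X"
    and I: "min_gens X (I :: ('x, 'k::field) mpoly set) = S" and inj: "inj_on key S"
    and quot: "\<And>s u. s \<in> S \<Longrightarrow> u \<in> S \<Longrightarrow> key s < key u \<Longrightarrow>
      \<exists>x\<in>X. Poly_Mapping.lookup u x < Poly_Mapping.lookup s x \<and>
        (\<exists>t\<in>S. key t < key u \<and> t \<preceq> Poly_Mapping.single x 1 + u)"
  shows "linear_quotients_wrt X I {(s, t). s \<in> S \<and> t \<in> S \<and> key s < key t}"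
  unfolding linear_quotients_wrt_def I
proof (intro conjI)
  let ?gt = "{(s, t). s \<in> S \<and> t \<in> S \<and> key s < key t}"
  show "strict_linear_order_on S ?gt"
    unfolding strict_linear_order_on_def
  proof (intro conjI)
    show "trans ?gt" by (rule transI) auto
    show "irrefl ?gt" by (auto simp: irrefl_def)
    show "total_on S ?gt" using inj by (fastforce simp: total_on_def inj_on_def)
  qed
  define ms where "ms = map (the_inv_into S key) (sorted_list_of_set (key ` S))"
  have set_ms: "set ms = S" using fin inj by (simp add: ms_def the_inv_into_onto)
  have "sorted_wrt (<) (sorted_list_of_set (key ` S))" by (rule strict_sorted_list_of_set)
  then have sorted: "sorted_wrt (\<lambda>u v. (u, v) \<in> ?gt) ms"
    unfolding ms_def sorted_wrt_map
    by (rule sorted_wrt_mono_rel[rotated])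
      (use fin inj in \<open>auto simp: the_inv_into_f_f\<close>)
  have colon: "\<exists>W\<subseteq>X. colon X (Idl\<^bsub>mpoly_ring X\<^esub> (mon ` set (take j ms))) (mon (ms ! j))
      = Idl\<^bsub>mpoly_ring X\<^esub> ((var :: _ \<Rightarrow> ('x, 'k) mpoly) ` W)" if j: "j < length ms" for j
  proof -
    let ?u = "ms ! j" and ?Q = "set (take j ms)"
    have u: "?u \<in> S" using j set_ms by auto
    have lt: "key (ms ! i) < key (ms ! l)" if "i < l" "l < length ms" for i l
      using sorted_wrt_nth_less[OF sorted that] by simp
    have Q: "?Q = {t \<in> S. key t < key ?u}"
    proof (intro subset_antisym subsetI)
      fix t assume "t \<in> ?Q"
      then obtain i where "i < j" "t = ms ! i" using j by (auto simp: in_set_conv_nth)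
      then show "t \<in> {t \<in> S. key t < key ?u}" using lt[of i j] j set_ms by auto
    next
      fix t assume "t \<in> {t \<in> S. key t < key ?u}"
      then obtain i where i: "i < length ms" "t = ms ! i" "key (ms ! i) < key ?u"
        using set_ms by (auto simp: in_set_conv_nth)
      have "i < j"
      proof (rule ccontr)
        assume "\<not> i < j"
        then have "i = j \<or> j < i" by linarith
        then show False using lt[of j i] i by auto
      qed
      then show "t \<in> ?Q" using i j by (auto simp: in_set_conv_nth)
    qed
    \<comment> \<open>All variables of the colon ideal are taken; \<open>quot\<close> shows that
      they generate it.\<close>
    define W where "W = {x \<in> X. \<exists>t\<in>?Q. t \<preceq> Poly_Mapping.single x 1 + ?u}"
    have "colon X (Idl\<^bsub>mpoly_ring X\<^esub> (mon ` ?Q)) (mon ?u) = Idl\<^bsub>mpoly_ring X\<^esub> ((var :: _ \<Rightarrow> ('x, 'k) mpoly) ` W)"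
    proof (rule colon_monomial)
      fix s assume "s \<in> ?Q"
      then have s: "s \<in> S" "key s < key ?u" using Q by auto
      from quot[OF s(1) u s(2)] show "\<exists>x\<in>W. Poly_Mapping.lookup ?u x < Poly_Mapping.lookup s x"
        unfolding W_def Q by blast
    qed (use SX u Q in \<open>auto simp: W_def\<close>)
    moreover have "W \<subseteq> X" by (auto simp: W_def)
    ultimately show ?thesis by blast
  qed
  show "\<exists>ms. set ms = S \<and> sorted_wrt (\<lambda>u v. (u, v) \<in> ?gt) ms \<and>
        (\<forall>j. 1 \<le> j \<and> j < length ms \<longrightarrow>
           (\<exists>W\<subseteq>X. colon X (Idl\<^bsub>mpoly_ring X\<^esub> (mon ` set (take j ms))) (mon (ms ! j))
                   = Idl\<^bsub>mpoly_ring X\<^esub> ((var :: _ \<Rightarrow> ('x, 'k) mpoly) ` W)))"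
    by (intro exI[of _ ms] conjI set_ms sorted) (simp add: colon)
qed

subsection \<open>Binary encodings of finite sets\<close>

lemma set_encode_less_power: "A \<subseteq> {..<n} \<Longrightarrow> set_encode A < 2 ^ n"
proof -
  assume "A \<subseteq> {..<n}"
  then have "set_encode A \<le> set_encode {..<n}" unfolding set_encode_def by (intro sum_mono2) auto
  also have "set_encode {..<n} < 2 ^ n"
    by (induction n) (simp_all add: lessThan_Suc set_encode_insert)
  finally show ?thesis .
qed

lemma set_encode_mono: "finite B \<Longrightarrow> A \<subseteq> B \<Longrightarrow> set_encode A \<le> set_encode B"
  unfolding set_encode_def by (intro sum_mono2) auto

text \<open>Comparing binary codes is comparing sets lexicographically from their largest elements
  down: the topmost differing bit decides.\<close>

lemma set_encode_first_difference:
  assumes fin: "finite A" "finite B" and less: "set_encode A < set_encode B"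
  obtains n where "n \<in> B" "n \<notin> A" "\<And>m. n < m \<Longrightarrow> m \<in> A \<longleftrightarrow> m \<in> B"
proof -
  define D where "D = (A - B) \<union> (B - A)"
  define n where "n = Max D"
  have D: "finite D" "D \<noteq> {}" using fin less by (auto simp: D_def)
  have above: "m \<in> A \<longleftrightarrow> m \<in> B" if "n < m" for m
  proof (rule ccontr)
    assume "\<not> (m \<in> A \<longleftrightarrow> m \<in> B)"
    then have "m \<in> D" by (auto simp: D_def)
    then show False using that Max_ge[OF D(1)] by (simp add: n_def leD)
  qed
  have "n \<in> D" using Max_in[OF D] by (simp add: n_def)
  moreover have "\<not> (n \<in> A \<and> n \<notin> B)"
  proof
    assume n: "n \<in> A \<and> n \<notin> B"
    let ?H = "{m \<in> A. n < m}" and ?L = "{m \<in> B. m < n}"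
    have "m < n" if "m \<in> B" "\<not> n < m" for m using that n by (cases "m = n") auto
    then have B: "B = ?L \<union> ?H" using above by blast
    \<comment> \<open>If the topmost differing bit belonged to \<open>A\<close>, the lower bits of
      \<open>B\<close> would add up to less than \<open>2 ^ n\<close> and could not make up for
      it.\<close>
    have "set_encode B = set_encode ?L + set_encode ?H"
      by (subst B, unfold set_encode_def, rule sum.union_disjoint) (use fin in auto)
    also have "\<dots> < 2 ^ n + set_encode ?H" using set_encode_less_power[of ?L n] by auto
    also have "\<dots> = set_encode (insert n ?H)" using fin by (simp add: set_encode_insert)
    also have "\<dots> \<le> set_encode A" by (rule set_encode_mono[OF fin(1)]) (use n in auto)
    finally show False using less by simp
  qed
  ultimately have "n \<in> B" "n \<notin> A" by (auto simp: D_def)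
  then show thesis using that above by blast
qed

subsection \<open>The independence complex with its clique labelling\<close>

text \<open>Only this much of the graph enters the combinatorics: adjacency, the clique
  \<open>cl\<close> of each vertex, and positions \<open>p\<close> of a perfect elimination
  ordering. By \<open>cl_adjacent\<close> an independent set meets each clique at most once, which
  is the injectivity demanded by \<open>labelled_complex\<close>.\<close>

locale clique_ordered =
  fixes V :: "'a set" and R :: "'a \<Rightarrow> 'a \<Rightarrow> bool" and cl :: "'a \<Rightarrow> 'b" and p :: "'a \<Rightarrow> nat"
    and X :: "('a + 'b) set"
  assumes finite_vertices: "finite V"
    and R_sym: "R x y \<Longrightarrow> R y x" and R_irrefl: "\<not> R x x"
    and cl_adjacent: "x \<in> V \<Longrightarrow> y \<in> V \<Longrightarrow> cl x = cl y \<Longrightarrow> x \<noteq> y \<Longrightarrow> R x y"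
    and p_inj: "inj_on p V" and elim: "x \<in> V \<Longrightarrow> simplicial R {y \<in> V. p y < p x} x"
    and X_verts: "Inl ` V \<union> Inr ` cl ` V \<subseteq> X"
begin

definition indep :: "'a set set" where
  "indep = {S. S \<subseteq> V \<and> (\<forall>x\<in>S. \<forall>y\<in>S. \<not> R x y)}"

end

sublocale clique_ordered \<subseteq> labelled_complex V p indep cl X
proof
  show "inj_on cl S" if "S \<in> indep" for S
  proof (rule inj_onI)
    fix x y assume "x \<in> S" "y \<in> S" "cl x = cl y"
    moreover from this have "x \<in> V" "y \<in> V" "\<not> R x y" using that by (auto simp: indep_def)
    ultimately show "x = y" using cl_adjacent by blast
  qed
  show "S' \<in> indep" if "S \<in> indep" "S' \<subseteq> S" for S S'
    using that by (simp add: indep_def subset_iff)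
  show "indep \<subseteq> Pow V" by (auto simp: indep_def)
qed (use finite_vertices p_inj X_verts in auto)

context clique_ordered
begin

abbreviation code :: "'a set \<Rightarrow> nat" where
  "code S \<equiv> set_encode (p ` S)"

definition top_part :: "('a + 'b) set \<Rightarrow> 'a set" where
  "top_part M = {w \<in> V. Inl w \<notin> M}"

text \<open>Several \<open>F\<close> may share a label, because only cliques are recorded; the one
  with the largest code is singled out.\<close>

definition best :: "nat \<Rightarrow> ('a + 'b) set \<Rightarrow> nat" where
  "best k M = Max {code F |F. (top_part M, F) \<in> cubes k \<and> label (top_part M, F) = M}"

text \<open>Pairs are compared lexicographically and small ranks come first. The code of
  \<open>T\<close> grows with inclusion, so removing elements from \<open>T\<close> moves a label
  forward; the negation, hence the type \<open>int\<close>, puts large codes of \<open>F\<close>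
  first.\<close>

definition rank :: "nat \<Rightarrow> ('a + 'b) set \<Rightarrow> nat \<times> int" where
  "rank k M = (code (top_part M), - int (best k M))"

lemma top_part_label: "(T, F) \<in> cubes k \<Longrightarrow> top_part (label (T, F)) = T"
  using cubesD(1)[of T F k] by (auto simp: top_part_def in_label_iff)

lemma finite_codes: "finite {code F |F. (T, F) \<in> cubes k \<and> label (T, F) = M}"
proof (rule finite_subset)
  show "{code F |F. (T, F) \<in> cubes k \<and> label (T, F) = M} \<subseteq> code ` Pow V" using cubesD(2) by auto
  show "finite (code ` Pow V)" using finite_vertices by simp
qed

lemma best_ge: "(T, F) \<in> cubes k \<Longrightarrow> label (T, F) = M \<Longrightarrow> code F \<le> best k M"
  unfolding best_def using top_part_label[of T F k] by (intro Max_ge finite_codes) auto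

lemma best_cube:
  assumes "M \<in> label ` cubes k"
  obtains F where "(top_part M, F) \<in> cubes k" "label (top_part M, F) = M" "code F = best k M"
proof -
  obtain T F where c: "(T, F) \<in> cubes k" "label (T, F) = M" using assms by force
  have "top_part M = T" using top_part_label[OF c(1)] c(2) by simp
  then have "best k M \<in> {code F |F. (top_part M, F) \<in> cubes k \<and> label (top_part M, F) = M}"
    unfolding best_def using c by (intro Max_in finite_codes) auto
  then show thesis using that by auto
qed

lemma code_eq_iff: "S \<subseteq> V \<Longrightarrow> S' \<subseteq> V \<Longrightarrow> code S = code S' \<longleftrightarrow> S = S'"
  using finite_subset[OF _ finite_vertices]
  by (simp add: set_encode_eq inj_on_image_eq_iff[OF p_inj])

lemma code_insert: "S \<subseteq> V \<Longrightarrow> x \<in> V \<Longrightarrow> x \<notin> S \<Longrightarrow> code (insert x S) = 2 ^ p x + code S"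
  using finite_subset[OF _ finite_vertices, of S] p_inj
  by (simp add: set_encode_insert inj_on_image_mem_iff)

lemma rank_inj: "inj_on (rank k) (label ` cubes k)"
proof (rule inj_onI)
  fix M M' assume M: "M \<in> label ` cubes k" and M': "M' \<in> label ` cubes k" and eq: "rank k M = rank k M'"
  obtain F where F: "(top_part M, F) \<in> cubes k" "label (top_part M, F) = M" "code F = best k M"
    using best_cube[OF M] .
  obtain F' where F': "(top_part M', F') \<in> cubes k" "label (top_part M', F') = M'" "code F' = best k M'"
    using best_cube[OF M'] .
  have "code (top_part M) = code (top_part M')" and best: "best k M = best k M'"
    using eq by (simp_all add: rank_def)
  then have T: "top_part M = top_part M'"
    by (rule_tac iffD1[OF code_eq_iff[OF cubesD(1)[OF F(1)] cubesD(1)[OF F'(1)]]])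
  have "code F = code F'" by (simp only: F(3) F'(3) best)
  then have "F = F'" by (rule iffD1[OF code_eq_iff[OF cubesD(2)[OF F(1)] cubesD(2)[OF F'(1)]]])
  then have "label (top_part M, F) = label (top_part M', F')" by (simp only: T)
  then show "M = M'" by (simp only: F(2) F'(2))
qed

text \<open>The clique of \<open>t\<close> contains no other vertex of \<open>T \<union> F\<close>,
  so its whisker leaves the label when \<open>t\<close> leaves \<open>T\<close>, and
  \<open>t\<close> itself enters. The same move yields the prescribed exchange of a whisker for a
  clique vertex and one of the two cases of the linear quotients.\<close>

lemma remove_top:
  assumes c: "(T, F) \<in> cubes k" and t: "t \<in> T"
  shows "(T - {t}, F) \<in> cubes k" "label (T - {t}, F) = insert (Inl t) (label (T, F) - {Inr (cl t)})"
    "rank k (label (T - {t}, F)) < rank k (label (T, F))"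
proof -
  note d = cubesD[OF c]
  have "T - {t} \<union> F \<in> indep" by (rule down[OF d(3)]) blast
  then show c': "(T - {t}, F) \<in> cubes k" using d by (auto simp: cubes_def)
  have 1: "cl ` (T - {t} \<union> F) = cl ` (T \<union> F) - {cl t}"
  proof -
    have "T - {t} \<union> F = T \<union> F - {t}" using d(4) t by blast
    then show ?thesis using inj_on_image_set_diff[OF cl_inj[OF d(3)], of "T \<union> F" "{t}"] t by simp
  qed
  have 2: "V - (T - {t}) = insert t (V - T)" using d(1) t by blast
  show "label (T - {t}, F) = insert (Inl t) (label (T, F) - {Inr (cl t)})"
  proof (intro Set.set_eqI)
    fix x
    show "x \<in> label (T - {t}, F) \<longleftrightarrow> x \<in> insert (Inl t) (label (T, F) - {Inr (cl t)})"
    proof (cases x)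
      case (Inl a)
      have "a \<in> V - (T - {t}) \<longleftrightarrow> a = t \<or> a \<in> V - T" using 2 by blast
      then show ?thesis using in_label_iff(1)[of a "(T - {t}, F)"] in_label_iff(1)[of a "(T, F)"] Inl by simp
    next
      case (Inr a)
      have "a \<in> cl ` (T - {t} \<union> F) \<longleftrightarrow> a \<in> cl ` (T \<union> F) \<and> a \<noteq> cl t" using 1 by blast
      then show ?thesis
        using in_label_iff(2)[of a "(T - {t}, F)"] in_label_iff(2)[of a "(T, F)"] Inr by simp
    qed
  qed
  have "code T = 2 ^ p t + code (T - {t})"
    using code_insert[of "T - {t}" t] d(1) t by (simp add: insert_absorb subset_iff)
  then have "code (T - {t}) < code T" by simp
  then show "rank k (label (T - {t}, F)) < rank k (label (T, F))"
    by (simp add: rank_def top_part_label[OF c'] top_part_label[OF c])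
qed

text \<open>The vertex \<open>x\<close> where \<open>F'\<close> first beats \<open>F\<close> in the lexicographic order has at most one neighbour in \<open>F\<close>,
  because its neighbours there come later in the elimination order.\<close>

lemma exchange:
  assumes c: "(T, F) \<in> cubes k" and c': "(T, F') \<in> cubes k" and less: "code F < code F'"
    and best: "\<And>F''. (T, F'') \<in> cubes k \<Longrightarrow> label (T, F'') = label (T, F) \<Longrightarrow> code F'' \<le> code F"
  obtains x F'' where "x \<in> F'" "cl x \<notin> cl ` (T \<union> F)" "(T, F'') \<in> cubes k" "code F < code F''"
    "label (T, F'') \<subseteq> insert (Inr (cl x)) (label (T, F))"
proof -
  note d = cubesD[OF c] and d' = cubesD[OF c']
  \<comment> \<open>Since codes are compared from the top bit, \<open>n\<close> is the largest
    position at which \<open>F\<close> and \<open>F'\<close> differ.\<close>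
  obtain n where n: "n \<in> p ` F'" "n \<notin> p ` F" and agree: "\<And>m. n < m \<Longrightarrow> m \<in> p ` F \<longleftrightarrow> m \<in> p ` F'"
    using set_encode_first_difference[OF _ _ less] d(7) d'(7) by auto
  obtain x where x: "x \<in> F'" "n = p x" using n(1) by blast
  have xF: "x \<notin> F" "x \<in> V" "x \<notin> T" using n(2) x d'(2,4) by auto
  have later: "y \<in> F'" if y: "y \<in> F" "p x < p y" for y
  proof -
    have "p y \<in> p ` F'" using agree[of "p y"] y x(2) by blast
    then show ?thesis using inj_on_image_mem_iff[OF p_inj _ d'(2)] y d(2) by blast
  qed
  have ind: "\<not> R a b" if "a \<in> T \<union> F" "b \<in> T \<union> F" for a b using d(3) that by (simp add: indep_def)
  have ind': "\<not> R a b" if "a \<in> T \<union> F'" "b \<in> T \<union> F'" for a b using d'(3) that by (simp add: indep_def)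
  have p_ne: "p y \<noteq> p x" if "y \<in> F" for y
    using n(2) x(2) imageI[OF that, of p] by auto
  have nbr: "p y < p x" if "y \<in> F" "R x y" for y
  proof (rule ccontr)
    assume "\<not> p y < p x"
    then have "y \<in> F'" using later[OF that(1)] p_ne[OF that(1)] by simp
    then show False using ind'[of x y] x(1) that(2) by blast
  qed
  have unique: "y = z" if y: "y \<in> F" "R x y" and z: "z \<in> F" "R x z" for y z
  proof (rule ccontr)
    assume "y \<noteq> z"
    moreover have "y \<in> {y \<in> V. p y < p x}" "z \<in> {y \<in> V. p y < p x}" using nbr y z d(2) by auto
    ultimately have "R y z" using elim[OF xF(2)] y(2) z(2) by (simp add: simplicial_def)
    then show False using ind[of y z] y z by blast
  qed
  \<comment> \<open>The vertex to give up for \<open>x\<close> is its neighbour in \<open>F\<close>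
    if there is one, and otherwise any vertex of \<open>F\<close> at an earlier position. The latter
    exists, for if all of \<open>F\<close> came later than \<open>x\<close>, then \<open>F\<close>
    would be a proper subset of \<open>F'\<close> despite equal cardinalities.\<close>
  obtain y where y: "y \<in> F" "p y < p x" "\<And>z. z \<in> F \<Longrightarrow> R x z \<Longrightarrow> z = y"
  proof (cases "\<exists>y\<in>F. R x y")
    case True
    then obtain y where "y \<in> F" "R x y" by blast
    then show thesis using that[of y] nbr unique by blast
  next
    case False
    have "\<exists>y\<in>F. p y < p x"
    proof (rule ccontr)
      assume "\<not> (\<exists>y\<in>F. p y < p x)"
      then have "p x < p y" if "y \<in> F" for y using p_ne[OF that] that by (meson linorder_neqE_nat)
      then have "y \<in> F'" if "y \<in> F" for y using later that by blast
      then have "F \<subseteq> F'" by blast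
      then have "F \<subset> F'" using x(1) xF(1) by blast
      then have "card F < card F'" by (rule psubset_card_mono[OF d'(7)])
      then show False using d(5) d'(5) by simp
    qed
    then show thesis using that False by blast
  qed
  define F'' where "F'' = insert x (F - {y})"
  have c'': "(T, F'') \<in> cubes k"
  proof -
    have "\<not> R a b" if ab: "a \<in> T \<union> F''" "b \<in> T \<union> F''" for a b
    proof -
      have x_only: "\<not> R x e" if "e \<in> T \<union> F''" for e
        using that y(3)[of e] ind'[of x e] x(1) R_irrefl by (auto simp: F''_def)
      have "a = x \<or> b = x \<or> (a \<in> T \<union> F \<and> b \<in> T \<union> F)" using ab by (auto simp: F''_def)
      then show ?thesis using x_only[OF ab(1)] x_only[OF ab(2)] R_sym[of a b] ind[of a b] by blast
    qed
    then have "T \<union> F'' \<in> indep" using d(1,2) xF(2) by (auto simp: indep_def F''_def)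
    moreover have "T \<inter> F'' = {}" using d(4) xF(3) by (auto simp: F''_def)
    moreover have "card F'' = k" using d(5,7) y(1) xF(1) card_Suc_Diff1[OF d(7) y(1)] by (simp add: F''_def)
    ultimately show ?thesis by (simp add: cubes_def)
  qed
  have code: "code F < code F''"
  proof -
    have "code F = 2 ^ p y + code (F - {y})"
      using code_insert[of "F - {y}" y] d(2) y(1) by (simp add: insert_absorb subset_iff)
    moreover have "code F'' = 2 ^ p x + code (F - {y})"
      unfolding F''_def using d(2) xF by (intro code_insert) auto
    ultimately show ?thesis using y(2) by simp
  qed
  \<comment> \<open>If the clique of \<open>x\<close> were already met, it would be met in a
    neighbour of \<open>x\<close>, which lies in \<open>F\<close> and therefore is \<open>y\<close>.
    Then \<open>F''\<close> would have the same label as \<open>F\<close> and a larger code, against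
    the choice of \<open>F\<close>.\<close>
  have cl: "cl x \<notin> cl ` (T \<union> F)"
  proof
    assume "cl x \<in> cl ` (T \<union> F)"
    then obtain z where z: "z \<in> T \<union> F" "cl x = cl z" by blast
    have "R x z" using z xF d(1,2) by (intro cl_adjacent) auto
    then have "z \<in> F" using z(1) ind'[of x z] x(1) by blast
    then have "z = y" using y(3) \<open>R x z\<close> by blast
    then have "cl ` F'' = cl ` F" using z(2) y(1) by (auto simp: F''_def)
    then have "label (T, F'') = label (T, F)" by (simp add: label_def image_Un)
    then show False using best[OF c''] code by simp
  qed
  have "label (T, F'') \<subseteq> insert (Inr (cl x)) (label (T, F))" by (auto simp: label_def F''_def)
  then show thesis using that[OF x(1) cl c'' code] by blast
qed

text \<open>If the \<open>T\<close> of \<open>M\<close> is not contained in that of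
  \<open>M'\<close>, removing a vertex of the difference costs one variable \<open>Inl t\<close>,
  which belongs to \<open>M'\<close>. Otherwise both have the same \<open>T\<close>, and
  \<open>exchange\<close> on the best representatives costs one whisker of
  \<open>M'\<close>.\<close>

lemma label_quotients:
  assumes M: "M \<in> label ` cubes k" and M': "M' \<in> label ` cubes k" and less: "rank k M' < rank k M"
  shows "\<exists>x\<in>M' - M. \<exists>M''\<in>label ` cubes k. rank k M'' < rank k M \<and> M'' \<subseteq> insert x M"
proof -
  obtain F where F: "(top_part M, F) \<in> cubes k" "label (top_part M, F) = M" "code F = best k M"
    using best_cube[OF M] .
  obtain F' where F': "(top_part M', F') \<in> cubes k" "label (top_part M', F') = M'" "code F' = best k M'"
    using best_cube[OF M'] .
  let ?T = "top_part M" and ?T' = "top_part M'"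
  show ?thesis
  proof (cases "?T \<subseteq> ?T'")
    case False
    then obtain t where t: "t \<in> ?T" "t \<notin> ?T'" by blast
    have "Inl t \<in> M' - M" using t by (auto simp: top_part_def)
    moreover have "label (?T - {t}, F) \<in> label ` cubes k" using remove_top(1)[OF F(1) t(1)] by blast
    moreover have "rank k (label (?T - {t}, F)) < rank k M" "label (?T - {t}, F) \<subseteq> insert (Inl t) M"
      using remove_top(2,3)[OF F(1) t(1)] F(2) by auto
    ultimately show ?thesis by blast
  next
    case True
    \<comment> \<open>Inclusion bounds the codes one way and the ranks bound them the other way, so
      they agree and the comparison is decided by \<open>best\<close>.\<close>
    have "code ?T \<le> code ?T'"
      by (rule set_encode_mono) (use True cubesD(6)[OF F'(1)] in auto)
    then have eq: "code ?T = code ?T'" and best: "best k M < best k M'"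
      using less by (auto simp: rank_def)
    then have T: "?T' = ?T" using code_eq_iff[OF cubesD(1)[OF F(1)] cubesD(1)[OF F'(1)]] by simp
    obtain x F'' where x: "x \<in> F'" "cl x \<notin> cl ` (?T \<union> F)" "(?T, F'') \<in> cubes k" "code F < code F''"
      "label (?T, F'') \<subseteq> insert (Inr (cl x)) (label (?T, F))"
    proof (rule exchange[OF F(1), of F'])
      show "(?T, F') \<in> cubes k" using F'(1) T by simp
      show "code F < code F'" using best F(3) F'(3) by simp
      show "code F'' \<le> code F" if "(?T, F'') \<in> cubes k" "label (?T, F'') = label (?T, F)" for F''
        using best_ge[OF that(1)] that(2) F(2,3) by simp
    qed
    have "Inr (cl x) \<in> M'" using x(1) F'(2) in_label_iff(2)[of "cl x" "(?T', F')"] by auto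
    moreover have "Inr (cl x) \<notin> M" using x(2) F(2) in_label_iff(2)[of "cl x" "(?T, F)"] by auto
    moreover have "rank k (label (?T, F'')) < rank k M"
    proof -
      have "best k M < best k (label (?T, F''))" using best_ge[OF x(3) refl] x(4) F(3) by simp
      then show ?thesis by (simp add: rank_def top_part_label[OF x(3)])
    qed
    ultimately show ?thesis using x(3,5) F(2) by (intro bexI[of _ "Inr (cl x)"] bexI[of _ "label (?T, F'')"]) auto
  qed
qed

text \<open>The vertices missing from \<open>V - T\<close> are compensated by the whiskers of
  \<open>T\<close>, one per vertex since \<open>cl\<close> is injective on faces. As the size
  depends on \<open>k\<close> only, no label of a \<open>k\<close>-dimensional cube properly
  contains another.\<close>

lemma card_label:
  assumes c: "(T, F) \<in> cubes k"
  shows "card (label (T, F)) = card V + k"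
proof -
  note d = cubesD[OF c]
  have "card (label (T, F)) = card (Inl ` (V - T) :: ('a + 'b) set) + card (Inr ` cl ` (T \<union> F) :: ('a + 'b) set)"
    unfolding label_def fst_conv snd_conv using finite_vertices d(6,7) by (intro card_Un_disjoint) auto
  also have "\<dots> = card (V - T) + card (T \<union> F)"
    using card_image[OF cl_inj[OF d(3)]] by (simp add: card_image)
  also have "\<dots> = card V - card T + (card T + k)"
    using d by (simp add: card_Diff_subset card_Un_disjoint)
  also have "\<dots> = card V + k" using card_mono[OF finite_vertices d(1)] by simp
  finally show ?thesis .
qed

lemma linear_quotients_labels:
  defines "S \<equiv> \<lambda>k. sqfree ` label ` cubes k"
  shows "min_gens X (Idl\<^bsub>mpoly_ring X\<^esub> (mon ` S k :: ('a + 'b, 'k::field) mpoly set)) = S k"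
    and "linear_quotients_wrt X (Idl\<^bsub>mpoly_ring X\<^esub> (mon ` S k :: ('a + 'b, 'k) mpoly set))
      {(s, t). s \<in> S k \<and> t \<in> S k \<and> rank k (Poly_Mapping.keys s) < rank k (Poly_Mapping.keys t)}"
proof -
  have fin: "finite M" and MX: "M \<subseteq> X" and card: "card M = card V + k" if M: "M \<in> label ` cubes k" for M
  proof -
    obtain T F where "(T, F) \<in> cubes k" "M = label (T, F)" using M by force
    then show "finite M" "M \<subseteq> X" "card M = card V + k"
      using finite_label label_subset card_label by simp_all
  qed
  have SX: "Poly_Mapping.keys s \<subseteq> X" if s: "s \<in> S k" for s
  proof -
    obtain M where "M \<in> label ` cubes k" "s = sqfree M" using s unfolding S_def by blast
    then show ?thesis using fin MX by simp
  qed
  show gens: "min_gens X (Idl\<^bsub>mpoly_ring X\<^esub> (mon ` S k :: ('a + 'b, 'k) mpoly set)) = S k"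
  proof (rule min_gens_antichain[OF SX])
    fix s t assume "s \<in> S k" "t \<in> S k" and le: "s \<preceq> t"
    then obtain M N where M: "M \<in> label ` cubes k" "s = sqfree M" and N: "N \<in> label ` cubes k" "t = sqfree N"
      unfolding S_def by blast
    have "M \<subseteq> N" using le M N fin by (simp add: sqfree_mle_iff)
    then have "M = N" using card_subset_eq[OF fin[OF N(1)]] card[OF M(1)] card[OF N(1)] by simp
    then show "s = t" using M N by simp
  qed
  show "linear_quotients_wrt X (Idl\<^bsub>mpoly_ring X\<^esub> (mon ` S k :: ('a + 'b, 'k) mpoly set))
      {(s, t). s \<in> S k \<and> t \<in> S k \<and> rank k (Poly_Mapping.keys s) < rank k (Poly_Mapping.keys t)}"
  proof (rule linear_quotients_by_key[OF _ SX gens])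
    show "finite (S k)" using finite_cubes by (simp add: S_def)
    show "inj_on (\<lambda>s. rank k (Poly_Mapping.keys s)) (S k)"
    proof (rule inj_onI)
      fix s t assume "s \<in> S k" "t \<in> S k" and eq: "rank k (Poly_Mapping.keys s) = rank k (Poly_Mapping.keys t)"
      then obtain M N where M: "M \<in> label ` cubes k" "s = sqfree M" and N: "N \<in> label ` cubes k" "t = sqfree N"
        unfolding S_def by blast
      then have "M = N" using eq fin inj_onD[OF rank_inj _ M(1) N(1)] by simp
      then show "s = t" using M N by simp
    qed
    fix s u assume "s \<in> S k" "u \<in> S k" and less: "rank k (Poly_Mapping.keys s) < rank k (Poly_Mapping.keys u)"
    then obtain M N where M: "M \<in> label ` cubes k" "s = sqfree M" and N: "N \<in> label ` cubes k" "u = sqfree N"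
      unfolding S_def by blast
    have "rank k M < rank k N" using less M N fin by simp
    from label_quotients[OF N(1) M(1) this] obtain x N' where
      x: "x \<in> M - N" "N' \<in> label ` cubes k" "rank k N' < rank k N" "N' \<subseteq> insert x N" by blast
    have "Poly_Mapping.lookup u x < Poly_Mapping.lookup s x"
      using x(1) M N fin by (simp add: lookup_sqfree)
    moreover have "sqfree N' \<preceq> Poly_Mapping.single x 1 + u"
      using x(4) N fin[OF x(2)] fin[OF N(1)] by (auto simp: sqfree_mle_iff keys_add_nat)
    moreover have "sqfree N' \<in> S k" using x(2) unfolding S_def by blast
    moreover have "rank k (Poly_Mapping.keys (sqfree N')) < rank k (Poly_Mapping.keys u)"
      using x(2,3) N fin by simp
    moreover have "x \<in> X" using x(1) MX[OF M(1)] by blast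
    ultimately show "\<exists>x\<in>X. Poly_Mapping.lookup u x < Poly_Mapping.lookup s x \<and>
        (\<exists>t\<in>S k. rank k (Poly_Mapping.keys t) < rank k (Poly_Mapping.keys u) \<and> t \<preceq> Poly_Mapping.single x 1 + u)"
      by blast
  qed
qed

text \<open>Absence of \<open>Inl w\<close> means that \<open>w\<close> belongs to \<open>T\<close>,
  so the swap is \<open>remove_top\<close> at \<open>w\<close>. Divisibility by
  \<open>Inr (cl w)\<close> makes the truncated subtraction exact.\<close>

lemma swap_label:
  assumes \<alpha>: "\<alpha> \<in> sqfree ` label ` cubes k" and w: "w \<in> V"
    and "Inr (cl w) \<in> Poly_Mapping.keys \<alpha>" "Inl w \<notin> Poly_Mapping.keys \<alpha>"
  defines "\<alpha>' \<equiv> \<alpha> - Poly_Mapping.single (Inr (cl w)) 1 + Poly_Mapping.single (Inl w) 1"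
  shows "\<alpha>' \<in> sqfree ` label ` cubes k" "rank k (Poly_Mapping.keys \<alpha>') < rank k (Poly_Mapping.keys \<alpha>)"
proof -
  obtain T F where c: "(T, F) \<in> cubes k" "\<alpha> = sqfree (label (T, F))" using \<alpha> by force
  have keys: "Poly_Mapping.keys \<alpha> = label (T, F)" using c finite_label by simp
  then have wT: "w \<in> T" using assms(4) w by (simp add: in_label_iff)
  note r = remove_top[OF c(1) wT]
  have fin: "finite (label (T, F))" "finite (label (T - {w}, F))" using finite_label c(1) r(1) by auto
  have "\<alpha>' = sqfree (label (T - {w}, F))"
  proof (rule poly_mapping_eqI)
    fix x
    show "Poly_Mapping.lookup \<alpha>' x = Poly_Mapping.lookup (sqfree (label (T - {w}, F))) x"
      unfolding \<alpha>'_def c(2) lookup_add lookup_minus lookup_sqfree[OF fin(1)] lookup_sqfree[OF fin(2)]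
      using assms(3,4) unfolding keys r(2) by (auto simp: lookup_single when_def)
  qed
  then show "\<alpha>' \<in> sqfree ` label ` cubes k" "rank k (Poly_Mapping.keys \<alpha>') < rank k (Poly_Mapping.keys \<alpha>)"
    using r(1,3) keys fin by auto
qed

end

subsection \<open>Clique-whiskered graphs\<close>

text \<open>\<open>G\<close> is an induced subgraph of the whiskered graph, so a long induced cycle
  of \<open>G\<close> would remain one there.\<close>

lemma chordal_on_clique_whiskered:
  assumes ch: "chordal (clique_whiskered G P)"
  shows "chordal_on (\<lambda>u v. {u, v} \<in> edges G) (verts G)"
  unfolding chordal_on_def
proof (rule notI, elim exE conjE)
  fix vs
  assume len: "4 \<le> length vs" and dist: "distinct vs" and sub: "set vs \<subseteq> verts G"
    and adj: "\<forall>i j. i < j \<and> j < length vs \<longrightarrow>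
      ({vs ! i, vs ! j} \<in> edges G \<longleftrightarrow> j = Suc i \<or> i = 0 \<and> Suc j = length vs)"
  let ?H = "clique_whiskered G P" and ?us = "map Inl vs :: ('a + 'a set) list"
  have edge: "{Inl a, Inl b} \<in> edges ?H \<longleftrightarrow> {a, b} \<in> edges G" for a b
  proof -
    have "inj (\<lambda>e. Inl ` e :: ('a + 'a set) set)" by (simp add: inj_def inj_image_eq_iff)
    from inj_image_mem_iff[OF this, of "{a, b}" "edges G"]
    have "{Inl a, Inl b} \<in> (\<lambda>e. Inl ` e :: ('a + 'a set) set) ` edges G \<longleftrightarrow> {a, b} \<in> edges G" by simp
    moreover have "{Inl a, Inl b} \<notin> {{Inr A, Inl w} |A w. A \<in> P \<and> w \<in> A}"
      by (auto simp: doubleton_eq_iff)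
    ultimately show ?thesis unfolding clique_whiskered_def snd_conv Un_iff by blast
  qed
  have "induced_cycle ?H ?us"
    unfolding induced_cycle_def
  proof (intro conjI allI impI)
    show "set ?us \<subseteq> verts ?H" using sub by (auto simp: clique_whiskered_def)
    fix i j assume "i < j \<and> j < length ?us"
    then show "({?us ! i, ?us ! j} \<in> edges ?H) = (j = Suc i \<or> i = 0 \<and> Suc j = length ?us)"
      using adj edge by simp
  qed (use len dist in \<open>simp_all add: distinct_map\<close>)
  then show False using ch len unfolding chordal_def by (metis length_map)
qed

locale whiskered = clique_ordered V R cl p X
  for V :: "'a set" and R cl p and X :: "('a + 'a set) set" +
  fixes G :: "'a graph" and P :: "'a set set"
  assumes V_verts: "V = verts G" and R_edges: "R u v \<longleftrightarrow> {u, v} \<in> edges G"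
    and simple: "finite_simple_graph G"
    and X_whisk: "X = verts (clique_whiskered G P)"
    and cl_mem: "w \<in> V \<Longrightarrow> cl w \<in> P \<and> w \<in> cl w"
    and cl_unique: "A \<in> P \<Longrightarrow> w \<in> A \<Longrightarrow> w \<in> V \<and> cl w = A"
begin

lemma vertex_cover_iff:
  "vertex_cover (clique_whiskered G P) C \<longleftrightarrow> C \<subseteq> X \<and>
     (\<forall>u v. R u v \<longrightarrow> Inl u \<in> C \<or> Inl v \<in> C) \<and> (\<forall>w\<in>V. Inr (cl w) \<in> C \<or> Inl w \<in> C)"
  (is "_ \<longleftrightarrow> _ \<and> ?E \<and> ?W")
proof -
  have "(\<forall>e\<in>(\<lambda>e. Inl ` e) ` edges G. e \<inter> C \<noteq> {}) \<longleftrightarrow> ?E"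
  proof
    assume a: "\<forall>e\<in>(\<lambda>e. Inl ` e) ` edges G. e \<inter> C \<noteq> {}"
    show ?E
    proof (intro allI impI)
      fix u v assume "R u v"
      then have "Inl ` {u, v} \<in> (\<lambda>e. Inl ` e :: ('a + 'a set) set) ` edges G" using R_edges by blast
      then have "Inl ` {u, v} \<inter> C \<noteq> {}" using a by blast
      then show "Inl u \<in> C \<or> Inl v \<in> C" by auto
    qed
  next
    assume E: ?E
    show "\<forall>e\<in>(\<lambda>e. Inl ` e) ` edges G. e \<inter> C \<noteq> {}"
    proof (intro ballI)
      fix e' assume "e' \<in> (\<lambda>e. Inl ` e :: ('a + 'a set) set) ` edges G"
      then obtain e where e: "e \<in> edges G" "e' = Inl ` e" by blast
      have "card e = 2" using simple e(1) by (simp add: finite_simple_graph_def)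
      then obtain u v where "e = {u, v}" by (meson card_2_iff)
      then have "Inl u \<in> C \<or> Inl v \<in> C" using E e(1) R_edges by simp
      then show "e' \<inter> C \<noteq> {}" using e(2) \<open>e = {u, v}\<close> by auto
    qed
  qed
  moreover have "(\<forall>e\<in>{{Inr A, Inl w} |A w. A \<in> P \<and> w \<in> A}. e \<inter> C \<noteq> {}) \<longleftrightarrow> ?W"
  proof
    assume a: "\<forall>e\<in>{{Inr A, Inl w} |A w. A \<in> P \<and> w \<in> A}. e \<inter> C \<noteq> {}"
    show ?W
    proof
      fix w assume "w \<in> V"
      then have "{Inr (cl w), Inl w} \<in> {{Inr A, Inl w} |A w. A \<in> P \<and> w \<in> A}" using cl_mem by blast
      then have "{Inr (cl w), Inl w} \<inter> C \<noteq> {}" using a by blast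
      then show "Inr (cl w) \<in> C \<or> Inl w \<in> C" by blast
    qed
  next
    assume W: ?W
    show "\<forall>e\<in>{{Inr A, Inl w} |A w. A \<in> P \<and> w \<in> A}. e \<inter> C \<noteq> {}"
    proof
      fix e assume "e \<in> {{Inr A, Inl w} |A w. A \<in> P \<and> w \<in> A}"
      then obtain A w where Aw: "e = {Inr A, Inl w}" "A \<in> P" "w \<in> A" by blast
      then have "Inr A \<in> C \<or> Inl w \<in> C" using W cl_unique[of A w] by auto
      then show "e \<inter> C \<noteq> {}" using Aw(1) by blast
    qed
  qed
  moreover have "edges (clique_whiskered G P) =
      (\<lambda>e. Inl ` e) ` edges G \<union> {{Inr A, Inl w} |A w. A \<in> P \<and> w \<in> A}"
    by (simp add: clique_whiskered_def)
  ultimately show ?thesis unfolding vertex_cover_def X_whisk by (simp only: ball_Un)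
qed

lemma label_cover:
  assumes T: "T \<in> indep"
  shows "vertex_cover (clique_whiskered G P) (label (T, {}))"
  unfolding vertex_cover_iff
proof (intro conjI allI impI ballI)
  have c: "(T, {}) \<in> cubes 0" using T by (simp add: cubes_def)
  show "label (T, {}) \<subseteq> X" by (rule label_subset[OF c])
  fix u v assume uv: "R u v"
  have "{u, v} \<subseteq> V" using uv R_edges simple unfolding finite_simple_graph_def V_verts by blast
  moreover have "u \<notin> T \<or> v \<notin> T" using uv T by (auto simp: indep_def)
  ultimately show "Inl u \<in> label (T, {}) \<or> Inl v \<in> label (T, {})" by (auto simp: in_label_iff)
next
  fix w assume "w \<in> V"
  then show "Inr (cl w) \<in> label (T, {}) \<or> Inl w \<in> label (T, {})" by (auto simp: in_label_iff)
qed

text \<open>No edge joins two vertices of \<open>G\<close> left out by a cover, and each vertex left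
  out forces the whisker of its clique into the cover. Every cover thus contains the one attached to
  an independent set.\<close>

lemma cover_top_part:
  assumes C: "vertex_cover (clique_whiskered G P) C"
  shows "top_part C \<in> indep" "label (top_part C, {}) \<subseteq> C"
proof -
  have e: "\<And>u v. R u v \<Longrightarrow> Inl u \<in> C \<or> Inl v \<in> C" and w: "\<And>w. w \<in> V \<Longrightarrow> Inr (cl w) \<in> C \<or> Inl w \<in> C"
    using C unfolding vertex_cover_iff by simp_all
  show "top_part C \<in> indep" using e by (auto simp: indep_def top_part_def)
  show "label (top_part C, {}) \<subseteq> C"
  proof
    fix x assume "x \<in> label (top_part C, {})"
    then show "x \<in> C" using w by (cases x) (auto simp: in_label_iff top_part_def)
  qed
qed

lemma minimal_vertex_cover_iff:
  "minimal_vertex_cover (clique_whiskered G P) C \<longleftrightarrow> C \<in> label ` cubes 0"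
proof
  assume C: "minimal_vertex_cover (clique_whiskered G P) C"
  then have cov: "vertex_cover (clique_whiskered G P) C" by (simp add: minimal_vertex_cover_def)
  note t = cover_top_part[OF cov]
  have "\<not> label (top_part C, {}) \<subset> C" using C label_cover[OF t(1)] by (auto simp: minimal_vertex_cover_def)
  then have "C = label (top_part C, {})" using t(2) by blast
  moreover have "(top_part C, {}) \<in> cubes 0" using t(1) by (simp add: cubes_def)
  ultimately show "C \<in> label ` cubes 0" by blast
next
  assume "C \<in> label ` cubes 0"
  then obtain T F where c: "(T, F) \<in> cubes 0" "C = label (T, F)" by force
  have F: "F = {}" and T: "T \<in> indep" using cubesD(3,5,7)[OF c(1)] by auto
  have "\<not> vertex_cover (clique_whiskered G P) D" if D: "D \<subset> C" for D
  proof
    assume cov: "vertex_cover (clique_whiskered G P) D"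
    note t = cover_top_part[OF cov]
    have sub: "D \<subseteq> label (T, {})" using D c(2) F by simp
    have TD: "T \<subseteq> top_part D"
    proof
      fix w assume w: "w \<in> T"
      then have "Inl w \<notin> label (T, {})" by (simp add: in_label_iff)
      then show "w \<in> top_part D" using sub w T by (auto simp: top_part_def indep_def)
    qed
    moreover have "top_part D \<subseteq> T"
    proof
      \<comment> \<open>The whisker forced by \<open>w\<close> lies in the cover of
        \<open>T\<close>, so some \<open>u\<close> in \<open>T\<close> shares the clique of
        \<open>w\<close>. Both are left out by \<open>D\<close>, and independence makes them
        equal.\<close>
      fix w assume w: "w \<in> top_part D"
      then have "w \<in> V" by (simp add: top_part_def)
      have "Inr (cl w) \<in> label (top_part D, {})" using w by (simp add: in_label_iff)
      then have "Inr (cl w) \<in> label (T, {})" using t(2) sub by blast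
      then obtain u where u: "u \<in> T" "cl w = cl u" by (auto simp: in_label_iff)
      have "u \<in> top_part D" using u(1) TD by blast
      then have "\<not> R w u" "u \<in> V" using t(1) w by (auto simp: indep_def)
      then have "w = u" using cl_adjacent[OF \<open>w \<in> V\<close> _ u(2)] by blast
      then show "w \<in> T" using u(1) by simp
    qed
    ultimately have "top_part D = T" by blast
    then show False using t(2) D c(2) F by auto
  qed
  then show "minimal_vertex_cover (clique_whiskered G P) C"
    using label_cover[OF T] c(2) F by (simp add: minimal_vertex_cover_def)
qed

lemma cover_ideal_labels:
  "(cover_ideal (clique_whiskered G P) :: ('a + 'a set, 'k::field) mpoly set)
    = Idl\<^bsub>mpoly_ring X\<^esub> (mon ` (\<lambda>c. sqfree (label c)) ` cubes 0)"
proof -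
  have "{\<Prod>v\<in>C. var v |C. minimal_vertex_cover (clique_whiskered G P) C}
    = (mon ` (\<lambda>c. sqfree (label c)) ` cubes 0 :: ('a + 'a set, 'k) mpoly set)"
    unfolding minimal_vertex_cover_iff prod_var by auto
  then show ?thesis unfolding cover_ideal_def X_whisk by simp
qed

lemma HS_labels:
  "HS X k (cover_ideal (clique_whiskered G P) :: ('a + 'a set, 'k::field) mpoly set)
    = Idl\<^bsub>mpoly_ring X\<^esub> (mon ` sqfree ` label ` cubes k)"
  unfolding HS_def cover_ideal_labels multigraded_shifts_labels by (simp only: image_image)

end

theorem theorem2p11:
  fixes G :: "'a graph" and P :: "'a set set" and k :: nat
  assumes "finite_simple_graph G"
    and "clique_vertex_partition G P"
    and "chordal (clique_whiskered G P)"
    and "cohen_macaulay_graph TYPE('k::field) (clique_whiskered G P)"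
  shows "let H = clique_whiskered G P;
             X = verts H;
             J = (cover_ideal H :: ('a + 'a set, 'k) mpoly set);
             I = HS X k J
         in \<exists>gt. linear_quotients_wrt X I gt \<and>
              (\<forall>A\<in>P. \<forall>w\<in>A. \<forall>\<alpha>\<in>min_gens X I.
                 Inr A \<in> Poly_Mapping.keys \<alpha> \<and> Inl w \<notin> Poly_Mapping.keys \<alpha> \<longrightarrow>
                 (let \<alpha>' = \<alpha> - Poly_Mapping.single (Inr A) 1 + Poly_Mapping.single (Inl w) 1
                  in \<alpha>' \<in> min_gens X I \<and> (\<alpha>', \<alpha>) \<in> gt))"
proof -
  define V where "V = verts G"
  define R where "R u v \<longleftrightarrow> {u, v} \<in> edges G" for u v
  \<comment> \<open>The description is meaningful on \<open>V\<close> only: each vertex lies in a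
    member of \<open>P\<close>, and by disjointness in just one.\<close>
  define cl where "cl w = (THE A. A \<in> P \<and> w \<in> A)" for w
  define X where "X = verts (clique_whiskered G P)"
  have finV: "finite V" using assms(1) by (simp add: V_def finite_simple_graph_def)
  have sym: "R u v \<Longrightarrow> R v u" for u v by (simp add: R_def insert_commute)
  have irr: "\<not> R u u" for u using assms(1) by (auto simp: R_def finite_simple_graph_def)
  have "chordal_on R V"
    using chordal_on_clique_whiskered[OF assms(3)] unfolding R_def[abs_def] V_def .
  from perfect_elimination[of R, OF sym irr finV this] obtain p :: "'a \<Rightarrow> nat"
    where p: "inj_on p V" "\<And>x. x \<in> V \<Longrightarrow> simplicial R {y \<in> V. p y < p x} x" by blast
  have part: "\<And>A. A \<in> P \<Longrightarrow> clique G A" "disjoint P" "\<Union>P = V"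
    using assms(2) by (simp_all add: clique_vertex_partition_def V_def)
  have cl_unique: "w \<in> V \<and> cl w = A" if "A \<in> P" "w \<in> A" for A w
  proof -
    have uniq: "B = A" if "B \<in> P \<and> w \<in> B" for B
      using disjointD[OF part(2), of B A] that \<open>A \<in> P\<close> \<open>w \<in> A\<close> by blast
    have "cl w = A" unfolding cl_def using conjI[OF that] uniq by (rule the_equality)
    then show ?thesis using that part(3) by blast
  qed
  have cl_mem: "cl w \<in> P \<and> w \<in> cl w" if w: "w \<in> V" for w
  proof -
    obtain A where "A \<in> P" "w \<in> A" using w part(3) by blast
    then show ?thesis using cl_unique by simp
  qed
  have clR: "R x y" if "x \<in> V" "y \<in> V" "cl x = cl y" "x \<noteq> y" for x y
  proof -
    have "clique G (cl x)" "x \<in> cl x" "y \<in> cl x" 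
      using part(1)[of "cl x"] cl_mem[of x] cl_mem[of y] that by simp_all
    then show ?thesis using that(4) by (simp add: clique_def R_def)
  qed
  \<comment> \<open>Equality may fail: \<open>P\<close> may contain the empty clique, whose whisker
    is an isolated vertex and is not of the form \<open>Inr (cl w)\<close> with \<open>w\<close> in
    \<open>V\<close>.\<close>
  have XV: "Inl ` V \<union> Inr ` cl ` V \<subseteq> X"
    using cl_mem by (auto simp: X_def clique_whiskered_def V_def)
  interpret clique_ordered V R cl p X
    by (rule clique_ordered.intro[OF finV sym irr clR p XV])
  interpret whiskered V R cl p X G P
    by unfold_locales (simp_all add: V_def[symmetric] R_def X_def assms(1) cl_mem cl_unique)
  let ?S = "sqfree ` label ` cubes k"
  let ?I = "HS X k (cover_ideal (clique_whiskered G P) :: ('a + 'a set, 'k) mpoly set)"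
  let ?gt = "{(s, t). s \<in> ?S \<and> t \<in> ?S \<and> rank k (Poly_Mapping.keys s) < rank k (Poly_Mapping.keys t)}"
  have gens: "min_gens X ?I = ?S" and lq: "linear_quotients_wrt X ?I ?gt"
    unfolding HS_labels by (rule linear_quotients_labels)+
  have swap: "\<alpha> - Poly_Mapping.single (Inr A) 1 + Poly_Mapping.single (Inl w) 1 \<in> ?S \<and>
      (\<alpha> - Poly_Mapping.single (Inr A) 1 + Poly_Mapping.single (Inl w) 1, \<alpha>) \<in> ?gt"
    if A: "A \<in> P" "w \<in> A" and \<alpha>: "\<alpha> \<in> ?S" "Inr A \<in> Poly_Mapping.keys \<alpha>" "Inl w \<notin> Poly_Mapping.keys \<alpha>" for A w \<alpha>
  proof -
    have w: "w \<in> V" "cl w = A" using cl_unique[OF A] by auto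
    show ?thesis using swap_label[OF \<alpha>(1) w(1)] \<alpha> w(2) by simp
  qed
  show ?thesis
    unfolding Let_def X_def[symmetric] gens
  proof (intro exI[of _ ?gt] conjI[OF lq] ballI impI)
    fix A w \<alpha>
    assume "A \<in> P" "w \<in> A" "\<alpha> \<in> ?S"
      and "Inr A \<in> Poly_Mapping.keys \<alpha> \<and> Inl w \<notin> Poly_Mapping.keys \<alpha>"
    then show "\<alpha> - Poly_Mapping.single (Inr A) 1 + Poly_Mapping.single (Inl w) 1 \<in> ?S \<and>
      (\<alpha> - Poly_Mapping.single (Inr A) 1 + Poly_Mapping.single (Inl w) 1, \<alpha>) \<in> ?gt"
      by (elim conjE) (rule swap)
  qed
qed

end
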